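(* Fix any $0<\delta\le\frac1e$. Let $X\subset\mathbb{R}^d$, $|X|=n$, and suppose $C^*$ is a $(b_o,\alpha)$-stable stationary point. Run the stochastic $k$-means algorithm with learning rate $\eta^t_r=\eta^t=\frac{c'}{t_o+t}$ for all $r$ and parameters satisfying $$m>\frac{\ln(1-\sqrt\alpha)}{\ln(1-\frac45p^*_{\min})},\qquad c'>\frac{\beta}{2[1-\sqrt\alpha-(1-\frac45p^*_{\min})^m]}\ \text{ with }\beta\ge2,$$ $$t_o\ge768(c')^2\Big(1+\frac1{b_o}\Big)^2n^2\ln^2\frac1\delta .$$ Write $\Delta^t=\Delta(C^t,C^* )$ and $\phi^*=\phi(C^* )$. If at some iteration $i$ we have $\Delta^i\le\frac12b_o\phi^*$, then for all $t>i$, with $\Omega_t=\{\Delta^j\le b_o\phi^*,\ \forall\, i\le j<t\}$, $$\Pr(\Omega_t)\ge1-\delta$$ and $$E[\Delta^t\mid\Omega_t]\le\Big(\frac{t_o+i+1}{t_o+t+1}\Big)^{\beta}\Delta^i+\frac{(c')^2B}{\beta-1}\Big(\frac{t_o+i+2}{t_o+i+1}\Big)^{\beta+1}\frac1{t_o+t+1},$$ where $B:=4(b_o+1)n\phi^*$.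
   Context: **$k$-means.** $X\subset\mathbb{R}^d$ is a finite dataset with $|X|=n$. For $C=\{c_1,\dots,c_k\}\subset\mathbb{R}^d$, $\phi(C)=\sum_{x\in X}\min_r\|x-c_r\|^2$. $V(C)\cap X$ is the set of all clusterings $A=\{A_r\}$ of $X$ obtained by assigning each point to one of its closest centroids; if unique it is denoted $v(C)$. A centroid with an empty cluster is degenerate; degenerate centroids are ignored in comparisons. $m(A)$ is the set of means of the nonempty clusters of $A$. $C^*$ is a stationary point if $C^*=m(A^* )$ for a clustering $A^*\in V(C^* )\cap X$. Write $n_r^*=|A_r^*|$, $\phi^*=\phi(C^* )>0$, $p^*_{\min}=\min_r n_r^*/n$. **Distances.** For $C$ having as many non-degenerate centroids as $C^*$ has centroids, $\Delta(C,C^* )=\min_\pi\sum_r n_r^*\|c_{\pi(r)}-c_r^*\|^2$, the minimum over matchings $\pi$ of the indices of $C^*$ with the non-degenerate centroids of $C$. With $A\in V(C)\cap X$, $\mathrm{ClustDist}(A,A^* )=\max_r\frac{|A_{\pi(r)}\triangle A_r^*|}{n_r^*}$, where $\pi$ attains $\Delta(C,C^* )$. **Stability.** For $b_0>0$, $\alpha\in[0,1)$, a stationary point $C^*$ is $(b_0,\alpha)$-stable if for every $b'\le b_0$ and every $C$ with $\Delta(C,C^* )\le b'\phi^*$, there is $b\le\alpha b'$ ($b\geq 0$) with $\mathrm{ClustDist}(v(C),v(C^* ))\le\frac{b}{5b+4(1+\phi(C)/\phi^* )}$. **Stochastic $k$-means algorithm.** Input: $X$, $k$, mini-batch size $m\ge1$,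 learning rates $\eta_r^t$, initial $C^0$. At iteration $t\ge1$: draw a sample $S^t$ of $m$ points of $X$ uniformly at random with replacement; assign each $s\in S^t$ to a closest centroid in $C^{t-1}$, giving sub-samples $S^t_r$; for each $r$ with $S_r^t\ne\emptyset$, set $c_r^t=(1-\eta_r^t)c_r^{t-1}+\eta_r^t\hat c_r^t$ with $\hat c_r^t$ the mean of $S_r^t$; for other $r$, $c_r^t=c_r^{t-1}$. Probabilities and expectations are over the sampling of the algorithm after iteration $i$, with $C^i$ given.
   Formalization: If k exceeds the number of centroids of C*, centroids degenerate at iteration i are assumed to stay degenerate while the run is in Ω_t (else Δ^t may be undefined); stability is required for every tied clustering in V(C) and every optimal matching. *)

theory Defs
  imports "HOL-Probability.Probability"
begin

text \<open>
  A tuple of \<open>k\<close> centroids is a function \<open>C :: nat \<Rightarrow> real^'d\<close> of which only the values at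
  indices below \<open>k\<close> matter; a clustering is a function \<open>A\<close> from indices to clusters.
\<close>

definition kmeans_cost :: "(real^'d) set \<Rightarrow> nat \<Rightarrow> (nat \<Rightarrow> real^'d) \<Rightarrow> real" where
  "kmeans_cost X k C = (\<Sum>x\<in>X. Min ((\<lambda>r. (norm (x - C r))\<^sup>2) ` {..<k}))"

definition closest :: "nat \<Rightarrow> (nat \<Rightarrow> real^'d) \<Rightarrow> real^'d \<Rightarrow> nat \<Rightarrow> bool" where
  "closest k C x r \<longleftrightarrow> r < k \<and> (\<forall>j<k. norm (x - C r) \<le> norm (x - C j))"

definition clustering_of :: "(real^'d) set \<Rightarrow> (real^'d \<Rightarrow> nat) \<Rightarrow> nat \<Rightarrow> (real^'d) set" where
  "clustering_of X a r = {x \<in> X. a x = r}"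

text \<open>The set \<open>V(C) \<inter> X\<close>; it has several elements exactly when there are ties.\<close>

definition clusterings :: "(real^'d) set \<Rightarrow> nat \<Rightarrow> (nat \<Rightarrow> real^'d) \<Rightarrow> (nat \<Rightarrow> (real^'d) set) set" where
  "clusterings X k C = {clustering_of X a |a. \<forall>x\<in>X. closest k C x (a x)}"

definition nondegenerate :: "(nat \<Rightarrow> (real^'d) set) \<Rightarrow> nat set" where
  "nondegenerate A = {r. A r \<noteq> {}}"

definition mean :: "(real^'d) set \<Rightarrow> real^'d" where
  "mean S = (\<Sum>x\<in>S. x) /\<^sub>R real (card S)"

definition means :: "(nat \<Rightarrow> (real^'d) set) \<Rightarrow> (real^'d) set" where
  "means A = (\<lambda>r. mean (A r)) ` nondegenerate A"

text \<open>
  The set \<open>C\<^sup>*\<close> is enumerated without repetition by \<open>cs 0, \<dots>, cs (ks - 1)\<close>, and \<open>As\<close> is a clustering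
  witnessing stationarity.
\<close>

definition stationary_point ::
  "(real^'d) set \<Rightarrow> nat \<Rightarrow> (nat \<Rightarrow> real^'d) \<Rightarrow> (nat \<Rightarrow> (real^'d) set) \<Rightarrow> bool" where
  "stationary_point X ks cs As \<longleftrightarrow>
     inj_on cs {..<ks} \<and> As \<in> clusterings X ks cs \<and> cs ` {..<ks} = means As"

definition p_min :: "(real^'d) set \<Rightarrow> nat \<Rightarrow> (nat \<Rightarrow> (real^'d) set) \<Rightarrow> real" where
  "p_min X ks As = Min ((\<lambda>r. real (card (As r)) / real (card X)) ` {..<ks})"

text \<open>
  \<open>C\<close>, with its clustering \<open>A\<close>, can be compared with a stationary point of \<open>ks\<close> centroids if it has
  \<open>ks\<close> non-degenerate centroids.  Under ties, which centroids are degenerate depends on \<open>A\<close>,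
  hence so does the distance.
\<close>

definition comparable :: "nat \<Rightarrow> (nat \<Rightarrow> (real^'d) set) \<Rightarrow> bool" where
  "comparable ks A \<longleftrightarrow> card (nondegenerate A) = ks"

text \<open>
  For comparable \<open>C\<close> the matchings are the bijections onto the non-degenerate centroids.
  Otherwise the centroidal distance has no standard meaning; here all \<open>k\<close> centroids
  are admitted as targets, so that \<open>Delta\<close> is total (for \<open>ks \<le> k\<close>).  Wherever the condition
  \<open>Delta \<le> \<dots>\<close> occurs below, comparability is required as well.
\<close>

definition matchings :: "nat \<Rightarrow> nat \<Rightarrow> (nat \<Rightarrow> (real^'d) set) \<Rightarrow> (nat \<Rightarrow> nat) set" where
  "matchings ks k A =
     {\<pi> \<in> {..<ks} \<rightarrow>\<^sub>E (if comparable ks A then nondegenerate A else {..<k}). inj_on \<pi> {..<ks}}"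

definition match_cost ::
  "nat \<Rightarrow> (nat \<Rightarrow> real^'d) \<Rightarrow> (nat \<Rightarrow> (real^'d) set) \<Rightarrow> (nat \<Rightarrow> real^'d) \<Rightarrow> (nat \<Rightarrow> nat) \<Rightarrow> real" where
  "match_cost ks cs As C \<pi> = (\<Sum>r<ks. real (card (As r)) * (norm (C (\<pi> r) - cs r))\<^sup>2)"

definition Delta ::
  "nat \<Rightarrow> (nat \<Rightarrow> real^'d) \<Rightarrow> (nat \<Rightarrow> (real^'d) set) \<Rightarrow>
   nat \<Rightarrow> (nat \<Rightarrow> real^'d) \<Rightarrow> (nat \<Rightarrow> (real^'d) set) \<Rightarrow> real" where
  "Delta ks cs As k C A = Min (match_cost ks cs As C ` matchings ks k A)"

definition optimal_matchings ::
  "nat \<Rightarrow> (nat \<Rightarrow> real^'d) \<Rightarrow> (nat \<Rightarrow> (real^'d) set) \<Rightarrow>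
   nat \<Rightarrow> (nat \<Rightarrow> real^'d) \<Rightarrow> (nat \<Rightarrow> (real^'d) set) \<Rightarrow> (nat \<Rightarrow> nat) set" where
  "optimal_matchings ks cs As k C A =
     {\<pi> \<in> matchings ks k A. match_cost ks cs As C \<pi> = Delta ks cs As k C A}"

definition clust_dist ::
  "nat \<Rightarrow> (nat \<Rightarrow> (real^'d) set) \<Rightarrow> (nat \<Rightarrow> (real^'d) set) \<Rightarrow> (nat \<Rightarrow> nat) \<Rightarrow> real" where
  "clust_dist ks As A \<pi> =
     Max ((\<lambda>r. real (card ((A (\<pi> r) - As r) \<union> (As r - A (\<pi> r)))) / real (card (As r))) ` {..<ks})"

text \<open>
  Neither the clustering of \<open>C\<close> (under ties) nor the optimal matching need be unique: the bound is
  required for all of them.  For \<open>b' = 0\<close> and \<open>C = C\<^sup>*\<close> this includes that every non-degenerate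
  clustering by \<open>C\<^sup>*\<close> is \<open>As\<close>.
\<close>

definition stable ::
  "(real^'d) set \<Rightarrow> nat \<Rightarrow> (nat \<Rightarrow> real^'d) \<Rightarrow> (nat \<Rightarrow> (real^'d) set) \<Rightarrow> real \<Rightarrow> real \<Rightarrow> bool" where
  "stable X ks cs As b0 \<alpha> \<longleftrightarrow>
     stationary_point X ks cs As \<and>
     (\<forall>b' k C A. b' \<le> b0 \<and> A \<in> clusterings X k C \<and> comparable ks A \<and>
        Delta ks cs As k C A \<le> b' * kmeans_cost X ks cs \<longrightarrow>
        (\<exists>b. 0 \<le> b \<and> b \<le> \<alpha> * b' \<and>
           (\<forall>\<pi>\<in>optimal_matchings ks cs As k C A.
              clust_dist ks As A \<pi> \<le> b / (5 * b + 4 * (1 + kmeans_cost X k C / kmeans_cost X ks cs)))))"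

text \<open>
  One iteration: \<open>s 0, \<dots>, s (m - 1)\<close> is the sample, \<open>a\<close> the assignment of points to centroids, and
  \<open>\<eta> r\<close> the learning rate of the \<open>r\<close>-th centroid.
\<close>

definition subsample :: "nat \<Rightarrow> (real^'d \<Rightarrow> nat) \<Rightarrow> (nat \<Rightarrow> real^'d) \<Rightarrow> nat \<Rightarrow> nat set" where
  "subsample m a s r = {l. l < m \<and> a (s l) = r}"

definition skm_step ::
  "nat \<Rightarrow> (nat \<Rightarrow> real) \<Rightarrow> (real^'d \<Rightarrow> nat) \<Rightarrow> (nat \<Rightarrow> real^'d) \<Rightarrow> (nat \<Rightarrow> real^'d) \<Rightarrow> nat \<Rightarrow> real^'d" where
  "skm_step m \<eta> a s C r =
     (if subsample m a s r \<noteq> {}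
      then (1 - \<eta> r) *\<^sub>R C r
           + \<eta> r *\<^sub>R ((\<Sum>l\<in>subsample m a s r. s l) /\<^sub>R real (card (subsample m a s r)))
      else C r)"

text \<open>
  The run after iteration \<open>i\<close>, with \<open>Ci\<close> the centroids at iteration \<open>i\<close>.  The rule \<open>pick t\<close> resolves
  the ties when points are assigned to the centroids of iteration \<open>t\<close>; \<open>S t\<close> is the sample drawn at
  iteration \<open>t\<close>.
\<close>

primrec skm ::
  "nat \<Rightarrow> (nat \<Rightarrow> nat \<Rightarrow> real) \<Rightarrow> (nat \<Rightarrow> (nat \<Rightarrow> real^'d) \<Rightarrow> real^'d \<Rightarrow> nat) \<Rightarrow>
   nat \<Rightarrow> (nat \<Rightarrow> real^'d) \<Rightarrow> (nat \<Rightarrow> nat \<Rightarrow> real^'d) \<Rightarrow> nat \<Rightarrow> nat \<Rightarrow> real^'d" where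
  "skm m \<eta> pick i Ci S 0 = Ci"
| "skm m \<eta> pick i Ci S (Suc t) =
     (if Suc t \<le> i then Ci
      else skm_step m (\<eta> (Suc t)) (pick t (skm m \<eta> pick i Ci S t)) (S (Suc t)) (skm m \<eta> pick i Ci S t))"

definition uniform_samples ::
  "'w measure \<Rightarrow> (real^'d) set \<Rightarrow> nat \<Rightarrow> nat \<Rightarrow> (nat \<Rightarrow> nat \<Rightarrow> 'w \<Rightarrow> real^'d) \<Rightarrow> bool" where
  "uniform_samples M X m i S \<longleftrightarrow>
     prob_space.indep_vars M (\<lambda>_. uniform_count_measure X) (\<lambda>(t, l). S t l) ({i<..} \<times> {..<m}) \<and>
     (\<forall>t>i. \<forall>l<m. distr M (uniform_count_measure X) (S t l) = uniform_count_measure X)"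

definition event_expectation :: "'w measure \<Rightarrow> ('w \<Rightarrow> real) \<Rightarrow> 'w set \<Rightarrow> real" where
  "event_expectation M f E = (LINT \<omega>:E|M. f \<omega>) / measure M E"

end

theory Submission
  imports Defs
begin

text \<open>
  As long as the run is in the basin of attraction, stability makes the clusters of \<open>C\<^sup>t\<close> overlap
  those of \<open>As\<close> in four fifths of their points and makes a full batch step contract the distance by
  \<open>\<alpha>\<close>; a mini-batch step moves each centroid by \<open>\<eta>\<close> times a vector whose conditional mean is the
  batch step times the probability that the sub-sample is nonempty.  Expanding the square gives
  \<open>\<Delta>' \<le> \<Delta> + \<eta> P + \<eta>\<^sup>2 V\<close> with \<open>E P \<le> - 2 \<kappa> \<Delta>\<close> and \<open>P\<close>, \<open>V\<close> bounded.  Hence \<open>exp (\<theta> \<Delta>)\<close> is, up to a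
  convergent product, a supermartingale, which bounds the probability of leaving the basin, and
  \<open>E \<Delta>\<close> satisfies a recursion that decays like \<open>t\<close> to the power \<open>-\<beta>\<close>, plus noise.
  Conditioning on \<open>\<Omega>\<close> only discards runs with large \<open>\<Delta>\<close>, so it does not increase the mean.

  Leaving the basin must also account for centroids that become degenerate.  Stability excludes
  this while the distance is small: moving from \<open>C\<^sup>*\<close> to \<open>C\<close> along a segment, a cluster can only
  become empty through a tie, and such a tie contradicts stability.
\<close>

section \<open>Clusterings and the matching cost\<close>

text \<open>Along a run both the optimal matching and the set of non-degenerate centroids may
  change. Distances are therefore taken to a fixed target set, and the matching that is optimal
  before a step is kept through it; this can only overestimate the new distance, which is the
  harmless direction. Since \<open>X\<close> is finite, averages over \<open>m\<close>-tuples take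
  the place of conditional expectations. Survival is tested at iterations strictly before the
  current one, hence is known before the next draw. The denominator
  \<open>5 * b + 4 * (1 + f)\<close> in stability, \<open>f\<close> being the cost ratio, has two
  jobs: \<open>5 * b\<close> keeps symmetric differences below one fifth of a cluster, whence the
  factor 4/5 in the probability of hitting a cluster, and the whole is balanced so that the
  perturbation of the means adds up to at most \<open>b * \<phi>s\<close>. The root of \<alpha> in
  the drift comes from Cauchy-Schwarz: the batch step contracts squared distances by \<alpha>, but
  enters through an inner product. Starting in the inner half of the basin leaves the exponential
  moment a gap between start and exit, and this gap pays for \<delta>.\<close>

lemma mean_norm_sum:
  fixes S :: "(real^'d) set"
  assumes "finite S" "S \<noteq> {}"
  shows "(\<Sum>x\<in>S. (norm (x - c))\<^sup>2) =
    (\<Sum>x\<in>S. (norm (x - mean S))\<^sup>2) + real (card S) * (norm (mean S - c))\<^sup>2"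
proof -
  have card: "real (card S) > 0" using assms by (simp add: card_gt_0_iff)
  have "(\<Sum>x\<in>S. x - mean S) = 0"
    using card by (simp add: sum_subtractf mean_def sum_constant_scaleR del: sum_constant)
  moreover have "(norm (x - c))\<^sup>2 = (norm (x - mean S))\<^sup>2 + (norm (mean S - c))\<^sup>2
      + 2 * ((x - mean S) \<bullet> (mean S - c))" for x
    by (simp add: power2_norm_eq_inner inner_diff_left inner_diff_right inner_commute)
  then have "(\<Sum>x\<in>S. (norm (x - c))\<^sup>2) = (\<Sum>x\<in>S. (norm (x - mean S))\<^sup>2 + (norm (mean S - c))\<^sup>2
      + 2 * ((x - mean S) \<bullet> (mean S - c)))"
    by (intro sum.cong refl)
  then have "(\<Sum>x\<in>S. (norm (x - c))\<^sup>2) = (\<Sum>x\<in>S. (norm (x - mean S))\<^sup>2)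
      + real (card S) * (norm (mean S - c))\<^sup>2 + 2 * ((\<Sum>x\<in>S. x - mean S) \<bullet> (mean S - c))"
    by (simp only: sum.distrib inner_sum_left sum_distrib_left sum_constant)
  ultimately show ?thesis by simp
qed

lemma kmeans_cost_closest:
  assumes "\<forall>x\<in>X. closest k C x (a x)"
  shows "kmeans_cost X k C = (\<Sum>x\<in>X. (norm (x - C (a x)))\<^sup>2)"
  unfolding kmeans_cost_def
proof (rule sum.cong)
  fix x assume "x \<in> X"
  then have "closest k C x (a x)" using assms by blast
  then show "Min ((\<lambda>r. (norm (x - C r))\<^sup>2) ` {..<k}) = (norm (x - C (a x)))\<^sup>2"
    by (intro Min_eqI) (auto simp: closest_def)
qed simp

lemma kmeans_cost_le:
  assumes "\<forall>x\<in>X. a x < k"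
  shows "kmeans_cost X k C \<le> (\<Sum>x\<in>X. (norm (x - C (a x)))\<^sup>2)"
  unfolding kmeans_cost_def using assms by (intro sum_mono Min_le) auto

lemma kmeans_cost_nonneg: "k > 0 \<Longrightarrow> kmeans_cost X k C \<ge> 0"
  unfolding kmeans_cost_def by (intro sum_nonneg) (subst Min_ge_iff, auto)

lemma sum_clustering:
  assumes "finite X" "finite K" "\<forall>x\<in>X. a x \<in> K"
  shows "(\<Sum>r\<in>K. \<Sum>x\<in>clustering_of X a r. f r x) = (\<Sum>x\<in>X. f (a x) x)"
proof -
  have "(\<Sum>r\<in>K. \<Sum>x\<in>clustering_of X a r. f r x) = (\<Sum>r\<in>K. \<Sum>x\<in>{x \<in> X. a x = r}. f (a x) x)"
    unfolding clustering_of_def by (intro sum.cong) auto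
  also have "\<dots> = (\<Sum>x\<in>X. f (a x) x)" using assms by (intro sum.group) auto
  finally show ?thesis .
qed

lemma nondegenerate_clustering: "nondegenerate (clustering_of X a) = a ` X"
  by (auto simp: nondegenerate_def clustering_of_def)

lemma finite_injections:
  fixes ks :: nat
  assumes "finite N"
  shows "finite {\<pi> \<in> {..<ks} \<rightarrow>\<^sub>E N. inj_on \<pi> {..<ks}}"
  using assms by (intro finite_subset[OF _ finite_PiE[of "{..<ks}" "\<lambda>_. N"]]) auto

lemma injections_nonempty:
  fixes ks :: nat
  assumes "finite N" "ks \<le> card N"
  shows "{\<pi> \<in> {..<ks} \<rightarrow>\<^sub>E N. inj_on \<pi> {..<ks}} \<noteq> {}"
proof -
  obtain f where f: "f ` {..<ks} \<subseteq> N" "inj_on f {..<ks}"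
    using assms card_le_inj[of "{..<ks}" N] by auto
  then have "restrict f {..<ks} \<in> {\<pi> \<in> {..<ks} \<rightarrow>\<^sub>E N. inj_on \<pi> {..<ks}}"
    by (simp add: image_subset_iff)
  then show ?thesis by blast
qed

locale stable_clustering =
  fixes X :: "(real^'d) set" and ks :: nat and cs :: "nat \<Rightarrow> real^'d"
    and As :: "nat \<Rightarrow> (real^'d) set" and b0 \<alpha> :: real
  assumes finite_X: "finite X"
    and cost_pos: "kmeans_cost X ks cs > 0"
    and b0_pos: "b0 > 0"
    and \<alpha>: "0 \<le> \<alpha>" "\<alpha> < 1"
    and stable: "stable X ks cs As b0 \<alpha>"
begin

abbreviation "\<phi>s \<equiv> kmeans_cost X ks cs"

lemma X_nonempty: "X \<noteq> {}"
  using cost_pos by (auto simp: kmeans_cost_def)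

lemma stationary: "inj_on cs {..<ks}" "As \<in> clusterings X ks cs" "cs ` {..<ks} = means As"
  using stable unfolding stable_def stationary_point_def by auto

lemma As_assignment: obtains a where "As = clustering_of X a" "\<forall>x\<in>X. closest ks cs x (a x)"
  using stationary(2) unfolding clusterings_def by auto

lemma ks_pos: "ks > 0"
proof -
  obtain a where "\<forall>x\<in>X. closest ks cs x (a x)" by (rule As_assignment)
  then show ?thesis using X_nonempty by (auto simp: closest_def)
qed

lemma As_subset: "As r \<subseteq> X"
  by (rule As_assignment) (auto simp: clustering_of_def)

lemma finite_As: "finite (As r)"
  using As_subset finite_X finite_subset by blast

text \<open>A count: the \<open>ks\<close> distinct centroids are all means of nonempty clusters, so
  at least \<open>ks\<close> clusters are nonempty, while labels below \<open>ks\<close> allow no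
  more.\<close>

lemma nondegenerate_As: "nondegenerate As = {..<ks}"
proof -
  obtain a where a: "As = clustering_of X a" "\<forall>x\<in>X. closest ks cs x (a x)" by (rule As_assignment)
  have sub: "nondegenerate As \<subseteq> {..<ks}"
    using a by (auto simp: nondegenerate_clustering closest_def)
  have "ks = card (cs ` {..<ks})"
    using stationary(1) by (simp add: card_image)
  also have "\<dots> = card (means As)"
    by (simp add: stationary(3))
  also have "\<dots> \<le> card (nondegenerate As)"
    unfolding means_def using sub by (intro card_image_le) (auto intro: finite_subset)
  finally show ?thesis using sub by (intro card_seteq) auto
qed

lemma As_nonempty: "r < ks \<Longrightarrow> As r \<noteq> {}"
  using nondegenerate_As by (auto simp: nondegenerate_def)

lemma card_As_pos: "r < ks \<Longrightarrow> real (card (As r)) > 0"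
  using As_nonempty finite_As by (simp add: card_gt_0_iff)

text \<open>
  Stationarity only says that the means of the clusters are the centroids as a set.  Every point of
  a cluster is closest to its own centroid, and the mean minimises the sum of squares, so the
  enumerations match.
\<close>

lemma cs_eq_mean:
  assumes "r < ks"
  shows "cs r = mean (As r)"
proof -
  obtain a where a: "As = clustering_of X a" "\<forall>x\<in>X. closest ks cs x (a x)" by (rule As_assignment)
  have "mean (As r) \<in> means As"
    unfolding means_def nondegenerate_As using assms by blast
  also have "means As = cs ` {..<ks}"
    by (simp add: stationary(3))
  finally obtain j where j: "j < ks" "cs j = mean (As r)" by auto
  have "(\<Sum>x\<in>As r. (norm (x - cs r))\<^sup>2) \<le> (\<Sum>x\<in>As r. (norm (x - cs j))\<^sup>2)"
    using a j(1) by (intro sum_mono power_mono) (auto simp: clustering_of_def closest_def)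
  also have "\<dots> = (\<Sum>x\<in>As r. (norm (x - mean (As r)))\<^sup>2)" by (simp add: j)
  finally have "real (card (As r)) * (norm (mean (As r) - cs r))\<^sup>2 \<le> 0"
    using mean_norm_sum[OF finite_As As_nonempty[OF assms], of "cs r"] by simp
  then show ?thesis
    using card_As_pos[OF assms] by (auto simp: mult_le_0_iff)
qed

lemma sum_As: "(\<Sum>r<ks. \<Sum>x\<in>As r. (norm (x - cs r))\<^sup>2) = \<phi>s"
proof -
  obtain a where a: "As = clustering_of X a" "\<forall>x\<in>X. closest ks cs x (a x)" by (rule As_assignment)
  then show ?thesis
    using sum_clustering[OF finite_X, of "{..<ks}" a "\<lambda>r x. (norm (x - cs r))\<^sup>2"]
    by (auto simp: kmeans_cost_closest[OF a(2)] closest_def)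
qed

lemma card_As_le: "card (As r) \<le> card X"
  by (intro card_mono finite_X As_subset)

abbreviation "mcost \<equiv> match_cost ks cs As"

lemma match_cost_nonneg: "mcost C \<pi> \<ge> 0"
  by (auto simp: match_cost_def intro!: sum_nonneg)

text \<open>Sending each cluster \<open>As r\<close> as a whole to the centroid
  \<open>\<pi> r\<close> is one admissible assignment; as \<open>cs r\<close> is the mean of
  \<open>As r\<close>, the decomposition around the mean splits its cost exactly into the two
  summands.\<close>

lemma kmeans_cost_le_match:
  assumes "\<pi> \<in> {..<ks} \<rightarrow> {..<k}"
  shows "kmeans_cost X k C \<le> \<phi>s + mcost C \<pi>"
proof -
  obtain a where a: "As = clustering_of X a" "\<forall>x\<in>X. closest ks cs x (a x)" by (rule As_assignment)
  have a_less: "\<forall>x\<in>X. a x < ks" using a by (auto simp: closest_def)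
  have "kmeans_cost X k C \<le> (\<Sum>x\<in>X. (norm (x - C (\<pi> (a x))))\<^sup>2)"
    using assms a_less by (intro kmeans_cost_le[where a = "\<lambda>x. \<pi> (a x)"]) auto
  also have "\<dots> = (\<Sum>r<ks. \<Sum>x\<in>As r. (norm (x - C (\<pi> r)))\<^sup>2)"
    using sum_clustering[OF finite_X, of "{..<ks}" a "\<lambda>r x. (norm (x - C (\<pi> r)))\<^sup>2"] a_less a(1)
    by simp
  also have "\<dots> = (\<Sum>r<ks. (\<Sum>x\<in>As r. (norm (x - cs r))\<^sup>2)
      + real (card (As r)) * (norm (C (\<pi> r) - cs r))\<^sup>2)"
  proof (intro sum.cong refl)
    fix r assume "r \<in> {..<ks}"
    then show "(\<Sum>x\<in>As r. (norm (x - C (\<pi> r)))\<^sup>2) = (\<Sum>x\<in>As r. (norm (x - cs r))\<^sup>2)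
        + real (card (As r)) * (norm (C (\<pi> r) - cs r))\<^sup>2"
      using mean_norm_sum[OF finite_As As_nonempty, of r "C (\<pi> r)"]
      by (simp add: cs_eq_mean norm_minus_commute)
  qed
  also have "\<dots> = \<phi>s + mcost C \<pi>"
    unfolding sum.distrib sum_As match_cost_def ..
  finally show ?thesis .
qed

text \<open>Both branches of \<open>Delta\<close> with the target set made explicit. A run can then
  be measured against one fixed set of centroids, while the targets of \<open>Delta\<close> vary
  with the clustering.\<close>

definition Delta_on :: "nat set \<Rightarrow> (nat \<Rightarrow> real^'d) \<Rightarrow> real" where
  "Delta_on N C = Min (mcost C ` {\<pi> \<in> {..<ks} \<rightarrow>\<^sub>E N. inj_on \<pi> {..<ks}})"

lemma Delta_on_attained:
  assumes "finite N" "ks \<le> card N"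
  obtains \<pi> where "\<pi> \<in> {..<ks} \<rightarrow>\<^sub>E N" "inj_on \<pi> {..<ks}" "mcost C \<pi> = Delta_on N C"
proof -
  have "Delta_on N C \<in> mcost C ` {\<pi> \<in> {..<ks} \<rightarrow>\<^sub>E N. inj_on \<pi> {..<ks}}"
    unfolding Delta_on_def
  proof (rule Min_in)
    show "finite (mcost C ` {\<pi> \<in> {..<ks} \<rightarrow>\<^sub>E N. inj_on \<pi> {..<ks}})"
      by (rule finite_imageI[OF finite_injections[OF assms(1)]])
    show "mcost C ` {\<pi> \<in> {..<ks} \<rightarrow>\<^sub>E N. inj_on \<pi> {..<ks}} \<noteq> {}"
      unfolding image_is_empty by (rule injections_nonempty[OF assms])
  qed
  then obtain \<pi> where "\<pi> \<in> {\<pi> \<in> {..<ks} \<rightarrow>\<^sub>E N. inj_on \<pi> {..<ks}}" "Delta_on N C = mcost C \<pi>"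
    by (rule imageE)
  then show thesis by (intro that) simp_all
qed

lemma Delta_on_le:
  assumes "finite N" "\<pi> \<in> {..<ks} \<rightarrow>\<^sub>E N" "inj_on \<pi> {..<ks}"
  shows "Delta_on N C \<le> mcost C \<pi>"
  unfolding Delta_on_def
  by (rule Min_le[OF finite_imageI[OF finite_injections[OF assms(1)]]]) (use assms in simp)

lemma Delta_on_nonneg:
  assumes "finite N" "ks \<le> card N"
  shows "Delta_on N C \<ge> 0"
proof -
  obtain \<pi> where "mcost C \<pi> = Delta_on N C" by (rule Delta_on_attained[OF assms])
  then show ?thesis using match_cost_nonneg[of C \<pi>] by simp
qed

lemma Delta_on_antimono:
  assumes "finite N'" "N \<subseteq> N'" "ks \<le> card N"
  shows "Delta_on N' C \<le> Delta_on N C"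
proof -
  obtain \<pi> where \<pi>: "\<pi> \<in> {..<ks} \<rightarrow>\<^sub>E N" "inj_on \<pi> {..<ks}" "mcost C \<pi> = Delta_on N C"
    by (rule Delta_on_attained[OF finite_subset[OF assms(2,1)] assms(3)])
  have "\<pi> \<in> {..<ks} \<rightarrow>\<^sub>E N'" using \<pi>(1) assms(2) by auto
  then show ?thesis using Delta_on_le[OF assms(1), of \<pi> C] \<pi> by simp
qed

lemma Delta_comparable:
  "comparable ks A \<Longrightarrow> Delta ks cs As k C A = Delta_on (nondegenerate A) C"
  unfolding Delta_def Delta_on_def matchings_def by (simp only: if_True if_False)

lemma Delta_not_comparable:
  "\<not> comparable ks A \<Longrightarrow> Delta ks cs As k C A = Delta_on {..<k} C"
  unfolding Delta_def Delta_on_def matchings_def by (simp only: if_True if_False)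

end

section \<open>Consequences of stability\<close>

text \<open>Deviations from \<open>mean T\<close> cancel over \<open>T\<close>, so
  \<open>card S\<close> times \<open>mean S - mean T\<close> is a difference of two sums over the
  symmetric difference only. Cauchy-Schwarz there costs its cardinality, at most
  \<open>\<rho> * card T\<close>, and \<open>card S \<ge> (1 - \<rho>) * card T\<close> allows
  division.\<close>

lemma mean_perturbation:
  fixes S T :: "(real^'d) set"
  assumes fin: "finite S" "finite T" and T: "T \<noteq> {}" and \<rho>: "0 \<le> \<rho>" "\<rho> < 1"
    and sym: "real (card ((S - T) \<union> (T - S))) \<le> \<rho> * real (card T)"
  shows "(1 - \<rho>)\<^sup>2 * (real (card T) * (norm (mean S - mean T))\<^sup>2)
    \<le> \<rho> * (\<Sum>x\<in>(S - T) \<union> (T - S). (norm (x - mean T))\<^sup>2)"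
proof -
  define c U where "c = mean T" and "U = (S - T) \<union> (T - S)"
  define n where "n = real (card T)"
  have n: "n > 0" using fin T by (simp add: n_def card_gt_0_iff)
  have "card T \<le> card (T - S) + card S"
    using card_mono[of "(T - S) \<union> S" T] card_Un_le[of "T - S" S] fin by fastforce
  moreover have "card (T - S) \<le> card U" unfolding U_def using fin by (intro card_mono) auto
  ultimately have S_ge: "(1 - \<rho>) * n \<le> real (card S)"
    using sym by (simp add: U_def n_def algebra_simps)
  then have S: "real (card S) > 0" using n \<rho> by (smt (verit) mult_pos_pos)
  have "(\<Sum>x\<in>T. x - c) = 0"
    using n by (simp add: sum_subtractf c_def mean_def sum_constant_scaleR n_def del: sum_constant)
  have S_split: "(\<Sum>x\<in>S. x - c) = (\<Sum>x\<in>S-T. x - c) + (\<Sum>x\<in>S\<inter>T. x - c)"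
    using sum.Int_Diff[OF fin(1), of "\<lambda>x. x - c" T] by simp
  have T_split: "(\<Sum>x\<in>T. x - c) = (\<Sum>x\<in>T-S. x - c) + (\<Sum>x\<in>S\<inter>T. x - c)"
    using sum.Int_Diff[OF fin(2), of "\<lambda>x. x - c" S] by (simp add: Int_commute)
  have "(\<Sum>x\<in>S. x - c) = real (card S) *\<^sub>R (mean S - c)"
    using S by (simp add: sum_subtractf mean_def sum_constant_scaleR scaleR_diff_right del: sum_constant)
  then have "real (card S) *\<^sub>R (mean S - c) = (\<Sum>x\<in>S-T. x - c) - (\<Sum>x\<in>T-S. x - c)"
    unfolding S_split using T_split \<open>(\<Sum>x\<in>T. x - c) = 0\<close>
    by (simp add: eq_neg_iff_add_eq_0[symmetric])
  then have "real (card S) * norm (mean S - c) = norm ((\<Sum>x\<in>S-T. x - c) - (\<Sum>x\<in>T-S. x - c))"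
    by (metis abs_of_nat norm_scaleR)
  also have "\<dots> \<le> (\<Sum>x\<in>S-T. norm (x - c)) + (\<Sum>x\<in>T-S. norm (x - c))"
    by (rule order_trans[OF norm_triangle_ineq4 add_mono[OF norm_sum norm_sum]])
  also have "\<dots> = (\<Sum>x\<in>U. norm (x - c))"
    unfolding U_def using fin by (subst sum.union_disjoint) auto
  finally have "(real (card S) * norm (mean S - c))\<^sup>2 \<le> (\<Sum>x\<in>U. norm (x - c))\<^sup>2"
    by (intro power_mono) auto
  also have "\<dots> \<le> (\<Sum>x\<in>U. (norm (x - c))\<^sup>2) * real (card U)"
    by (rule sum_squared_le_sum_of_squares)
  also have "\<dots> \<le> (\<Sum>x\<in>U. (norm (x - c))\<^sup>2) * (\<rho> * n)"
    using sym by (intro mult_left_mono sum_nonneg) (auto simp: U_def n_def)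
  finally have "(real (card S))\<^sup>2 * (norm (mean S - c))\<^sup>2 \<le> n * (\<rho> * (\<Sum>x\<in>U. (norm (x - c))\<^sup>2))"
    by (simp add: power_mult_distrib mult_ac)
  moreover have "((1 - \<rho>) * n)\<^sup>2 * (norm (mean S - c))\<^sup>2 \<le> (real (card S))\<^sup>2 * (norm (mean S - c))\<^sup>2"
    using S_ge n \<rho> by (intro mult_right_mono power_mono) auto
  ultimately have "n * ((1 - \<rho>)\<^sup>2 * (n * (norm (mean S - c))\<^sup>2)) \<le> n * (\<rho> * (\<Sum>x\<in>U. (norm (x - c))\<^sup>2))"
    by (simp add: power2_eq_square mult_ac)
  then show ?thesis using n unfolding U_def n_def c_def by (simp only: mult_le_cancel_left_pos)
qed

lemma norm_diff_square_le: "(norm (x - z))\<^sup>2 \<le> 2 * (norm (x - y))\<^sup>2 + 2 * (norm (y - z))\<^sup>2"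
  for x y z :: "'a::real_normed_vector"
proof -
  have "norm (x - z) \<le> norm (x - y) + norm (y - z)"
    using norm_triangle_ineq[of "x - y" "y - z"] by simp
  then have "(norm (x - z))\<^sup>2 \<le> (norm (x - y) + norm (y - z))\<^sup>2" by (intro power_mono) auto
  also have "\<dots> \<le> 2 * (norm (x - y))\<^sup>2 + 2 * (norm (y - z))\<^sup>2"
    using zero_le_power2[of "norm (x - y) - norm (y - z)"] by (simp add: power2_eq_square algebra_simps)
  finally show ?thesis .
qed

text \<open>Here the denominator in stability earns its form. With \<open>F = 1 + f\<close> and
  \<open>D = 5 * b + 4 * F\<close> the claim becomes
  \<open>F * (2 * D + 5 * b) \<le> (4 * b + 4 * F)\<^sup>2\<close>, that is,
  \<open>15 * b * F + 8 * F\<^sup>2 \<le> 16 * (b + F)\<^sup>2\<close>.\<close>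

lemma stability_arith:
  fixes b f \<rho> :: real
  assumes "0 \<le> b" "0 \<le> f" "\<rho> = b / (5 * b + 4 * (1 + f))"
  shows "\<rho> * (2 * (1 + f) + 5 * \<rho> * (1 + f)) \<le> (1 - \<rho>)\<^sup>2 * b"
proof -
  define F D where "F = 1 + f" and "D = 5 * b + 4 * F"
  have pos: "F > 0" "D > 0" using assms by (simp_all add: F_def D_def)
  have \<rho>: "\<rho> = b / D" "1 - \<rho> = (4 * b + 4 * F) / D"
    using pos assms by (simp_all add: F_def D_def field_simps)
  have "F * (2 * D + 5 * b) \<le> (4 * b + 4 * F)\<^sup>2"
    using assms pos by (simp add: D_def power2_eq_square algebra_simps)
  then have "b * (F * (2 * D + 5 * b)) / D\<^sup>2 \<le> b * (4 * b + 4 * F)\<^sup>2 / D\<^sup>2"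
    using assms by (intro divide_right_mono mult_left_mono) auto
  moreover have "b / D * (2 * F + 5 * (b / D) * F) = b * (F * (2 * D + 5 * b)) / D\<^sup>2"
    using pos by (simp add: power2_eq_square field_simps)
  moreover have "((4 * b + 4 * F) / D)\<^sup>2 * b = b * (4 * b + 4 * F)\<^sup>2 / D\<^sup>2"
    by (simp add: power_divide)
  ultimately show ?thesis unfolding \<rho>(2) F_def[symmetric] unfolding \<rho>(1) by linarith
qed

context stable_clustering
begin

text \<open>For a comparable \<open>A\<close> this is membership in
  \<open>optimal_matchings\<close>, freed of the index bound \<open>k\<close>, which then does not
  matter.\<close>

definition optimal :: "(nat \<Rightarrow> (real^'d) set) \<Rightarrow> (nat \<Rightarrow> real^'d) \<Rightarrow> (nat \<Rightarrow> nat) \<Rightarrow> bool" where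
  "optimal A C \<pi> \<longleftrightarrow> \<pi> \<in> {..<ks} \<rightarrow>\<^sub>E nondegenerate A \<and> inj_on \<pi> {..<ks} \<and>
     mcost C \<pi> = Delta_on (nondegenerate A) C"

lemma optimal_bij:
  assumes "comparable ks A" "optimal A C \<pi>"
  shows "bij_betw \<pi> {..<ks} (nondegenerate A)"
proof -
  have "finite (nondegenerate A)"
    using assms(1) ks_pos by (intro card_ge_0_finite) (simp add: comparable_def)
  then have "\<pi> ` {..<ks} = nondegenerate A"
    using assms by (intro card_seteq) (auto simp: optimal_def comparable_def card_image)
  then show ?thesis using assms(2) by (simp add: bij_betw_def optimal_def)
qed

lemma stability_bound:
  assumes "A \<in> clusterings X k C" "comparable ks A" "Delta_on (nondegenerate A) C \<le> b' * \<phi>s" "b' \<le> b0"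
  obtains b where "0 \<le> b" "b \<le> \<alpha> * b'"
    "\<And>\<pi> r. optimal A C \<pi> \<Longrightarrow> r < ks \<Longrightarrow>
       real (card ((A (\<pi> r) - As r) \<union> (As r - A (\<pi> r))))
         \<le> b / (5 * b + 4 * (1 + kmeans_cost X k C / \<phi>s)) * real (card (As r))"
proof -
  have "Delta ks cs As k C A \<le> b' * \<phi>s"
    using assms by (simp only: Delta_comparable)
  then obtain b where b: "0 \<le> b" "b \<le> \<alpha> * b'"
    "\<forall>\<pi>\<in>optimal_matchings ks cs As k C A.
       clust_dist ks As A \<pi> \<le> b / (5 * b + 4 * (1 + kmeans_cost X k C / \<phi>s))"
    using stable assms unfolding stable_def by blast
  show thesis
  proof (rule that[OF b(1,2)])
    fix \<pi> r assume \<pi>: "optimal A C \<pi>" and r: "r < ks"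
    have "\<pi> \<in> optimal_matchings ks cs As k C A"
      using \<pi> assms(2) unfolding optimal_matchings_def optimal_def matchings_def Delta_comparable[OF assms(2)]
      by simp
    then have "clust_dist ks As A \<pi> \<le> b / (5 * b + 4 * (1 + kmeans_cost X k C / \<phi>s))"
      using b(3) by blast
    moreover have "real (card ((A (\<pi> r) - As r) \<union> (As r - A (\<pi> r)))) / real (card (As r)) \<le> clust_dist ks As A \<pi>"
      unfolding clust_dist_def using r by (intro Max_ge) auto
    ultimately have "real (card ((A (\<pi> r) - As r) \<union> (As r - A (\<pi> r)))) / real (card (As r))
         \<le> b / (5 * b + 4 * (1 + kmeans_cost X k C / \<phi>s))"
      by linarith
    then show "real (card ((A (\<pi> r) - As r) \<union> (As r - A (\<pi> r))))
         \<le> b / (5 * b + 4 * (1 + kmeans_cost X k C / \<phi>s)) * real (card (As r))"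
      by (simp only: pos_divide_le_eq[OF card_As_pos[OF r]])
  qed
qed

lemma comparable_k_pos:
  assumes "A \<in> clusterings X k C"
  shows "k > 0"
  using assms X_nonempty by (auto simp: clusterings_def closest_def)

text \<open>The bound of stability is below 1/5 whatever \<open>b \<ge> 0\<close> it supplies,
  because of the summand \<open>5 * b\<close> in the denominator. Strictness matters: it makes
  matched clusters coincide when they are very small.\<close>

lemma symdiff_fifth:
  assumes "A \<in> clusterings X k C" "comparable ks A" "Delta_on (nondegenerate A) C \<le> b0 * \<phi>s"
    "optimal A C \<pi>" "r < ks"
  shows "5 * card ((A (\<pi> r) - As r) \<union> (As r - A (\<pi> r))) < card (As r)"
proof -
  obtain b where b: "0 \<le> b" "real (card ((A (\<pi> r) - As r) \<union> (As r - A (\<pi> r))))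
         \<le> b / (5 * b + 4 * (1 + kmeans_cost X k C / \<phi>s)) * real (card (As r))"
    using stability_bound[OF assms(1-3) order_refl] assms(4,5) by metis
  have "kmeans_cost X k C / \<phi>s \<ge> 0"
    using kmeans_cost_nonneg[OF comparable_k_pos[OF assms(1)], of X C] cost_pos by simp
  then have "b / (5 * b + 4 * (1 + kmeans_cost X k C / \<phi>s)) < 1 / 5"
    using b(1) by (simp add: divide_less_eq)
  then have "b / (5 * b + 4 * (1 + kmeans_cost X k C / \<phi>s)) * real (card (As r)) < 1 / 5 * real (card (As r))"
    by (rule mult_strict_right_mono) (rule card_As_pos[OF assms(5)])
  then show ?thesis using b(2) by linarith
qed

text \<open>\<open>mean_perturbation\<close> is summed over the matched pairs of clusters. What
  remains is the squared deviation on the symmetric differences, bounded by both k-means costs and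
  the distance itself; the points shared by matched clusters bound that distance by the two costs
  again, and \<open>stability_arith\<close> closes the estimate.\<close>

lemma batch_contraction:
  assumes a: "\<forall>x\<in>X. closest k C x (a x)" and A: "A = clustering_of X a" and comp: "comparable ks A"
    and opt: "optimal A C \<pi>" and small: "mcost C \<pi> \<le> b0 * \<phi>s"
  shows "(\<Sum>r<ks. real (card (As r)) * (norm (mean (A (\<pi> r)) - cs r))\<^sup>2) \<le> \<alpha> * mcost C \<pi>"
proof -
  have cl: "A \<in> clusterings X k C" using a A by (auto simp: clusterings_def)
  define f where "f = kmeans_cost X k C / \<phi>s"
  have f: "f \<ge> 0" "kmeans_cost X k C = f * \<phi>s"
    using kmeans_cost_nonneg[OF comparable_k_pos[OF cl], of X C] cost_pos by (simp_all add: f_def)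
  \<comment> \<open>Stability is invoked at the actual distance rather than at \<open>b0\<close>, so
    that the gain \<open>b \<le> \<alpha> * b'\<close> is proportional to the current
    distance.\<close>
  define b' where "b' = mcost C \<pi> / \<phi>s"
  have b': "Delta_on (nondegenerate A) C \<le> b' * \<phi>s" "b' \<le> b0" "mcost C \<pi> = b' * \<phi>s"
    using opt small cost_pos by (simp_all add: b'_def optimal_def pos_divide_le_eq)
  obtain b where b: "0 \<le> b" "b \<le> \<alpha> * b'"
    "\<And>r. r < ks \<Longrightarrow> real (card ((A (\<pi> r) - As r) \<union> (As r - A (\<pi> r))))
         \<le> b / (5 * b + 4 * (1 + f)) * real (card (As r))"
    using stability_bound[OF cl comp b'(1,2)] opt unfolding f_def by metis
  define \<rho> where "\<rho> = b / (5 * b + 4 * (1 + f))"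
  have \<rho>: "0 \<le> \<rho>" "\<rho> < 1 / 5"
    using b(1) f(1) by (simp_all add: \<rho>_def divide_less_eq)
  define P Q where "P r = A (\<pi> r)" and "Q r = (P r - As r) \<union> (As r - P r)" for r
  have sym: "real (card (Q r)) \<le> \<rho> * real (card (As r))" if "r < ks" for r
    using b(3)[OF that] by (simp add: \<rho>_def P_def Q_def)
  have finP: "finite (P r)" for r using finite_X by (simp add: P_def A clustering_of_def)
  have finQ: "finite (Q r)" for r using finP finite_As by (simp add: Q_def)
  have "bij_betw \<pi> {..<ks} (a ` X)"
    using optimal_bij[OF comp opt] by (simp add: A nondegenerate_clustering)
  then have P_sum: "(\<Sum>r<ks. \<Sum>x\<in>P r. (norm (x - C (\<pi> r)))\<^sup>2) = f * \<phi>s"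
    using sum.reindex_bij_betw[of \<pi> "{..<ks}" "a ` X" "\<lambda>r. \<Sum>x\<in>A r. (norm (x - C r))\<^sup>2"]
      sum_clustering[OF finite_X, of "a ` X" a "\<lambda>r x. (norm (x - C r))\<^sup>2"] finite_X
    by (simp add: P_def A kmeans_cost_closest[OF a] f(2)[symmetric])
  let ?d = "\<lambda>r. (norm (C (\<pi> r) - cs r))\<^sup>2"
  \<comment> \<open>Each point of the overlap bounds the distance of the two centroids by its own
    distances to them, and the overlap keeps a fraction \<open>1 - \<rho>\<close> of
    \<open>As r\<close>.\<close>
  have "(1 - \<rho>) * (real (card (As r)) * ?d r)
      \<le> 2 * (\<Sum>x\<in>P r. (norm (x - C (\<pi> r)))\<^sup>2) + 2 * (\<Sum>x\<in>As r. (norm (x - cs r))\<^sup>2)"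
    if r: "r < ks" for r
  proof -
    have "card (As r) \<le> card (P r \<inter> As r) + card (As r - P r)"
      using card_Un_le[of "P r \<inter> As r" "As r - P r"] by (simp add: Un_Diff_Int Int_commute Un_commute)
    moreover have "card (As r - P r) \<le> card (Q r)" using finQ unfolding Q_def by (intro card_mono) auto
    ultimately have "(1 - \<rho>) * real (card (As r)) \<le> real (card (P r \<inter> As r))"
      using sym[OF r] by (simp add: algebra_simps)
    then have "(1 - \<rho>) * (real (card (As r)) * ?d r) \<le> real (card (P r \<inter> As r)) * ?d r"
      unfolding mult.assoc[symmetric] by (rule mult_right_mono) simp
    also have "\<dots> = (\<Sum>x\<in>P r \<inter> As r. ?d r)" by simp
    also have "\<dots> \<le> (\<Sum>x\<in>P r \<inter> As r. 2 * (norm (x - C (\<pi> r)))\<^sup>2 + 2 * (norm (x - cs r))\<^sup>2)"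
      by (intro sum_mono) (metis norm_diff_square_le norm_minus_commute)
    also have "\<dots> = 2 * (\<Sum>x\<in>P r \<inter> As r. (norm (x - C (\<pi> r)))\<^sup>2) + 2 * (\<Sum>x\<in>P r \<inter> As r. (norm (x - cs r))\<^sup>2)"
      by (simp only: sum.distrib sum_distrib_left)
    also have "\<dots> \<le> 2 * (\<Sum>x\<in>P r. (norm (x - C (\<pi> r)))\<^sup>2) + 2 * (\<Sum>x\<in>As r. (norm (x - cs r))\<^sup>2)"
      using finP finite_As by (intro add_mono mult_left_mono sum_mono2) auto
    finally show ?thesis .
  qed
  then have "(\<Sum>r<ks. (1 - \<rho>) * (real (card (As r)) * ?d r))
      \<le> (\<Sum>r<ks. 2 * (\<Sum>x\<in>P r. (norm (x - C (\<pi> r)))\<^sup>2) + 2 * (\<Sum>x\<in>As r. (norm (x - cs r))\<^sup>2))"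
    by (intro sum_mono) auto
  also have "\<dots> = 2 * (f * \<phi>s) + 2 * \<phi>s"
    by (simp only: sum.distrib sum_distrib_left[symmetric] P_sum sum_As)
  finally have D1: "(1 - \<rho>) * mcost C \<pi> \<le> 2 * (1 + f) * \<phi>s"
    by (simp only: match_cost_def sum_distrib_left) (simp add: algebra_simps)
  have D: "2 * mcost C \<pi> \<le> 5 * (1 + f) * \<phi>s"
  proof -
    have "4 / 5 * mcost C \<pi> \<le> (1 - \<rho>) * mcost C \<pi>"
      using \<rho> match_cost_nonneg by (intro mult_right_mono) auto
    then show ?thesis using D1 by linarith
  qed
  \<comment> \<open>Points missing from \<open>P r\<close> are charged to the cost at
    \<open>cs\<close>. The extra points, at most \<open>\<rho> * card (As r)\<close> of them, are
    charged to the cost at \<open>C\<close> plus the displacement of the centroid.\<close>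
  have "(\<Sum>x\<in>Q r. (norm (x - cs r))\<^sup>2) \<le> (\<Sum>x\<in>As r. (norm (x - cs r))\<^sup>2)
      + 2 * (\<Sum>x\<in>P r. (norm (x - C (\<pi> r)))\<^sup>2) + 2 * \<rho> * (real (card (As r)) * ?d r)"
    if r: "r < ks" for r
  proof -
    have "(\<Sum>x\<in>P r - As r. (norm (x - cs r))\<^sup>2) \<le> (\<Sum>x\<in>P r - As r. 2 * (norm (x - C (\<pi> r)))\<^sup>2 + 2 * ?d r)"
      by (intro sum_mono norm_diff_square_le)
    also have "\<dots> = 2 * (\<Sum>x\<in>P r - As r. (norm (x - C (\<pi> r)))\<^sup>2) + 2 * (real (card (P r - As r)) * ?d r)"
      by (simp add: sum.distrib sum_distrib_left)
    also have "\<dots> \<le> 2 * (\<Sum>x\<in>P r. (norm (x - C (\<pi> r)))\<^sup>2) + 2 * (\<rho> * real (card (As r)) * ?d r)"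
    proof (intro add_mono mult_left_mono mult_right_mono sum_mono2)
      have "card (P r - As r) \<le> card (Q r)" using finQ unfolding Q_def by (intro card_mono) auto
      then show "real (card (P r - As r)) \<le> \<rho> * real (card (As r))" using sym[OF r] by linarith
    qed (use finP in auto)
    finally have "(\<Sum>x\<in>P r - As r. (norm (x - cs r))\<^sup>2)
      \<le> 2 * (\<Sum>x\<in>P r. (norm (x - C (\<pi> r)))\<^sup>2) + 2 * (\<rho> * real (card (As r)) * ?d r)" .
    moreover have "(\<Sum>x\<in>As r - P r. (norm (x - cs r))\<^sup>2) \<le> (\<Sum>x\<in>As r. (norm (x - cs r))\<^sup>2)"
      using finite_As by (intro sum_mono2) auto
    moreover have "(\<Sum>x\<in>Q r. (norm (x - cs r))\<^sup>2)
        = (\<Sum>x\<in>P r - As r. (norm (x - cs r))\<^sup>2) + (\<Sum>x\<in>As r - P r. (norm (x - cs r))\<^sup>2)"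
      unfolding Q_def using finP finite_As by (intro sum.union_disjoint) auto
    ultimately show ?thesis by simp
  qed
  then have "(\<Sum>r<ks. \<Sum>x\<in>Q r. (norm (x - cs r))\<^sup>2) \<le> (\<Sum>r<ks. (\<Sum>x\<in>As r. (norm (x - cs r))\<^sup>2)
      + 2 * (\<Sum>x\<in>P r. (norm (x - C (\<pi> r)))\<^sup>2) + 2 * \<rho> * (real (card (As r)) * ?d r))"
    by (intro sum_mono) auto
  also have "\<dots> = \<phi>s + 2 * (f * \<phi>s) + 2 * \<rho> * mcost C \<pi>"
    by (simp only: sum.distrib sum_distrib_left[symmetric] P_sum sum_As match_cost_def)
  also have "\<dots> \<le> (2 * (1 + f) + 5 * \<rho> * (1 + f)) * \<phi>s"
  proof -
    have "\<rho> * (2 * mcost C \<pi>) \<le> \<rho> * (5 * (1 + f) * \<phi>s)"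
      using D \<rho>(1) by (rule mult_left_mono)
    then show ?thesis using cost_pos by (simp add: algebra_simps)
  qed
  finally have Q_sum: "(\<Sum>r<ks. \<Sum>x\<in>Q r. (norm (x - cs r))\<^sup>2) \<le> (2 * (1 + f) + 5 * \<rho> * (1 + f)) * \<phi>s" .
  let ?L = "\<Sum>r<ks. real (card (As r)) * (norm (mean (P r) - cs r))\<^sup>2"
  have "(1 - \<rho>)\<^sup>2 * (real (card (As r)) * (norm (mean (P r) - cs r))\<^sup>2)
      \<le> \<rho> * (\<Sum>x\<in>Q r. (norm (x - cs r))\<^sup>2)" if r: "r < ks" for r
    using mean_perturbation[OF finP finite_As As_nonempty[OF r], of \<rho> r] \<rho> sym[OF r]
    by (simp add: Q_def cs_eq_mean[OF r])
  then have "(1 - \<rho>)\<^sup>2 * ?L \<le> \<rho> * (\<Sum>r<ks. \<Sum>x\<in>Q r. (norm (x - cs r))\<^sup>2)"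
    unfolding sum_distrib_left[where A = "{..<ks}"] by (intro sum_mono) auto
  also have "\<dots> \<le> \<rho> * ((2 * (1 + f) + 5 * \<rho> * (1 + f)) * \<phi>s)"
    using Q_sum \<rho>(1) by (rule mult_left_mono)
  also have "\<dots> \<le> (1 - \<rho>)\<^sup>2 * (b * \<phi>s)"
    using mult_right_mono[OF stability_arith[OF b(1) f(1) \<rho>_def], of \<phi>s] cost_pos by (simp add: mult.assoc)
  finally have "?L \<le> b * \<phi>s"
    using \<rho> by (subst (asm) mult_le_cancel_left_pos) auto
  also have "\<dots> \<le> \<alpha> * b' * \<phi>s"
    using b(2) cost_pos by (intro mult_right_mono) auto
  finally show ?thesis by (simp add: P_def b'(3))
qed

end

section \<open>Clusters do not become empty\<close>

context stable_clustering
begin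

lemma optimal_exists:
  assumes "comparable ks A"
  obtains \<pi> where "optimal A C \<pi>"
proof -
  have "finite (nondegenerate A)"
    using assms ks_pos by (intro card_ge_0_finite) (simp add: comparable_def)
  moreover have "ks \<le> card (nondegenerate A)" using assms by (simp add: comparable_def)
  ultimately obtain \<pi> where "\<pi> \<in> {..<ks} \<rightarrow>\<^sub>E nondegenerate A" "inj_on \<pi> {..<ks}"
    "mcost C \<pi> = Delta_on (nondegenerate A) C"
    by (rule Delta_on_attained)
  then show thesis by (intro that) (simp only: optimal_def)
qed

text \<open>
  If moving a tied point \<open>x\<close> emptied its cluster \<open>r\<close>, that cluster would be \<open>{x}\<close>, and by stability
  so would be the matched cluster of \<open>As\<close>.  Placing centroid \<open>r\<close> on top of centroid \<open>j\<close> then changes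
  neither the clustering nor the cost, while exchanging \<open>r\<close> and \<open>j\<close> keeps a matching optimal; but the
  clusters \<open>r\<close> and \<open>j\<close> cannot both be close to the same cluster of \<open>As\<close>.
\<close>

lemma tie_keeps_clusters:
  assumes a: "\<forall>x\<in>X. closest ks C x (a x)" and surj: "a ` X = {..<ks}"
    and small: "Delta_on {..<ks} C \<le> b0 * \<phi>s" and x: "x \<in> X" "closest ks C x j"
  shows "(a(x := j)) ` X = {..<ks}"
proof (rule ccontr)
  assume contr: "(a(x := j)) ` X \<noteq> {..<ks}"
  define r where "r = a x"
  have rj: "r < ks" "j < ks" using a x by (auto simp: closest_def r_def)
  have only_x: "a y = r \<Longrightarrow> y = x" if "y \<in> X" for y
  proof (rule ccontr)
    assume y: "a y = r" "y \<noteq> x"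
    have "(a(x := j)) z \<in> {..<ks}" if "z \<in> X" for z
      using that rj surj by (cases "z = x") auto
    moreover have "l \<in> (a(x := j)) ` X" if l: "l \<in> {..<ks}" for l
    proof -
      obtain z where z: "z \<in> X" "l = a z" using l surj by blast
      show ?thesis
      proof (cases "z = x")
        case True
        then have "l = (a(x := j)) y" using y z by (simp add: r_def)
        then show ?thesis using \<open>y \<in> X\<close> by (rule image_eqI)
      next
        case False
        then have "l = (a(x := j)) z" using z by simp
        then show ?thesis using \<open>z \<in> X\<close> by (rule image_eqI)
      qed
    qed
    ultimately have "(a(x := j)) ` X = {..<ks}" by blast
    with contr show False by (rule notE)
  qed
  have "r \<noteq> j"
  proof
    assume "r = j"
    then have "a(x := j) = a" by (auto simp: r_def)
    then show False using contr surj by simp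
  qed
  define A where "A = clustering_of X a"
  have nd: "nondegenerate A = {..<ks}" using surj by (simp add: A_def nondegenerate_clustering)
  have comp: "comparable ks A" by (simp add: comparable_def nd)
  have cl: "A \<in> clusterings X ks C" using a by (auto simp: A_def clusterings_def)
  have Ar: "A r = {x}" using only_x x by (auto simp: A_def clustering_of_def r_def)
  obtain \<pi> where \<pi>: "optimal A C \<pi>" using optimal_exists[OF comp] .
  have "r \<in> \<pi> ` {..<ks}"
    using optimal_bij[OF comp \<pi>] rj by (simp add: bij_betw_def nd)
  then obtain p where p: "p < ks" "\<pi> p = r" by auto
  have "5 * card ((A r - As p) \<union> (As p - A r)) < card (As p)"
    using symdiff_fifth[OF cl comp _ \<pi> p(1)] small p(2) by (simp add: nd)
  moreover have "card (As p) \<le> card (A r) + card (As p - A r)"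
  proof -
    have "card (As p) \<le> card (A r \<union> (As p - A r))"
      using finite_As[of p] by (intro card_mono) (auto simp: Ar)
    also have "\<dots> \<le> card (A r) + card (As p - A r)" by (rule card_Un_le)
    finally show ?thesis .
  qed
  moreover have "card (As p - A r) \<le> card ((A r - As p) \<union> (As p - A r))"
    using finite_As by (intro card_mono) (auto simp: Ar)
  \<comment> \<open>With \<open>c\<close> the size of the symmetric difference,
    \<open>5 * c < card (As p) \<le> 1 + c\<close> leaves only \<open>c = 0\<close>.\<close>
  ultimately have "card ((A r - As p) \<union> (As p - A r)) = 0" by (simp add: Ar)
  then have "As p = {x}" using finite_As by (auto simp: Ar)
  then have csp: "cs p = x" using cs_eq_mean[OF p(1)] by (simp add: mean_def)
  have dist: "norm (x - C r) = norm (x - C j)"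
    using a x rj unfolding r_def closest_def by (intro antisym) auto
  define C' where "C' = C(r := C j)"
  have "\<forall>y\<in>X. closest ks C' y (a y)"
  proof
    fix y assume y: "y \<in> X"
    show "closest ks C' y (a y)"
    proof (cases "y = x")
      case True
      then show ?thesis using a x rj dist by (auto simp: C'_def closest_def r_def)
    next
      case False
      then have "a y \<noteq> r" using only_x y by blast
      then show ?thesis using a y rj by (auto simp: C'_def closest_def)
    qed
  qed
  then have cl': "A \<in> clusterings X ks C'" by (auto simp: A_def clusterings_def)
  have \<pi>_props: "\<pi> \<in> {..<ks} \<rightarrow>\<^sub>E {..<ks}" "inj_on \<pi> {..<ks}" "mcost C \<pi> \<le> b0 * \<phi>s"
    using \<pi> small by (auto simp: optimal_def nd)
  have "mcost C' \<pi> = mcost C \<pi>"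
    unfolding match_cost_def
  proof (intro sum.cong refl)
    fix q assume "q \<in> {..<ks}"
    show "real (card (As q)) * (norm (C' (\<pi> q) - cs q))\<^sup>2 = real (card (As q)) * (norm (C (\<pi> q) - cs q))\<^sup>2"
    proof (cases "q = p")
      case True
      then show ?thesis
        using p(2) dist by (simp add: C'_def csp norm_minus_commute[of _ x])
    next
      case False
      then have "\<pi> q \<noteq> r" using \<pi>_props(2) p \<open>q \<in> {..<ks}\<close> by (auto simp: inj_on_def)
      then show ?thesis by (simp add: C'_def)
    qed
  qed
  then have small': "Delta_on (nondegenerate A) C' \<le> b0 * \<phi>s"
    using Delta_on_le[OF _ \<pi>_props(1,2), of C'] \<pi>_props(3) by (simp add: nd)
  obtain \<pi>1 where \<pi>1: "optimal A C' \<pi>1" using optimal_exists[OF comp] .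
  define \<pi>2 where "\<pi>2 = restrict (Transposition.transpose r j \<circ> \<pi>1) {..<ks}"
  have C'_transpose: "C' (Transposition.transpose r j l) = C' l" for l
    using \<open>r \<noteq> j\<close> by (simp add: C'_def Transposition.transpose_def)
  have "optimal A C' \<pi>2"
    unfolding optimal_def
  proof (intro conjI)
    have "\<pi>1 q < ks" if "q < ks" for q
      using \<pi>1 that by (auto simp: optimal_def nd PiE_def Pi_def)
    then have "Transposition.transpose r j (\<pi>1 q) < ks" if "q < ks" for q
      using rj that by (simp add: Transposition.transpose_def)
    then show "\<pi>2 \<in> {..<ks} \<rightarrow>\<^sub>E nondegenerate A"
      unfolding \<pi>2_def nd by (intro restrict_PiE_iff[THEN iffD2]) simp
    show "inj_on \<pi>2 {..<ks}"
      using \<pi>1 unfolding \<pi>2_def inj_on_restrict_eq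
      by (intro comp_inj_on) (simp_all add: optimal_def)
    show "mcost C' \<pi>2 = Delta_on (nondegenerate A) C'"
      using \<pi>1 by (simp add: optimal_def match_cost_def \<pi>2_def C'_transpose)
  qed
  moreover have "r \<in> \<pi>1 ` {..<ks}"
    using optimal_bij[OF comp \<pi>1] rj by (simp add: bij_betw_def nd)
  then obtain q where q: "q < ks" "\<pi>1 q = r" by auto
  then have "\<pi>2 q = j" by (simp add: \<pi>2_def)
  ultimately have 2: "5 * card ((A j - As q) \<union> (As q - A j)) < card (As q)"
    using symdiff_fifth[OF cl' comp small' _ q(1)] by metis
  have 1: "5 * card ((A r - As q) \<union> (As q - A r)) < card (As q)"
    using symdiff_fifth[OF cl' comp small' \<pi>1 q(1)] q(2) by simp
  have finA: "finite (A l)" for l using finite_X by (simp add: A_def clustering_of_def)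
  have "A r \<inter> A j = {}" using \<open>r \<noteq> j\<close> by (auto simp: A_def clustering_of_def)
  then have "card (As q) \<le> card ((As q - A r) \<union> (As q - A j))"
    using finite_As by (intro card_mono) auto
  also have "\<dots> \<le> card (As q - A r) + card (As q - A j)" by (rule card_Un_le)
  also have "\<dots> \<le> card ((A r - As q) \<union> (As q - A r)) + card ((A j - As q) \<union> (As q - A j))"
    using finA finite_As by (intro add_mono card_mono) auto
  finally show False using 1 2 by linarith
qed

text \<open>Two resolutions of the ties are joined by reassigning one point at a time with the
  centroids fixed; the induction is on the number of points where they differ.\<close>

lemma ties_keep_clusters:
  assumes "\<forall>x\<in>X. closest ks C x (a x)" "a ` X = {..<ks}" "Delta_on {..<ks} C \<le> b0 * \<phi>s"
    "\<forall>x\<in>X. closest ks C x (a' x)"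
  shows "a' ` X = {..<ks}"
  using assms(1,2)
proof (induction "card {x\<in>X. a x \<noteq> a' x}" arbitrary: a rule: less_induct)
  case less
  show ?case
  proof (cases "\<exists>x\<in>X. a x \<noteq> a' x")
    case True
    then obtain x where x: "x \<in> X" "a x \<noteq> a' x" by blast
    have "card {y\<in>X. (a(x := a' x)) y \<noteq> a' y} < card {y\<in>X. a y \<noteq> a' y}"
      using finite_X x by (intro psubset_card_mono) auto
    moreover have "\<forall>y\<in>X. closest ks C y ((a(x := a' x)) y)" using less.prems(1) assms(4) by simp
    moreover have "(a(x := a' x)) ` X = {..<ks}"
      using tie_keeps_clusters[OF less.prems assms(3) x(1)] assms(4) x(1) by blast
    ultimately show ?thesis by (rule less.hyps)
  next
    case False
    then have "a' ` X = a ` X" by (intro image_cong) auto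
    then show ?thesis using less.prems(2) by simp
  qed
qed

text \<open>
  Along the segment from \<open>cs\<close> to \<open>C\<close>, the parameters whose ties can be resolved without an empty
  cluster, and those whose ties can be resolved with one, form two disjoint closed sets.
\<close>

lemma small_cost_no_empty_cluster:
  assumes small: "mcost C id \<le> b0 * \<phi>s" and a: "\<forall>x\<in>X. closest ks C x (a x)"
  shows "a ` X = {..<ks}"
proof (rule ccontr)
  assume contr: "a ` X \<noteq> {..<ks}"
  define Cs where "Cs s r = cs r + s *\<^sub>R (C r - cs r)" for s :: real and r
  define T where "T g = {s \<in> {0..1}. \<forall>x\<in>X. \<forall>j<ks. norm (x - Cs s (g x)) \<le> norm (x - Cs s j)}" for g
  define G where "G = X \<rightarrow>\<^sub>E {..<ks}"
  have finG: "finite G" unfolding G_def using finite_X by (intro finite_PiE) auto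
  have T_iff: "s \<in> T g \<longleftrightarrow> 0 \<le> s \<and> s \<le> 1 \<and> (\<forall>x\<in>X. closest ks (Cs s) x (g x))" if "g \<in> G" for g s
    using that by (auto simp: T_def closest_def G_def PiE_def)
  have closedT: "closed (T g)" for g
  proof -
    have "T g = {0..1} \<inter> (\<Inter>x\<in>X. \<Inter>j\<in>{..<ks}. {s. norm (x - Cs s (g x)) \<le> norm (x - Cs s j)})"
      by (auto simp: T_def)
    also have "closed \<dots>"
      unfolding Cs_def by (intro closed_Int closed_INT ballI closed_atLeastAtMost closed_Collect_le continuous_intros)
    finally show ?thesis .
  qed
  \<comment> \<open>Under the identity matching the cost scales by \<open>s\<^sup>2\<close> along
    the segment, so every intermediate tuple stays in the basin and the result on ties applies to
    it.\<close>
  have cost: "Delta_on {..<ks} (Cs s) \<le> b0 * \<phi>s" if "0 \<le> s" "s \<le> 1" for s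
  proof -
    have "Delta_on {..<ks} (Cs s) \<le> mcost (Cs s) (restrict id {..<ks})"
      by (rule Delta_on_le) auto
    also have "\<dots> = s\<^sup>2 * mcost C id"
      by (simp add: match_cost_def Cs_def power_mult_distrib sum_distrib_left mult_ac)
    also have "\<dots> \<le> 1 * mcost C id"
      using that match_cost_nonneg by (intro mult_right_mono power_le_one)
    finally show ?thesis using small by simp
  qed
  define T1 T2 where "T1 = (\<Union>g\<in>{g\<in>G. g ` X = {..<ks}}. T g)" and "T2 = (\<Union>g\<in>{g\<in>G. g ` X \<noteq> {..<ks}}. T g)"
  have closed: "closed T1" "closed T2"
    unfolding T1_def T2_def using finG closedT by (intro closed_UN ballI; simp)+
  have cover: "{0..1} \<subseteq> T1 \<union> T2"
  proof
    fix s :: real assume s: "s \<in> {0..1}"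
    have "\<exists>r. closest ks (Cs s) x r" for x
    proof -
      let ?f = "\<lambda>r. norm (x - Cs s r)"
      have "Min (?f ` {..<ks}) \<in> ?f ` {..<ks}" using ks_pos by (intro Min_in) auto
      then obtain r where "r < ks" "Min (?f ` {..<ks}) = ?f r" by auto
      then show ?thesis by (auto simp: closest_def intro!: exI[of _ r]) (metis Min_le finite_imageI finite_lessThan imageI lessThan_iff)
    qed
    then obtain g where g: "closest ks (Cs s) x (g x)" for x by metis
    have "restrict g X \<in> G" using g by (auto simp: G_def closest_def)
    moreover have "s \<in> T (restrict g X)" using s g by (simp add: T_iff[OF calculation])
    ultimately show "s \<in> T1 \<union> T2" unfolding T1_def T2_def by blast
  qed
  have disjoint: "T1 \<inter> T2 = {}"
  proof (rule equals0I)
    fix s assume "s \<in> T1 \<inter> T2"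
    then obtain g h where gh: "g \<in> G" "h \<in> G" "g ` X = {..<ks}" "h ` X \<noteq> {..<ks}" "s \<in> T g" "s \<in> T h"
      unfolding T1_def T2_def by blast
    then have s: "0 \<le> s" "s \<le> 1" "\<forall>x\<in>X. closest ks (Cs s) x (g x)" "\<forall>x\<in>X. closest ks (Cs s) x (h x)"
      using T_iff by blast+
    show False using ties_keep_clusters[OF s(3) gh(3) cost[OF s(1,2)] s(4)] gh(4) by blast
  qed
  have zero: "0 \<in> T1"
  proof -
    obtain g where g: "As = clustering_of X g" "\<forall>x\<in>X. closest ks cs x (g x)" by (rule As_assignment)
    have Cs0: "Cs 0 = cs" by (simp add: Cs_def fun_eq_iff)
    have "restrict g X \<in> G" using g(2) by (auto simp: G_def closest_def)
    moreover have "0 \<in> T (restrict g X)" using g(2) by (simp add: T_iff[OF calculation] Cs0)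
    moreover have "restrict g X ` X = {..<ks}"
      using nondegenerate_As by (simp add: g(1) nondegenerate_clustering)
    ultimately show ?thesis unfolding T1_def by blast
  qed
  have one: "1 \<in> T2"
  proof -
    have Cs1: "Cs 1 = C" by (simp add: Cs_def fun_eq_iff)
    have "restrict a X \<in> G" using a by (auto simp: G_def closest_def)
    moreover have "1 \<in> T (restrict a X)" using a by (simp add: T_iff[OF calculation] Cs1)
    moreover have "restrict a X ` X \<noteq> {..<ks}" using contr by simp
    ultimately show ?thesis unfolding T2_def by blast
  qed
  have "T1 \<inter> {0..1} = {} \<or> T2 \<inter> {0..1} = {}"
    by (rule connected_closedD[OF connected_Icc _ cover closed]) (simp add: disjoint)
  moreover have "0 \<in> T1 \<inter> {0..1}" "1 \<in> T2 \<inter> {0..1}" using zero one by simp_all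
  ultimately show False by blast
qed

text \<open>Relabelling the centroids by an optimal matching \<open>\<nu>\<close> turns it into the
  identity, which reduces the claim to \<open>small_cost_no_empty_cluster\<close>. Centroids outside
  \<open>N\<close> drop out because no point is assigned to them.\<close>

lemma Delta_on_no_empty_cluster:
  assumes a: "\<forall>x\<in>X. closest k C x (a x)" and N: "a ` X \<subseteq> N" "N \<subseteq> {..<k}" "card N = ks"
    and small: "Delta_on N C \<le> b0 * \<phi>s"
  shows "a ` X = N"
proof -
  have finN: "finite N" using N(2) finite_subset by blast
  obtain \<nu> where \<nu>: "\<nu> \<in> {..<ks} \<rightarrow>\<^sub>E N" "inj_on \<nu> {..<ks}" "mcost C \<nu> = Delta_on N C"
    using Delta_on_attained[OF finN] N(3) by (metis order_refl)
  have im: "\<nu> ` {..<ks} = N"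
    using \<nu> N(3) finN by (intro card_seteq) (auto simp: card_image)
  define a' where "a' = inv_into {..<ks} \<nu> \<circ> a"
  have \<nu>a': "\<nu> (a' x) = a x" "a' x < ks" if "x \<in> X" for x
    using that N(1) im f_inv_into_f[of "a x" \<nu> "{..<ks}"] inv_into_into[of "a x" \<nu> "{..<ks}"]
    by (auto simp: a'_def)
  have "closest ks (C \<circ> \<nu>) x (a' x)" if "x \<in> X" for x
  proof -
    have "\<nu> l < k" if "l < ks" for l using \<nu>(1) N(2) that by (auto simp: PiE_def Pi_def)
    then show ?thesis using a that \<nu>a' by (auto simp: closest_def)
  qed
  moreover have "mcost (C \<circ> \<nu>) id \<le> b0 * \<phi>s"
    using \<nu>(3) small by (simp add: match_cost_def)
  ultimately have "a' ` X = {..<ks}" by (intro small_cost_no_empty_cluster) auto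
  then have "\<nu> ` a' ` X = N" using im by simp
  moreover have "\<nu> ` a' ` X = a ` X" unfolding image_image using \<nu>a' by (intro image_cong) auto
  ultimately show ?thesis by simp
qed

end

section \<open>One mini-batch step\<close>

text \<open>Replacing the \<open>l\<close>-th draw by another point of the same cluster leaves the
  index set \<open>subsample\<close> unchanged, so every point of the cluster carries the same total
  weight as \<open>x0\<close>. That weight is left unevaluated here.\<close>

lemma subsample_sum_exchange:
  fixes v :: "real^'d \<Rightarrow> 'b::real_vector"
  assumes X: "finite X" and x0: "x0 \<in> X" "a x0 = r"
  shows "(\<Sum>s\<in>{..<m} \<rightarrow>\<^sub>E X. (\<Sum>l\<in>subsample m a s r. v (s l)) /\<^sub>R real (card (subsample m a s r)))
    = (\<Sum>l<m. \<Sum>s | s \<in> {..<m} \<rightarrow>\<^sub>E X \<and> s l = x0. 1 / real (card (subsample m a s r)))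
      *\<^sub>R (\<Sum>x\<in>clustering_of X a r. v x)"
proof -
  let ?W = "{..<m} \<rightarrow>\<^sub>E X" and ?A = "clustering_of X a r"
  let ?c = "\<lambda>s. 1 / real (card (subsample m a s r))"
  have finW: "finite ?W" using X by (intro finite_PiE) auto
  have finA: "finite ?A" using X by (simp add: clustering_of_def)
  have K: "(\<Sum>s | s \<in> ?W \<and> s l = x. ?c s) = (\<Sum>s | s \<in> ?W \<and> s l = x0. ?c s)"
    if l: "l < m" and x: "x \<in> ?A" for l x
  proof (rule sum.reindex_bij_witness[of _ "\<lambda>s. s(l := x)" "\<lambda>s. s(l := x0)"])
    fix s assume s: "s \<in> {s. s \<in> ?W \<and> s l = x}"
    have "subsample m a (s(l := x0)) r = subsample m a s r"
      using s x0 x by (auto simp: subsample_def clustering_of_def)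
    then show "?c (s(l := x0)) = ?c s" by simp
    show "s(l := x0) \<in> {s. s \<in> ?W \<and> s l = x0}" using s x0 l by (auto simp: PiE_def extensional_def)
  next
    fix s assume s: "s \<in> {s. s \<in> ?W \<and> s l = x0}"
    show "s(l := x) \<in> {s. s \<in> ?W \<and> s l = x}"
      using s x l by (auto simp: PiE_def extensional_def clustering_of_def)
  qed auto
  have "(\<Sum>s\<in>?W. (\<Sum>l\<in>subsample m a s r. v (s l)) /\<^sub>R real (card (subsample m a s r)))
      = (\<Sum>s\<in>?W. \<Sum>l<m. if a (s l) = r then ?c s *\<^sub>R v (s l) else 0)"
  proof (intro sum.cong refl)
    fix s
    have "(\<Sum>l\<in>subsample m a s r. v (s l)) /\<^sub>R real (card (subsample m a s r))
        = (\<Sum>l\<in>{l\<in>{..<m}. a (s l) = r}. ?c s *\<^sub>R v (s l))"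
      by (simp add: scaleR_sum_right subsample_def inverse_eq_divide)
    also have "\<dots> = (\<Sum>l<m. if a (s l) = r then ?c s *\<^sub>R v (s l) else 0)"
      by (rule sum.inter_filter) simp
    finally show "(\<Sum>l\<in>subsample m a s r. v (s l)) /\<^sub>R real (card (subsample m a s r))
        = (\<Sum>l<m. if a (s l) = r then ?c s *\<^sub>R v (s l) else 0)" .
  qed
  also have "\<dots> = (\<Sum>l<m. \<Sum>s\<in>?W. if a (s l) = r then ?c s *\<^sub>R v (s l) else 0)"
    by (rule sum.swap)
  also have "\<dots> = (\<Sum>l<m. (\<Sum>s | s \<in> ?W \<and> s l = x0. ?c s) *\<^sub>R (\<Sum>x\<in>?A. v x))"
  proof (intro sum.cong refl)
    fix l assume "l \<in> {..<m}"
    then have l: "l < m" by simp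
    have "(\<Sum>s\<in>?W. if a (s l) = r then ?c s *\<^sub>R v (s l) else 0)
        = (\<Sum>s\<in>{s\<in>?W. a (s l) = r}. ?c s *\<^sub>R v (s l))"
      by (rule sum.inter_filter[symmetric, OF finW])
    also have "\<dots> = (\<Sum>x\<in>?A. \<Sum>s\<in>{s \<in> {s\<in>?W. a (s l) = r}. s l = x}. ?c s *\<^sub>R v (s l))"
      using finW finA l by (intro sum.group[symmetric]) (auto simp: clustering_of_def)
    also have "\<dots> = (\<Sum>x\<in>?A. (\<Sum>s | s \<in> ?W \<and> s l = x. ?c s) *\<^sub>R v x)"
      unfolding scaleR_sum_left by (intro sum.cong) (auto simp: clustering_of_def)
    also have "\<dots> = (\<Sum>s | s \<in> ?W \<and> s l = x0. ?c s) *\<^sub>R (\<Sum>x\<in>?A. v x)"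
      unfolding scaleR_sum_right by (intro sum.cong refl) (simp only: K[OF l])
    finally show "(\<Sum>s\<in>?W. if a (s l) = r then ?c s *\<^sub>R v (s l) else 0)
      = (\<Sum>s | s \<in> ?W \<and> s l = x0. ?c s) *\<^sub>R (\<Sum>x\<in>?A. v x)" .
  qed
  finally show ?thesis by (simp add: scaleR_sum_left)
qed

text \<open>Samples missing the cluster are exactly the \<open>m\<close>-tuples from its
  complement.\<close>

lemma card_subsample_nonempty:
  assumes "finite X"
  shows "(\<Sum>s\<in>{..<m} \<rightarrow>\<^sub>E X. if subsample m a s r = {} then 0 else 1::real)
    = real (card X) ^ m - (real (card X) - real (card (clustering_of X a r))) ^ m"
proof -
  have sub: "clustering_of X a r \<subseteq> X" by (auto simp: clustering_of_def)
  have finW: "finite ({..<m} \<rightarrow>\<^sub>E X)" using assms by (intro finite_PiE) auto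
  have "(\<Sum>s\<in>{..<m} \<rightarrow>\<^sub>E X. if subsample m a s r = {} then 1 else 0::real)
      = (\<Sum>s\<in>{s \<in> {..<m} \<rightarrow>\<^sub>E X. subsample m a s r = {}}. 1)"
    by (rule sum.inter_filter[symmetric, OF finW])
  also have "{s \<in> {..<m} \<rightarrow>\<^sub>E X. subsample m a s r = {}} = {..<m} \<rightarrow>\<^sub>E (X - clustering_of X a r)"
    by (auto simp: subsample_def clustering_of_def PiE_def Pi_def)
  also have "(\<Sum>s\<in>{..<m} \<rightarrow>\<^sub>E (X - clustering_of X a r). 1)
      = (real (card X) - real (card (clustering_of X a r))) ^ m"
    using assms sub by (simp add: card_PiE card_Diff_subset finite_subset card_mono of_nat_diff)
  finally have "(\<Sum>s\<in>{..<m} \<rightarrow>\<^sub>E X. if subsample m a s r = {} then 1 else 0::real)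
      = (real (card X) - real (card (clustering_of X a r))) ^ m" .
  moreover have "(\<Sum>s\<in>{..<m} \<rightarrow>\<^sub>E X. if subsample m a s r = {} then 0 else 1::real)
      = (\<Sum>s\<in>{..<m} \<rightarrow>\<^sub>E X. 1 - (if subsample m a s r = {} then 1 else 0))"
    by (intro sum.cong) auto
  ultimately show ?thesis using assms by (simp add: sum_subtractf card_PiE)
qed

text \<open>Given that the cluster is hit, the mean over its sub-sample is unbiased for the mean
  over the cluster; the scalar factor is the probability of a hit.\<close>

lemma average_subsample:
  fixes v :: "real^'d \<Rightarrow> 'b::real_vector"
  assumes X: "finite X" "X \<noteq> {}"
  shows "(\<Sum>s\<in>{..<m} \<rightarrow>\<^sub>E X. (\<Sum>l\<in>subsample m a s r. v (s l)) /\<^sub>R real (card (subsample m a s r)))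
      /\<^sub>R real (card X) ^ m
    = (1 - (1 - real (card (clustering_of X a r)) / real (card X)) ^ m)
      *\<^sub>R ((\<Sum>x\<in>clustering_of X a r. v x) /\<^sub>R real (card (clustering_of X a r)))"
proof (cases "clustering_of X a r = {}")
  case True
  have "subsample m a s r = {}" if "s \<in> {..<m} \<rightarrow>\<^sub>E X" for s
    using that True by (auto simp: subsample_def clustering_of_def)
  then show ?thesis by (simp add: True)
next
  case False
  then obtain x0 where x0: "x0 \<in> X" "a x0 = r" by (auto simp: clustering_of_def)
  let ?n = "real (card X)" and ?N = "real (card (clustering_of X a r))"
  define K where "K = (\<Sum>l<m. \<Sum>s | s \<in> {..<m} \<rightarrow>\<^sub>E X \<and> s l = x0. 1 / real (card (subsample m a s r)))"
  have n: "?n > 0" using X by (simp add: card_gt_0_iff)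
  have N: "?N > 0" using False X by (simp add: card_gt_0_iff clustering_of_def)
  \<comment> \<open>The common weight \<open>K\<close> is found by testing with the constant
    function 1, whose sub-sample mean is the indicator of a hit.\<close>
  have "K *\<^sub>R ?N = (\<Sum>s\<in>{..<m} \<rightarrow>\<^sub>E X. (\<Sum>l\<in>subsample m a s r. 1) /\<^sub>R real (card (subsample m a s r)))"
    using subsample_sum_exchange[where a = a and r = r and v = "\<lambda>_. 1::real", OF X(1) x0] by (simp add: K_def)
  also have "\<dots> = (\<Sum>s\<in>{..<m} \<rightarrow>\<^sub>E X. if subsample m a s r = {} then 0 else 1)"
    by (intro sum.cong) (auto simp: subsample_def)
  finally have "K * ?N = ?n ^ m - (?n - ?N) ^ m"
    by (simp add: card_subsample_nonempty[OF X(1)])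
  then have "K = (?n ^ m - (?n - ?N) ^ m) / ?N"
    using N by (simp only: nonzero_eq_divide_eq)
  moreover have "1 - (1 - ?N / ?n) ^ m = (?n ^ m - (?n - ?N) ^ m) / ?n ^ m"
  proof -
    have "1 - ?N / ?n = (?n - ?N) / ?n" using n by (simp add: diff_divide_distrib)
    then show ?thesis using n by (simp only: power_divide) (simp add: diff_divide_distrib)
  qed
  ultimately have "K / ?n ^ m = (1 - (1 - ?N / ?n) ^ m) / ?N" by simp
  then show ?thesis
    unfolding subsample_sum_exchange[where a = a and r = r, OF X(1) x0] K_def[symmetric]
    by (simp add: inverse_eq_divide)
qed

text \<open>For an empty sub-sample the empty sum makes this 0, so one formula covers both branches
  of \<open>skm_step\<close>, the unmoved centroid included.\<close>

definition sample_shift where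
  "sample_shift m a s C r = (\<Sum>l\<in>subsample m a s r. s l - C r) /\<^sub>R real (card (subsample m a s r))"

lemma skm_step_eq_shift: "skm_step m \<eta> a s C r = C r + \<eta> r *\<^sub>R sample_shift m a s C r"
proof (cases "subsample m a s r = {}")
  case False
  have "finite (subsample m a s r)" by (simp add: subsample_def)
  then have "real (card (subsample m a s r)) \<noteq> 0" using False by simp
  then have "sample_shift m a s C r = (\<Sum>l\<in>subsample m a s r. s l) /\<^sub>R real (card (subsample m a s r)) - C r"
    by (simp add: sample_shift_def sum_subtractf sum_constant_scaleR scaleR_diff_right del: sum_constant)
  then have avg: "(\<Sum>l\<in>subsample m a s r. s l) /\<^sub>R real (card (subsample m a s r)) = C r + sample_shift m a s C r"
    by simp
  show ?thesis unfolding skm_step_def avg using False by (simp add: algebra_simps)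
qed (simp add: skm_step_def sample_shift_def)

lemma average_sample_shift:
  assumes X: "finite X" "X \<noteq> {}" and ne: "clustering_of X a r \<noteq> {}"
  shows "(\<Sum>s\<in>{..<m} \<rightarrow>\<^sub>E X. sample_shift m a s C r) /\<^sub>R real (card X) ^ m
    = (1 - (1 - real (card (clustering_of X a r)) / real (card X)) ^ m) *\<^sub>R (mean (clustering_of X a r) - C r)"
proof -
  have "real (card (clustering_of X a r)) > 0"
    using ne X by (simp add: card_gt_0_iff clustering_of_def)
  then have "(\<Sum>x\<in>clustering_of X a r. x - C r) /\<^sub>R real (card (clustering_of X a r)) = mean (clustering_of X a r) - C r"
    by (simp add: mean_def sum_subtractf sum_constant_scaleR scaleR_diff_right del: sum_constant)
  then show ?thesis
    unfolding sample_shift_def average_subsample[OF X, where v = "\<lambda>x. x - C r"] by simp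
qed

text \<open>A mean of squares is at most its largest term, here majorised by the sum over the whole
  cluster. The bound is uniform in the sample and in \<open>m\<close>, and adding it over the
  clusters produces the k-means cost.\<close>

lemma norm_sample_shift_le:
  assumes X: "finite X" and s: "s \<in> {..<m} \<rightarrow>\<^sub>E X"
  shows "(norm (sample_shift m a s C r))\<^sup>2 \<le> (\<Sum>x\<in>clustering_of X a r. (norm (x - C r))\<^sup>2)"
proof (cases "subsample m a s r = {}")
  case True
  then show ?thesis by (simp add: sample_shift_def sum_nonneg)
next
  case False
  let ?L = "subsample m a s r"
  have finL: "finite ?L" by (simp add: subsample_def)
  then have N: "real (card ?L) > 0" using False by (simp add: card_gt_0_iff)
  have "(real (card ?L) * norm (sample_shift m a s C r))\<^sup>2 = (norm (\<Sum>l\<in>?L. s l - C r))\<^sup>2"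
    using N by (simp add: sample_shift_def)
  also have "\<dots> \<le> (\<Sum>l\<in>?L. norm (s l - C r))\<^sup>2"
    by (intro power_mono norm_sum) simp
  also have "\<dots> \<le> (\<Sum>l\<in>?L. (norm (s l - C r))\<^sup>2) * real (card ?L)"
    by (rule sum_squared_le_sum_of_squares)
  also have "\<dots> \<le> (\<Sum>l\<in>?L. (\<Sum>x\<in>clustering_of X a r. (norm (x - C r))\<^sup>2)) * real (card ?L)"
  proof (intro mult_right_mono sum_mono)
    fix l assume "l \<in> ?L"
    then have "s l \<in> clustering_of X a r" using s by (auto simp: subsample_def clustering_of_def)
    then show "(norm (s l - C r))\<^sup>2 \<le> (\<Sum>x\<in>clustering_of X a r. (norm (x - C r))\<^sup>2)"
      using X by (intro member_le_sum) (auto simp: clustering_of_def)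
  qed simp
  also have "\<dots> = (real (card ?L))\<^sup>2 * (\<Sum>x\<in>clustering_of X a r. (norm (x - C r))\<^sup>2)"
    by (simp add: power2_eq_square)
  finally show ?thesis using N by (simp add: power_mult_distrib)
qed

lemma weighted_Cauchy_Schwarz:
  fixes u d :: "'i \<Rightarrow> 'b::real_inner"
  assumes "\<And>i. i \<in> I \<Longrightarrow> w i \<ge> 0"
  shows "(\<Sum>i\<in>I. w i * (u i \<bullet> d i))\<^sup>2 \<le> (\<Sum>i\<in>I. w i * (norm (u i))\<^sup>2) * (\<Sum>i\<in>I. w i * (norm (d i))\<^sup>2)"
proof -
  have "\<bar>\<Sum>i\<in>I. w i * (u i \<bullet> d i)\<bar> \<le> (\<Sum>i\<in>I. (sqrt (w i) * norm (u i)) * (sqrt (w i) * norm (d i)))"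
  proof (rule order_trans[OF sum_abs sum_mono])
    fix i assume i: "i \<in> I"
    have "\<bar>w i * (u i \<bullet> d i)\<bar> \<le> w i * (norm (u i) * norm (d i))"
      unfolding abs_mult using assms[OF i] Cauchy_Schwarz_ineq2[of "u i" "d i"] by (simp add: mult_left_mono)
    also have "\<dots> = (sqrt (w i))\<^sup>2 * (norm (u i) * norm (d i))" using assms[OF i] by simp
    finally show "\<bar>w i * (u i \<bullet> d i)\<bar> \<le> (sqrt (w i) * norm (u i)) * (sqrt (w i) * norm (d i))"
      by (simp only: power2_eq_square mult_ac)
  qed
  from power_mono[OF this abs_ge_zero, of 2]
  have "(\<Sum>i\<in>I. w i * (u i \<bullet> d i))\<^sup>2 \<le> (\<Sum>i\<in>I. (sqrt (w i) * norm (u i)) * (sqrt (w i) * norm (d i)))\<^sup>2"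
    by simp
  also have "\<dots> \<le> (\<Sum>i\<in>I. (sqrt (w i) * norm (u i))\<^sup>2) * (\<Sum>i\<in>I. (sqrt (w i) * norm (d i))\<^sup>2)"
    by (rule Cauchy_Schwarz_ineq_sum)
  also have "\<dots> = (\<Sum>i\<in>I. w i * (norm (u i))\<^sup>2) * (\<Sum>i\<in>I. w i * (norm (d i))\<^sup>2)"
    using assms by (simp add: power_mult_distrib)
  finally show ?thesis .
qed

section \<open>Drift and noise of one step\<close>

context stable_clustering
begin

lemma p_min_le: "r < ks \<Longrightarrow> p_min X ks As \<le> real (card (As r)) / real (card X)"
  unfolding p_min_def by (intro Min_le) auto

lemma p_min_bounds: "0 < p_min X ks As" "p_min X ks As \<le> 1"
proof -
  have X: "real (card X) > 0" using finite_X X_nonempty by (simp add: card_gt_0_iff)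
  show "0 < p_min X ks As"
    unfolding p_min_def using ks_pos X card_As_pos by (subst Min_gr_iff) auto
  have "real (card (As 0)) / real (card X) \<le> 1" using card_As_le X by simp
  then show "p_min X ks As \<le> 1" using p_min_le[OF ks_pos] by linarith
qed

text \<open>The rate \<kappa> of the overview: a lower bound for the probability that a given
  cluster is hit, where 4/5 is the part of \<open>As r\<close> surely kept by the matched cluster,
  less the loss \<open>sqrt \<alpha>\<close> in the cross term.\<close>

definition drift_rate :: "nat \<Rightarrow> real" where
  "drift_rate m = 1 - sqrt \<alpha> - (1 - 4/5 * p_min X ks As) ^ m"

text \<open>With the matching held fixed, the cost after the step is a quadratic polynomial in
  \<eta>: \<open>P s\<close> is twice the weighted inner product of shift and error,
  \<open>V s\<close> the weighted squared length of the shift. The bound on \<open>P\<close> follows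
  from that on \<open>V\<close> by Cauchy-Schwarz; only the drift uses the average over
  samples.\<close>

lemma step_expansion:
  assumes a: "\<forall>x\<in>X. closest k C x (a x)" and A: "A = clustering_of X a" and comp: "comparable ks A"
    and opt: "optimal A C \<pi>" and small: "mcost C \<pi> \<le> b0 * \<phi>s"
  obtains P V where
    "\<And>\<eta> s. mcost (skm_step m (\<lambda>_. \<eta>) a s C) \<pi> = mcost C \<pi> + \<eta> * P s + \<eta>\<^sup>2 * V s"
    "\<And>s. s \<in> {..<m} \<rightarrow>\<^sub>E X \<Longrightarrow> V s \<le> real (card X) * (1 + b0) * \<phi>s"
    "\<And>s. s \<in> {..<m} \<rightarrow>\<^sub>E X \<Longrightarrow> (P s)\<^sup>2 \<le> 4 * real (card X) * b0 * (1 + b0) * \<phi>s\<^sup>2"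
    "(\<Sum>s\<in>{..<m} \<rightarrow>\<^sub>E X. P s) / real (card X) ^ m \<le> - 2 * drift_rate m * mcost C \<pi>"
proof -
  define n where "n = real (card X)"
  have n: "n > 0" using finite_X X_nonempty by (simp add: card_gt_0_iff n_def)
  define w where "w r = real (card (As r))" for r
  define d where "d r = C (\<pi> r) - cs r" for r
  define u where "u s r = sample_shift m a s C (\<pi> r)" for s r
  define P where "P s = 2 * (\<Sum>r<ks. w r * (u s r \<bullet> d r))" for s
  define V where "V s = (\<Sum>r<ks. w r * (norm (u s r))\<^sup>2)" for s
  define Y where "Y = mcost C \<pi>"
  have Y: "Y = (\<Sum>r<ks. w r * (norm (d r))\<^sup>2)" by (simp add: Y_def match_cost_def w_def d_def)
  have Y_nonneg: "Y \<ge> 0" unfolding Y_def by (rule match_cost_nonneg)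
  have bij: "bij_betw \<pi> {..<ks} (a ` X)"
    using optimal_bij[OF comp opt] by (simp add: A nondegenerate_clustering)
  have \<pi>_less: "\<pi> \<in> {..<ks} \<rightarrow> {..<k}"
  proof
    fix r assume "r \<in> {..<ks}"
    then have "\<pi> r \<in> a ` X" using bij by (auto dest: bij_betwE)
    then show "\<pi> r \<in> {..<k}" using a by (auto simp: closest_def)
  qed
  have expansion: "mcost (skm_step m (\<lambda>_. \<eta>) a s C) \<pi> = mcost C \<pi> + \<eta> * P s + \<eta>\<^sup>2 * V s" for \<eta> s
  proof -
    have "w r * (norm (skm_step m (\<lambda>_. \<eta>) a s C (\<pi> r) - cs r))\<^sup>2
        = w r * (norm (d r))\<^sup>2 + \<eta> * (2 * (w r * (u s r \<bullet> d r))) + \<eta>\<^sup>2 * (w r * (norm (u s r))\<^sup>2)" for r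
      unfolding skm_step_eq_shift u_def[symmetric] d_def power2_norm_eq_inner
      by (simp add: inner_add_left inner_add_right inner_diff_left inner_diff_right inner_commute
          power2_eq_square distrib_left left_diff_distrib right_diff_distrib mult_ac)
    then have "mcost (skm_step m (\<lambda>_. \<eta>) a s C) \<pi>
        = (\<Sum>r<ks. w r * (norm (d r))\<^sup>2 + \<eta> * (2 * (w r * (u s r \<bullet> d r))) + \<eta>\<^sup>2 * (w r * (norm (u s r))\<^sup>2))"
      unfolding match_cost_def w_def[symmetric] by (intro sum.cong refl)
    then show ?thesis
      unfolding Y_def[symmetric] Y P_def V_def by (simp add: sum.distrib sum_distrib_left)
  qed
  have V_le: "V s \<le> n * (1 + b0) * \<phi>s" if s: "s \<in> {..<m} \<rightarrow>\<^sub>E X" for s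
  proof -
    \<comment> \<open>Replacing the weights by their common bound \<open>n\<close> leaves each
      cluster's cost once; this is the origin of the factor \<open>card X\<close> in the
      noise.\<close>
    have "V s \<le> (\<Sum>r<ks. n * (\<Sum>x\<in>clustering_of X a (\<pi> r). (norm (x - C (\<pi> r)))\<^sup>2))"
      unfolding V_def u_def
    proof (intro sum_mono mult_mono)
      fix r show "w r \<le> n" using card_As_le[of r] by (simp add: w_def n_def)
      show "(norm (sample_shift m a s C (\<pi> r)))\<^sup>2 \<le> (\<Sum>x\<in>clustering_of X a (\<pi> r). (norm (x - C (\<pi> r)))\<^sup>2)"
        by (rule norm_sample_shift_le[OF finite_X s])
    qed (use n in auto)
    also have "\<dots> = n * (\<Sum>r\<in>a ` X. \<Sum>x\<in>clustering_of X a r. (norm (x - C r))\<^sup>2)"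
      unfolding sum_distrib_left[symmetric]
      by (simp only: sum.reindex_bij_betw[OF bij, of "\<lambda>r. \<Sum>x\<in>clustering_of X a r. (norm (x - C r))\<^sup>2"])
    also have "\<dots> = n * kmeans_cost X k C"
      using finite_X sum_clustering[OF finite_X, of "a ` X" a "\<lambda>r x. (norm (x - C r))\<^sup>2"]
      by (simp add: kmeans_cost_closest[OF a])
    also have "\<dots> \<le> n * (\<phi>s + b0 * \<phi>s)"
      using kmeans_cost_le_match[OF \<pi>_less, of C] small n by (intro mult_left_mono) auto
    finally show ?thesis by (simp add: algebra_simps)
  qed
  have P_le: "(P s)\<^sup>2 \<le> 4 * n * b0 * (1 + b0) * \<phi>s\<^sup>2" if s: "s \<in> {..<m} \<rightarrow>\<^sub>E X" for s
  proof -
    have "(P s)\<^sup>2 = 4 * (\<Sum>r<ks. w r * (u s r \<bullet> d r))\<^sup>2" by (simp add: P_def power_mult_distrib)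
    also have "\<dots> \<le> 4 * (V s * Y)"
      unfolding V_def Y by (intro mult_left_mono weighted_Cauchy_Schwarz) (auto simp: w_def)
    also have "\<dots> \<le> 4 * ((n * (1 + b0) * \<phi>s) * (b0 * \<phi>s))"
      using V_le[OF s] small Y_nonneg n b0_pos cost_pos
      by (intro mult_left_mono mult_mono) (auto simp: Y_def)
    finally show ?thesis by (simp add: power2_eq_square algebra_simps)
  qed
  define q where "q r = 1 - (1 - real (card (A (\<pi> r))) / n) ^ m" for r
  define e where "e r = mean (A (\<pi> r)) - cs r" for r
  define q0 where "q0 = 1 - (1 - 4/5 * p_min X ks As) ^ m"
  have cl: "A \<in> clusterings X k C" using a A by (auto simp: clusterings_def)
  have size: "4/5 * p_min X ks As \<le> real (card (A (\<pi> r))) / n" "real (card (A (\<pi> r))) / n \<le> 1" if r: "r < ks" for r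
  proof -
    have finA: "finite (A (\<pi> r))" using finite_X by (simp add: A clustering_of_def)
    have "5 * card ((A (\<pi> r) - As r) \<union> (As r - A (\<pi> r))) < card (As r)"
      using symdiff_fifth[OF cl comp _ opt r] small opt by (simp add: optimal_def)
    moreover have "card (As r) \<le> card (A (\<pi> r)) + card (As r - A (\<pi> r))"
      using card_mono[of "A (\<pi> r) \<union> (As r - A (\<pi> r))" "As r"] card_Un_le[of "A (\<pi> r)" "As r - A (\<pi> r)"]
        finA finite_As by fastforce
    moreover have "card (As r - A (\<pi> r)) \<le> card ((A (\<pi> r) - As r) \<union> (As r - A (\<pi> r)))"
      using finA finite_As by (intro card_mono) auto
    ultimately have "4/5 * real (card (As r)) \<le> real (card (A (\<pi> r)))" by linarith
    then have "4/5 * (real (card (As r)) / n) \<le> real (card (A (\<pi> r))) / n"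
      using n by (simp add: field_simps)
    then show "4/5 * p_min X ks As \<le> real (card (A (\<pi> r))) / n"
      using p_min_le[OF r] unfolding n_def[symmetric] by linarith
    have "card (A (\<pi> r)) \<le> card X" using finite_X by (intro card_mono) (auto simp: A clustering_of_def)
    then show "real (card (A (\<pi> r))) / n \<le> 1" using n by (simp add: n_def)
  qed
  have q: "q0 \<le> q r" "0 \<le> q r" "q r \<le> 1" if r: "r < ks" for r
  proof -
    have "(1 - real (card (A (\<pi> r))) / n) ^ m \<le> (1 - 4/5 * p_min X ks As) ^ m"
      using size[OF r] by (intro power_mono) auto
    then show "q0 \<le> q r" by (simp add: q_def q0_def)
    have "0 \<le> (1 - real (card (A (\<pi> r))) / n) ^ m" "(1 - real (card (A (\<pi> r))) / n) ^ m \<le> 1"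
      using size[OF r] n by (auto intro!: power_le_one)
    then show "0 \<le> q r" "q r \<le> 1" by (auto simp: q_def)
  qed
  have mean_shift: "(\<Sum>s\<in>{..<m} \<rightarrow>\<^sub>E X. u s r) /\<^sub>R n ^ m = q r *\<^sub>R (e r - d r)" if r: "r < ks" for r
  proof -
    have "\<pi> r \<in> nondegenerate A" using opt r by (auto simp: optimal_def PiE_def Pi_def)
    then have "clustering_of X a (\<pi> r) \<noteq> {}" by (simp add: A nondegenerate_def)
    from average_sample_shift[OF finite_X X_nonempty this] show ?thesis
      by (simp add: u_def n_def q_def A e_def d_def)
  qed
  have "(\<Sum>s\<in>{..<m} \<rightarrow>\<^sub>E X. P s) / n ^ m
      = 2 * (\<Sum>r<ks. w r * (((\<Sum>s\<in>{..<m} \<rightarrow>\<^sub>E X. u s r) /\<^sub>R n ^ m) \<bullet> d r))"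
  proof -
    have "(\<Sum>s\<in>{..<m} \<rightarrow>\<^sub>E X. P s) = 2 * (\<Sum>s\<in>{..<m} \<rightarrow>\<^sub>E X. \<Sum>r<ks. w r * (u s r \<bullet> d r))"
      by (simp add: P_def sum_distrib_left)
    also have "\<dots> = 2 * (\<Sum>r<ks. \<Sum>s\<in>{..<m} \<rightarrow>\<^sub>E X. w r * (u s r \<bullet> d r))"
      by (subst sum.swap) (rule refl)
    also have "\<dots> = 2 * (\<Sum>r<ks. w r * ((\<Sum>s\<in>{..<m} \<rightarrow>\<^sub>E X. u s r) \<bullet> d r))"
      by (simp add: sum_distrib_left inner_sum_left)
    finally show ?thesis by (simp add: sum_divide_distrib divide_inverse sum_distrib_left mult_ac)
  qed
  also have "\<dots> = 2 * (\<Sum>r<ks. w r * ((q r *\<^sub>R (e r - d r)) \<bullet> d r))"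
    by (simp add: mean_shift)
  also have "\<dots> = 2 * (\<Sum>r<ks. w r * ((q r *\<^sub>R e r) \<bullet> d r)) - 2 * (\<Sum>r<ks. w r * (q r * (norm (d r))\<^sup>2))"
    by (simp add: inner_diff_left power2_norm_eq_inner algebra_simps sum_subtractf)
  \<comment> \<open>The hit probabilities \<open>q r\<close> differ between clusters. In the term
    with \<open>e r\<close> they are bounded above by 1, so that Cauchy-Schwarz and
    \<open>batch_contraction\<close> give \<open>sqrt \<alpha> * Y\<close>; in the quadratic term
    they are bounded below by \<open>q0\<close>.\<close>
  also have "\<dots> \<le> 2 * (sqrt \<alpha> * Y) - 2 * (q0 * Y)"
  proof -
    have "(\<Sum>r<ks. w r * ((q r *\<^sub>R e r) \<bullet> d r))\<^sup>2 \<le> (\<Sum>r<ks. w r * (norm (q r *\<^sub>R e r))\<^sup>2) * Y"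
      unfolding Y by (rule weighted_Cauchy_Schwarz) (simp add: w_def)
    also have "\<dots> \<le> (\<Sum>r<ks. w r * (norm (e r))\<^sup>2) * Y"
    proof (intro mult_right_mono sum_mono mult_left_mono power_mono)
      fix r assume "r \<in> {..<ks}"
      then show "norm (q r *\<^sub>R e r) \<le> norm (e r)" using q[of r] by (simp add: mult_left_le_one_le)
    qed (auto simp: w_def Y_nonneg)
    also have "\<dots> \<le> (\<alpha> * Y) * Y"
      using batch_contraction[OF a A comp opt small] Y_nonneg
      by (intro mult_right_mono) (simp_all add: w_def e_def Y_def)
    also have "\<dots> = (sqrt \<alpha> * Y)\<^sup>2"
      unfolding power_mult_distrib real_sqrt_pow2[OF \<alpha>(1)] by (simp add: power2_eq_square)
    finally have "(\<Sum>r<ks. w r * ((q r *\<^sub>R e r) \<bullet> d r)) \<le> sqrt \<alpha> * Y"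
      by (rule power2_le_imp_le) (simp add: \<alpha>(1) Y_nonneg)
    moreover have "q0 * Y \<le> (\<Sum>r<ks. w r * (q r * (norm (d r))\<^sup>2))"
      unfolding Y sum_distrib_left
    proof (intro sum_mono)
      fix r assume "r \<in> {..<ks}"
      then have "q0 * (w r * (norm (d r))\<^sup>2) \<le> q r * (w r * (norm (d r))\<^sup>2)"
        using q by (intro mult_right_mono) (auto simp: w_def)
      then show "q0 * (w r * (norm (d r))\<^sup>2) \<le> w r * (q r * (norm (d r))\<^sup>2)" by (simp add: mult_ac)
    qed
    ultimately show ?thesis by linarith
  qed
  also have "\<dots> = - 2 * drift_rate m * Y" by (simp add: drift_rate_def q0_def algebra_simps)
  finally have "(\<Sum>s\<in>{..<m} \<rightarrow>\<^sub>E X. P s) / n ^ m \<le> - 2 * drift_rate m * Y" .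
  then show thesis
    using that[of P V] expansion V_le P_le unfolding n_def Y_def by blast
qed

end

section \<open>Expectations over finite histories\<close>

text \<open>Wanted for both signs, as the fluctuation of a step has either. For
  \<open>x = - y\<close> the claim is \<open>1 \<le> (1 - y + y\<^sup>2) * exp y\<close>, and the
  quadratic Taylor polynomial in place of \<open>exp y\<close> already suffices.\<close>

lemma exp_le_quadratic:
  fixes x :: real
  assumes "\<bar>x\<bar> \<le> 1"
  shows "exp x \<le> 1 + x + x\<^sup>2"
proof (cases "x \<ge> 0")
  case True
  then show ?thesis using assms by (intro exp_bound) auto
next
  case False
  define y where "y = - x"
  have y: "0 \<le> y" "y \<le> 1" using False assms by (auto simp: y_def)
  have "1 \<le> (1 - y + y\<^sup>2) * (1 + y + y\<^sup>2 / 2)"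
  proof -
    have "(1 - y + y\<^sup>2) * (1 + y + y\<^sup>2 / 2) = 1 + (y ^ 2 + y ^ 3 + y ^ 4) / 2"
      by (simp add: field_simps power2_eq_square power3_eq_cube power4_eq_xxxx)
    then show ?thesis using y by simp
  qed
  also have "\<dots> \<le> (1 - y + y\<^sup>2) * exp y"
    using y exp_lower_Taylor_quadratic[OF y(1)] by (intro mult_left_mono) auto
  finally have "1 / exp y \<le> 1 - y + y\<^sup>2" by (simp add: divide_le_eq)
  then show ?thesis by (simp add: y_def exp_minus inverse_eq_divide)
qed

text \<open>Stands in for measurability with respect to the draws of iterations \<open>i + 1\<close>
  to \<open>t\<close>: with \<open>X\<close> finite, functional dependence is enough, and it makes
  sense for values of any type, such as centroids and predicates.\<close>

definition determined :: "nat \<Rightarrow> nat \<Rightarrow> nat \<Rightarrow> ((nat \<Rightarrow> nat \<Rightarrow> 'v) \<Rightarrow> 'b) \<Rightarrow> bool" where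
  "determined i m t f \<longleftrightarrow>
     (\<forall>s s'. (\<forall>j l. i < j \<longrightarrow> j \<le> t \<longrightarrow> l < m \<longrightarrow> s j l = s' j l) \<longrightarrow> f s = f s')"

lemma determinedI:
  "(\<And>s s'. (\<And>j l. i < j \<Longrightarrow> j \<le> t \<Longrightarrow> l < m \<Longrightarrow> s j l = s' j l) \<Longrightarrow> f s = f s') \<Longrightarrow> determined i m t f"
  unfolding determined_def by blast

lemma determinedD:
  "determined i m t f \<Longrightarrow> (\<And>j l. i < j \<Longrightarrow> j \<le> t \<Longrightarrow> l < m \<Longrightarrow> s j l = s' j l) \<Longrightarrow> f s = f s'"
  unfolding determined_def by blast

lemma determined_mono: "determined i m t f \<Longrightarrow> t \<le> t' \<Longrightarrow> determined i m t' f"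
  unfolding determined_def by (meson order_trans)

lemma determined_const: "determined i m t (\<lambda>_. c)"
  by (simp add: determined_def)

lemma determined_apply: "determined i m t f \<Longrightarrow> determined i m t (\<lambda>s. g (f s))"
  unfolding determined_def by metis

lemma determined_apply2: "determined i m t f \<Longrightarrow> determined i m t g \<Longrightarrow> determined i m t (\<lambda>s. h (f s) (g s))"
  unfolding determined_def by metis

lemma skm_step_cong: "(\<And>l. l < m \<Longrightarrow> s l = s' l) \<Longrightarrow> skm_step m \<eta> a s C = skm_step m \<eta> a s' C"
  by (rule ext) (auto simp: skm_step_def subsample_def cong: conj_cong)

lemma determined_skm:
  fixes pick :: "nat \<Rightarrow> (nat \<Rightarrow> real^'d) \<Rightarrow> real^'d \<Rightarrow> nat"
  shows "determined i m t (\<lambda>s. skm m \<eta> pick i C s t)"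
proof (induction t)
  case (Suc t)
  show ?case
  proof (rule determinedI)
    fix s s' :: "nat \<Rightarrow> nat \<Rightarrow> real^'d"
    assume eq: "\<And>j l. i < j \<Longrightarrow> j \<le> Suc t \<Longrightarrow> l < m \<Longrightarrow> s j l = s' j l"
    have "skm m \<eta> pick i C s t = skm m \<eta> pick i C s' t"
      by (rule determinedD[OF Suc.IH]) (use eq in simp)
    moreover have "skm_step m (\<eta> (Suc t)) a (s (Suc t)) c = skm_step m (\<eta> (Suc t)) a (s' (Suc t)) c"
      if "\<not> Suc t \<le> i" for a c
      using that eq by (intro skm_step_cong) auto
    ultimately show "skm m \<eta> pick i C s (Suc t) = skm m \<eta> pick i C s' (Suc t)" by simp
  qed
qed (simp add: determined_const)

locale uniform_sampling = prob_space M for M :: "'w measure" +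
  fixes X :: "(real^'d) set" and m i :: nat and S :: "nat \<Rightarrow> nat \<Rightarrow> 'w \<Rightarrow> real^'d"
  assumes finX: "finite X" and neX: "X \<noteq> {}" and samples: "uniform_samples M X m i S"
begin

definition sampled :: "'w \<Rightarrow> nat \<Rightarrow> nat \<Rightarrow> real^'d" where
  "sampled \<omega> = (\<lambda>j l. S j l \<omega>)"

definition draws :: "nat \<Rightarrow> (nat \<times> nat) set" where
  "draws t = {i<..t} \<times> {..<m}"

lemma finite_draws: "finite (draws t)" by (simp add: draws_def)

lemma card_X_pos: "real (card X) > 0"
  using finX neX by (simp add: card_gt_0_iff)

lemma S_measurable:
  assumes "(j, l) \<in> draws t"
  shows "S j l \<in> M \<rightarrow>\<^sub>M uniform_count_measure X"
  using samples assms unfolding uniform_samples_def indep_vars_def draws_def by fastforce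

lemma S_in_X: "(j, l) \<in> draws t \<Longrightarrow> \<omega> \<in> space M \<Longrightarrow> S j l \<omega> \<in> X"
  using measurable_space[OF S_measurable] by (auto simp: space_uniform_count_measure)

definition history_event :: "nat \<Rightarrow> (nat \<times> nat \<Rightarrow> real^'d) \<Rightarrow> 'w set" where
  "history_event t h = {\<omega> \<in> space M. \<forall>(j, l)\<in>draws t. S j l \<omega> = h (j, l)}"

lemma prob_history_event:
  assumes h: "h \<in> draws t \<rightarrow>\<^sub>E X"
  shows "history_event t h \<in> events" "prob (history_event t h) = 1 / real (card X) ^ card (draws t)"
proof -
  let ?S = "\<lambda>(j, l). S j l"
  have ev: "?S k -` {h k} \<inter> space M \<in> events" if "k \<in> draws t" for k
    using that h by (cases k) (auto intro!: measurable_sets[OF S_measurable] simp: sets_uniform_count_measure)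
  have pr: "prob (?S k -` {h k} \<inter> space M) = 1 / real (card X)" if k: "k \<in> draws t" for k
  proof -
    obtain j l where jl: "k = (j, l)" by (cases k)
    have hk: "h k \<in> X" using h k by auto
    have "distr M (uniform_count_measure X) (S j l) = uniform_count_measure X"
      using samples k by (auto simp: uniform_samples_def draws_def jl)
    then have "measure (uniform_count_measure X) {h k} = measure (distr M (uniform_count_measure X) (S j l)) {h k}"
      by simp
    also have "\<dots> = prob (S j l -` {h k} \<inter> space M)"
      using hk k unfolding jl by (intro measure_distr S_measurable) (auto simp: sets_uniform_count_measure)
    finally show ?thesis using hk finX by (simp add: jl measure_uniform_count_measure)
  qed
  \<comment> \<open>The case of no draws is separate because an intersection over the empty index
    set would be \<open>UNIV\<close> instead of \<open>space M\<close>.\<close>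
  have eq: "history_event t h = (if draws t = {} then space M else (\<Inter>k\<in>draws t. ?S k -` {h k} \<inter> space M))"
    by (auto simp: history_event_def)
  show "history_event t h \<in> events"
  proof (cases "draws t = {}")
    case False
    then show ?thesis unfolding eq using ev finite_draws by (simp only: if_False) (rule sets.finite_INT)
  qed (simp add: eq)
  show "prob (history_event t h) = 1 / real (card X) ^ card (draws t)"
  proof (cases "draws t = {}")
    case True
    then show ?thesis by (simp add: eq prob_space)
  next
    case False
    have indep: "indep_vars (\<lambda>_. uniform_count_measure X) ?S ({i<..} \<times> {..<m})"
      using samples by (simp add: uniform_samples_def)
    have "prob (\<Inter>k\<in>draws t. ?S k -` {h k} \<inter> space M) = (\<Prod>k\<in>draws t. prob (?S k -` {h k} \<inter> space M))"
      using h by (intro indep_varsD[OF indep False finite_draws])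
        (auto simp: draws_def sets_uniform_count_measure)
    also have "\<dots> = (1 / real (card X)) ^ card (draws t)"
      using pr by simp
    finally show ?thesis by (simp add: eq False power_one_over)
  qed
qed

text \<open>Exactly one of the finitely many histories occurs, so the random variable is a finite
  combination of indicators of history events; all of these are equally likely.\<close>

lemma history_integral:
  fixes f :: "(nat \<Rightarrow> nat \<Rightarrow> real^'d) \<Rightarrow> real"
  assumes f: "determined i m t f"
  shows "integrable M (\<lambda>\<omega>. f (sampled \<omega>))"
    and "expectation (\<lambda>\<omega>. f (sampled \<omega>))
      = (\<Sum>h\<in>draws t \<rightarrow>\<^sub>E X. f (\<lambda>j l. h (j, l))) / real (card X) ^ card (draws t)"
proof -
  let ?H = "draws t \<rightarrow>\<^sub>E X"
  let ?g = "\<lambda>\<omega>. \<Sum>h\<in>?H. f (\<lambda>j l. h (j, l)) * indicator (history_event t h) \<omega>"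
  have finH: "finite ?H" using finX finite_draws by (intro finite_PiE) auto
  have fg: "f (sampled \<omega>) = ?g \<omega>" if \<omega>: "\<omega> \<in> space M" for \<omega>
  proof -
    define h0 where "h0 = restrict (\<lambda>(j, l). S j l \<omega>) (draws t)"
    have h0: "h0 \<in> ?H" using S_in_X \<omega> by (auto simp: h0_def)
    have unique: "h = h0" if h: "h \<in> ?H" "\<omega> \<in> history_event t h" for h
    proof (rule PiE_ext[OF h(1) h0])
      fix k assume "k \<in> draws t"
      then show "h k = h0 k" using h(2) by (cases k) (auto simp: history_event_def h0_def)
    qed
    have mem: "\<omega> \<in> history_event t h0" using \<omega> by (auto simp: history_event_def h0_def)
    have "?g \<omega> = (\<Sum>h\<in>?H. if h = h0 then f (\<lambda>j l. h0 (j, l)) else 0)"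
    proof (intro sum.cong refl)
      fix h assume h: "h \<in> ?H"
      show "f (\<lambda>j l. h (j, l)) * indicator (history_event t h) \<omega> = (if h = h0 then f (\<lambda>j l. h0 (j, l)) else 0)"
      proof (cases "h = h0")
        case True
        then show ?thesis using mem by simp
      next
        case False
        then have "\<omega> \<notin> history_event t h" using unique[OF h] by blast
        then show ?thesis using False by simp
      qed
    qed
    also have "\<dots> = f (\<lambda>j l. h0 (j, l))" using finH h0 by (simp only: sum.delta if_True)
    also have "\<dots> = f (sampled \<omega>)"
      by (rule determinedD[OF f]) (auto simp: h0_def draws_def sampled_def)
    finally show ?thesis by simp
  qed
  have int: "integrable M (\<lambda>\<omega>. f (\<lambda>j l. h (j, l)) * indicator (history_event t h) \<omega>)" if "h \<in> ?H" for h
    using prob_history_event(1)[OF that]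
    by (intro integrable_mult_right integrable_real_indicator) (simp_all add: emeasure_eq_measure)
  then have "integrable M ?g" by (rule Bochner_Integration.integrable_sum)
  then show "integrable M (\<lambda>\<omega>. f (sampled \<omega>))"
    by (rule Bochner_Integration.integrable_cong[THEN iffD1, rotated 2]) (simp_all add: fg)
  have "expectation (\<lambda>\<omega>. f (sampled \<omega>)) = expectation ?g"
    by (rule Bochner_Integration.integral_cong) (simp_all add: fg)
  also have "\<dots> = (\<Sum>h\<in>?H. expectation (\<lambda>\<omega>. f (\<lambda>j l. h (j, l)) * indicator (history_event t h) \<omega>))"
    by (rule Bochner_Integration.integral_sum) (rule int)
  also have "\<dots> = (\<Sum>h\<in>?H. f (\<lambda>j l. h (j, l)) * (1 / real (card X) ^ card (draws t)))"
  proof (intro sum.cong refl)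
    fix h assume h: "h \<in> ?H"
    have "history_event t h \<subseteq> space M" by (auto simp: history_event_def)
    then show "expectation (\<lambda>\<omega>. f (\<lambda>j l. h (j, l)) * indicator (history_event t h) \<omega>)
        = f (\<lambda>j l. h (j, l)) * (1 / real (card X) ^ card (draws t))"
      using prob_history_event[OF h] by (simp add: Int_absorb2)
  qed
  finally show "expectation (\<lambda>\<omega>. f (sampled \<omega>))
      = (\<Sum>h\<in>?H. f (\<lambda>j l. h (j, l))) / real (card X) ^ card (draws t)"
    by (simp add: sum_divide_distrib)
qed

text \<open>The tower property in finite form: a history up to \<open>Suc t\<close> is a history up
  to \<open>t\<close> together with a fresh \<open>m\<close>-tuple, so the average over it can be
  taken in two stages.\<close>

lemma one_step_expectation:
  fixes f g :: "(nat \<Rightarrow> nat \<Rightarrow> real^'d) \<Rightarrow> real"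
  assumes t: "i \<le> t" and f: "determined i m (Suc t) f" and g: "determined i m t g"
    and le: "\<And>h. (\<Sum>s\<in>{..<m} \<rightarrow>\<^sub>E X. f (h(Suc t := s))) / real (card X) ^ m \<le> g h"
  shows "expectation (\<lambda>\<omega>. f (sampled \<omega>)) \<le> expectation (\<lambda>\<omega>. g (sampled \<omega>))"
proof -
  let ?H = "draws t \<rightarrow>\<^sub>E X" and ?W = "{..<m} \<rightarrow>\<^sub>E X" and ?H' = "draws (Suc t) \<rightarrow>\<^sub>E X"
  let ?c = "\<lambda>h j l. h (j, l) :: real^'d"
  have draws_Suc: "draws (Suc t) = draws t \<union> {Suc t} \<times> {..<m}" "draws t \<inter> {Suc t} \<times> {..<m} = {}"
    using t by (auto simp: draws_def)
  then have card: "card (draws (Suc t)) = card (draws t) + m"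
    by (simp add: card_Un_disjoint finite_draws card_cartesian_product)
  have "(\<Sum>h\<in>?H. \<Sum>s\<in>?W. f ((?c h)(Suc t := s))) = (\<Sum>(h, s)\<in>?H \<times> ?W. f ((?c h)(Suc t := s)))"
    by (rule sum.cartesian_product)
  also have "\<dots> = (\<Sum>k\<in>?H'. f (?c k))"
  \<comment> \<open>The restrictions keep both directions extensional, without which the two maps
    would not be inverse to each other.\<close>
  proof (rule sum.reindex_bij_witness[of _
      "\<lambda>k. (restrict k (draws t), \<lambda>l\<in>{..<m}. k (Suc t, l))"
      "\<lambda>(h, s). restrict (\<lambda>(j, l). if j = Suc t then s l else h (j, l)) (draws (Suc t))"])
    fix p assume "p \<in> ?H \<times> ?W"
    then obtain h s where p: "p = (h, s)" "h \<in> ?H" "s \<in> ?W" by auto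
    let ?k = "restrict (\<lambda>(j, l). if j = Suc t then s l else h (j, l)) (draws (Suc t))"
    have h: "h k \<in> X" if "k \<in> draws t" for k using p(2) that by (rule PiE_mem)
    have h_undef: "h k = undefined" if "k \<notin> draws t" for k using p(2) that by (rule PiE_arb)
    have s: "s l \<in> X" if "l < m" for l using PiE_mem[OF p(3)] that by simp
    have s_undef: "s l = undefined" if "\<not> l < m" for l using PiE_arb[OF p(3)] that by simp
    have "restrict ?k (draws t) k = h k" for k
      using h_undef[of k] by (cases k) (auto simp: restrict_def draws_def)
    moreover have "restrict (\<lambda>l. ?k (Suc t, l)) {..<m} l = s l" for l
      using s_undef[of l] t by (simp add: restrict_def draws_def)
    ultimately show "(\<lambda>k. (restrict k (draws t), \<lambda>l\<in>{..<m}. k (Suc t, l)))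
        ((\<lambda>(h, s). restrict (\<lambda>(j, l). if j = Suc t then s l else h (j, l)) (draws (Suc t))) p) = p"
      unfolding p(1) prod.case by (simp only: fun_eq_iff prod.inject simp_thms)
    have "(case k of (j, l) \<Rightarrow> if j = Suc t then s l else h (j, l)) \<in> X" if k: "k \<in> draws (Suc t)" for k
    proof -
      obtain j l where jl: "k = (j, l)" by (cases k)
      show ?thesis
      proof (cases "j = Suc t")
        case True
        then show ?thesis using k s[of l] by (simp add: jl draws_def)
      next
        case False
        then show ?thesis using k h[of k] by (simp add: jl draws_def)
      qed
    qed
    then show "(\<lambda>(h, s). restrict (\<lambda>(j, l). if j = Suc t then s l else h (j, l)) (draws (Suc t))) p \<in> ?H'"
      unfolding p(1) prod.case by (rule restrict_PiE_iff[THEN iffD2, OF ballI])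
    show "f (?c ((\<lambda>(h, s). restrict (\<lambda>(j, l). if j = Suc t then s l else h (j, l)) (draws (Suc t))) p))
        = (case p of (h, s) \<Rightarrow> f ((?c h)(Suc t := s)))"
      unfolding p(1) prod.case by (rule determinedD[OF f]) (simp add: draws_def)
  next
    fix k assume k: "k \<in> ?H'"
    have k_mem: "k p \<in> X" if "p \<in> draws (Suc t)" for p using k that by (rule PiE_mem)
    have k_undef: "k p = undefined" if "p \<notin> draws (Suc t)" for p using k that by (rule PiE_arb)
    show "(\<lambda>(h, s). restrict (\<lambda>(j, l). if j = Suc t then s l else h (j, l)) (draws (Suc t)))
        (restrict k (draws t), \<lambda>l\<in>{..<m}. k (Suc t, l)) = k"
    proof
      fix p
      show "(\<lambda>(h, s). restrict (\<lambda>(j, l). if j = Suc t then s l else h (j, l)) (draws (Suc t)))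
        (restrict k (draws t), \<lambda>l\<in>{..<m}. k (Suc t, l)) p = k p"
        using k_undef[of p] by (cases p) (auto simp: restrict_def draws_def)
    qed
    have "restrict k (draws t) \<in> ?H"
      using k_mem draws_Suc(1) by (intro restrict_PiE_iff[THEN iffD2] ballI) blast
    moreover have "(\<lambda>l\<in>{..<m}. k (Suc t, l)) \<in> ?W"
      using k_mem t by (intro restrict_PiE_iff[THEN iffD2] ballI) (simp add: draws_def)
    ultimately show "(restrict k (draws t), \<lambda>l\<in>{..<m}. k (Suc t, l)) \<in> ?H \<times> ?W"
      by (rule SigmaI)
  qed
  finally have sum_eq: "(\<Sum>h\<in>?H. \<Sum>s\<in>?W. f ((?c h)(Suc t := s))) = (\<Sum>k\<in>?H'. f (?c k))" .
  have "(\<Sum>k\<in>?H'. f (?c k)) / real (card X) ^ card (draws (Suc t))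
      = (\<Sum>h\<in>?H. (\<Sum>s\<in>?W. f ((?c h)(Suc t := s))) / real (card X) ^ m) / real (card X) ^ card (draws t)"
    unfolding sum_eq[symmetric] card power_add
    by (simp only: sum_divide_distrib[symmetric] divide_divide_eq_left mult.commute)
  also have "\<dots> \<le> (\<Sum>h\<in>?H. g (?c h)) / real (card X) ^ card (draws t)"
    using le by (intro divide_right_mono sum_mono) auto
  finally show ?thesis
    by (simp add: history_integral(2)[OF f] history_integral(2)[OF g])
qed

end

section \<open>The run inside the basin of attraction\<close>

locale skm_run = stable_clustering X ks cs As b0 \<alpha> + uniform_sampling M X m i S
  for X :: "(real^'d) set" and ks :: nat and cs :: "nat \<Rightarrow> real^'d" and As :: "nat \<Rightarrow> (real^'d) set"
    and b0 \<alpha> :: real and M :: "'w measure" and m i :: nat and S :: "nat \<Rightarrow> nat \<Rightarrow> 'w \<Rightarrow> real^'d" +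
  fixes k :: nat and pick :: "nat \<Rightarrow> (nat \<Rightarrow> real^'d) \<Rightarrow> real^'d \<Rightarrow> nat" and Ci :: "nat \<Rightarrow> real^'d"
    and c' t0 :: real
  assumes ties: "\<And>t c x. x \<in> X \<Longrightarrow> closest k c x (pick t c x)"
    and start_comparable: "card (pick i Ci ` X) = ks"
    and c'_nonneg: "c' \<ge> 0" and t0_pos: "t0 > 0"
begin

text \<open>
  The run is compared with \<open>C\<^sup>*\<close> through the centroids that are non-degenerate at iteration \<open>i\<close>.
  The event \<open>alive t\<close> then agrees with \<open>\<Omega> t\<close> almost surely, by the assumption that centroids degenerate
  at iteration \<open>i\<close> are ignored.
\<close>

definition targets :: "nat set" where
  "targets = pick i Ci ` X"

definition centroids :: "nat \<Rightarrow> (nat \<Rightarrow> nat \<Rightarrow> real^'d) \<Rightarrow> nat \<Rightarrow> real^'d" where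
  "centroids t s = skm m (\<lambda>t r. c' / (t0 + real t)) pick i Ci s t"

definition clusters :: "nat \<Rightarrow> (nat \<Rightarrow> nat \<Rightarrow> real^'d) \<Rightarrow> nat \<Rightarrow> (real^'d) set" where
  "clusters t s = clustering_of X (pick t (centroids t s))"

definition cost :: "nat \<Rightarrow> (nat \<Rightarrow> nat \<Rightarrow> real^'d) \<Rightarrow> real" where
  "cost t s = Delta_on targets (centroids t s)"

definition alive :: "nat \<Rightarrow> (nat \<Rightarrow> nat \<Rightarrow> real^'d) \<Rightarrow> bool" where
  "alive t s \<longleftrightarrow> (\<forall>j. i \<le> j \<and> j < t \<longrightarrow> nondegenerate (clusters j s) = targets \<and> cost j s \<le> b0 * \<phi>s)"

definition lrate :: "nat \<Rightarrow> real" where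
  "lrate t = c' / (t0 + real t)"

abbreviation "noise_bound \<equiv> real (card X) * (1 + b0) * \<phi>s"
abbreviation "variance_bound \<equiv> 4 * real (card X) * b0 * (1 + b0) * \<phi>s\<^sup>2"
abbreviation "EE f \<equiv> expectation (\<lambda>\<omega>. f (sampled \<omega>))"

lemma lrate_nonneg: "lrate t \<ge> 0"
  using c'_nonneg t0_pos by (simp add: lrate_def)

lemma targets_subset: "targets \<subseteq> {..<k}"
  using ties by (auto simp: targets_def closest_def)

lemma finite_targets: "finite targets"
  using targets_subset finite_subset by blast

lemma card_targets: "card targets = ks"
  using start_comparable by (simp add: targets_def)

lemma cost_nonneg: "cost t s \<ge> 0"
  unfolding cost_def by (rule Delta_on_nonneg[OF finite_targets]) (simp add: card_targets)

lemma centroids_init: "centroids i s = Ci"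
  unfolding centroids_def by (cases i) simp_all

definition Di :: real where
  "Di = Delta_on targets Ci"

lemma cost_init: "cost i s = Di"
  by (simp add: cost_def centroids_init Di_def)

lemma determined_centroids: "determined i m t (centroids t)"
  unfolding centroids_def by (rule determined_skm)

lemma determined_cost: "determined i m t (cost t)"
  unfolding cost_def by (rule determined_apply[OF determined_centroids])

text \<open>The off-by-one that carries the argument: survival up to \<open>Suc t\<close> tests
  iterations up to \<open>t\<close> only, so it is settled before the sample of iteration
  \<open>Suc t\<close> is drawn.\<close>

lemma determined_alive: "determined i m t (alive (Suc t))"
proof (rule determinedI)
  fix s s' :: "nat \<Rightarrow> nat \<Rightarrow> real^'d"
  assume eq: "\<And>j l. i < j \<Longrightarrow> j \<le> t \<Longrightarrow> l < m \<Longrightarrow> s j l = s' j l"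
  have "centroids j s = centroids j s'" if "j < Suc t" for j
    by (rule determinedD[OF determined_centroids]) (use eq that in simp)
  then have "clusters j s = clusters j s'" "cost j s = cost j s'" if "j < Suc t" for j
    using that by (simp_all add: clusters_def cost_def)
  then show "alive (Suc t) s = alive (Suc t) s'" by (simp add: alive_def)
qed

lemma alive_init: "alive i s"
  unfolding alive_def by auto

lemma alive_Suc:
  "i \<le> t \<Longrightarrow> alive (Suc t) s \<longleftrightarrow> alive t s \<and> nondegenerate (clusters t s) = targets \<and> cost t s \<le> b0 * \<phi>s"
  by (auto simp: alive_def less_Suc_eq)

lemma determined_alive': "determined i m t (alive t)"
proof (cases t)
  case 0
  then have "alive t = (\<lambda>_. True)" by (simp add: alive_def fun_eq_iff)
  then show ?thesis by (simp only: determined_const)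
next
  case (Suc u)
  then show ?thesis using determined_mono[OF determined_alive[of u], of t] by simp
qed

lemma centroids_Suc:
  assumes "i \<le> t"
  shows "centroids (Suc t) (h(Suc t := s)) = skm_step m (\<lambda>_. lrate (Suc t)) (pick t (centroids t h)) s (centroids t h)"
proof -
  have "centroids t (h(Suc t := s)) = centroids t h"
    by (rule determinedD[OF determined_centroids]) simp
  then show ?thesis using assms by (simp add: centroids_def lrate_def)
qed

text \<open>The matching that is optimal before the step is still admissible after it, so its new
  cost bounds the new minimum from above.\<close>

lemma step_bounds:
  assumes t: "i \<le> t" and alive: "alive (Suc t) h"
  obtains P V where
    "\<And>s. cost (Suc t) (h(Suc t := s)) \<le> cost t h + lrate (Suc t) * P s + (lrate (Suc t))\<^sup>2 * V s"
    "\<And>s. s \<in> {..<m} \<rightarrow>\<^sub>E X \<Longrightarrow> V s \<le> noise_bound"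
    "\<And>s. s \<in> {..<m} \<rightarrow>\<^sub>E X \<Longrightarrow> (P s)\<^sup>2 \<le> variance_bound"
    "(\<Sum>s\<in>{..<m} \<rightarrow>\<^sub>E X. P s) / real (card X) ^ m \<le> - 2 * drift_rate m * cost t h"
proof -
  let ?a = "pick t (centroids t h)"
  have nd: "nondegenerate (clusters t h) = targets" "cost t h \<le> b0 * \<phi>s" using alive t by (simp_all add: alive_Suc)
  have comp: "comparable ks (clusters t h)" by (simp add: comparable_def nd card_targets)
  obtain \<pi> where \<pi>: "optimal (clusters t h) (centroids t h) \<pi>" by (rule optimal_exists[OF comp])
  then have cost: "mcost (centroids t h) \<pi> = cost t h" and \<pi>targets: "\<pi> \<in> {..<ks} \<rightarrow>\<^sub>E targets" "inj_on \<pi> {..<ks}"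
    by (simp_all add: optimal_def nd cost_def)
  have closest: "\<forall>x\<in>X. closest k (centroids t h) x (?a x)" using ties by blast
  obtain P V where PV:
    "\<And>\<eta> s. mcost (skm_step m (\<lambda>_. \<eta>) ?a s (centroids t h)) \<pi> = mcost (centroids t h) \<pi> + \<eta> * P s + \<eta>\<^sup>2 * V s"
    "\<And>s. s \<in> {..<m} \<rightarrow>\<^sub>E X \<Longrightarrow> V s \<le> noise_bound"
    "\<And>s. s \<in> {..<m} \<rightarrow>\<^sub>E X \<Longrightarrow> (P s)\<^sup>2 \<le> variance_bound"
    "(\<Sum>s\<in>{..<m} \<rightarrow>\<^sub>E X. P s) / real (card X) ^ m \<le> - 2 * drift_rate m * mcost (centroids t h) \<pi>"
    using step_expansion[OF closest clusters_def comp \<pi>, of m] nd(2) unfolding cost by blast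
  show thesis
  proof (rule that[of P V])
    fix s
    have "cost (Suc t) (h(Suc t := s)) \<le> mcost (centroids (Suc t) (h(Suc t := s))) \<pi>"
      unfolding cost_def by (rule Delta_on_le[OF finite_targets \<pi>targets])
    then show "cost (Suc t) (h(Suc t := s)) \<le> cost t h + lrate (Suc t) * P s + (lrate (Suc t))\<^sup>2 * V s"
      by (simp only: centroids_Suc[OF t] PV(1) cost)
  qed (use PV cost in auto)
qed

lemma average_step:
  assumes t: "i \<le> t" and alive: "alive (Suc t) h"
  shows "(\<Sum>s\<in>{..<m} \<rightarrow>\<^sub>E X. cost (Suc t) (h(Suc t := s))) / real (card X) ^ m
    \<le> (1 - 2 * lrate (Suc t) * drift_rate m) * cost t h + (lrate (Suc t))\<^sup>2 * noise_bound"
proof -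
  let ?W = "{..<m} \<rightarrow>\<^sub>E X" and ?\<eta> = "lrate (Suc t)"
  define n where "n = real (card X) ^ m"
  obtain P V where PV:
    "\<And>s. cost (Suc t) (h(Suc t := s)) \<le> cost t h + ?\<eta> * P s + ?\<eta>\<^sup>2 * V s"
    "\<And>s. s \<in> ?W \<Longrightarrow> V s \<le> noise_bound"
    "(\<Sum>s\<in>?W. P s) / n \<le> - 2 * drift_rate m * cost t h"
    unfolding n_def by (rule step_bounds[OF t alive]) blast
  have n: "n > 0" using card_X_pos by (simp add: n_def)
  have card: "real (card ?W) = n" by (simp add: card_PiE n_def)
  have "(\<Sum>s\<in>?W. cost (Suc t) (h(Suc t := s))) \<le> (\<Sum>s\<in>?W. cost t h + ?\<eta> * P s + ?\<eta>\<^sup>2 * noise_bound)"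
  proof (intro sum_mono)
    fix s assume "s \<in> ?W"
    then have "?\<eta>\<^sup>2 * V s \<le> ?\<eta>\<^sup>2 * noise_bound" by (intro mult_left_mono PV(2)) auto
    then show "cost (Suc t) (h(Suc t := s)) \<le> cost t h + ?\<eta> * P s + ?\<eta>\<^sup>2 * noise_bound"
      using PV(1)[of s] by linarith
  qed
  also have "\<dots> = n * (cost t h + ?\<eta>\<^sup>2 * noise_bound) + ?\<eta> * (\<Sum>s\<in>?W. P s)"
    by (simp only: sum.distrib sum_constant card sum_distrib_left[symmetric]) (simp add: distrib_left)
  finally have "(\<Sum>s\<in>?W. cost (Suc t) (h(Suc t := s))) / n
      \<le> cost t h + ?\<eta>\<^sup>2 * noise_bound + ?\<eta> * ((\<Sum>s\<in>?W. P s) / n)"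
    using n by (simp add: divide_le_eq distrib_left distrib_right mult_ac)
  also have "\<dots> \<le> cost t h + ?\<eta>\<^sup>2 * noise_bound + ?\<eta> * (- 2 * drift_rate m * cost t h)"
    by (intro add_left_mono mult_left_mono PV(3) lrate_nonneg)
  finally show ?thesis unfolding n_def[symmetric] by (simp add: algebra_simps)
qed

text \<open>Of the drift only the sign is used. The assumption \<open>small\<close> puts the
  fluctuation into the range of \<open>exp_le_quadratic\<close>; after averaging, its square
  survives as the variance term, while the noise is bounded sample by sample.\<close>

lemma average_exp_step:
  assumes t: "i \<le> t" and alive: "alive (Suc t) h" and \<kappa>: "drift_rate m \<ge> 0" and \<theta>: "\<theta> \<ge> 0"
    and small: "(\<theta> * lrate (Suc t))\<^sup>2 * variance_bound \<le> 1"
  shows "(\<Sum>s\<in>{..<m} \<rightarrow>\<^sub>E X. exp (\<theta> * cost (Suc t) (h(Suc t := s)))) / real (card X) ^ m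
    \<le> exp ((lrate (Suc t))\<^sup>2 * (\<theta> * noise_bound + \<theta>\<^sup>2 * variance_bound)) * exp (\<theta> * cost t h)"
proof -
  let ?W = "{..<m} \<rightarrow>\<^sub>E X" and ?\<eta> = "lrate (Suc t)"
  define n where "n = real (card X) ^ m"
  obtain P V where PV:
    "\<And>s. cost (Suc t) (h(Suc t := s)) \<le> cost t h + ?\<eta> * P s + ?\<eta>\<^sup>2 * V s"
    "\<And>s. s \<in> ?W \<Longrightarrow> V s \<le> noise_bound"
    "\<And>s. s \<in> ?W \<Longrightarrow> (P s)\<^sup>2 \<le> variance_bound"
    "(\<Sum>s\<in>?W. P s) / n \<le> - 2 * drift_rate m * cost t h"
    unfolding n_def by (rule step_bounds[OF t alive]) blast
  have n: "n > 0" using card_X_pos by (simp add: n_def)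
  have card: "real (card ?W) = n" by (simp add: card_PiE n_def)
  define e where "e = exp (\<theta> * cost t h + ?\<eta>\<^sup>2 * (\<theta> * noise_bound))"
  define v where "v = (\<theta> * ?\<eta>)\<^sup>2 * variance_bound"
  have "(\<Sum>s\<in>?W. exp (\<theta> * cost (Suc t) (h(Suc t := s)))) \<le> (\<Sum>s\<in>?W. e * (1 + (\<theta> * ?\<eta>) * P s + v))"
  proof (intro sum_mono)
    fix s assume s: "s \<in> ?W"
    let ?x = "\<theta> * ?\<eta> * P s"
    have x2: "?x\<^sup>2 \<le> v"
      unfolding v_def power_mult_distrib[of _ "P s"] using PV(3)[OF s] by (intro mult_left_mono) auto
    then have "?x\<^sup>2 \<le> 1" using small unfolding v_def[symmetric] by linarith
    then have "\<bar>?x\<bar> \<le> 1" by (simp only: abs_square_le_1)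
    then have "exp ?x \<le> 1 + ?x + v" using exp_le_quadratic[of ?x] x2 by linarith
    have "?\<eta>\<^sup>2 * V s \<le> ?\<eta>\<^sup>2 * noise_bound" using s by (intro mult_left_mono PV(2)) auto
    then have "cost (Suc t) (h(Suc t := s)) \<le> cost t h + ?\<eta> * P s + ?\<eta>\<^sup>2 * noise_bound"
      using PV(1)[of s] by linarith
    then have "\<theta> * cost (Suc t) (h(Suc t := s)) \<le> \<theta> * (cost t h + ?\<eta> * P s + ?\<eta>\<^sup>2 * noise_bound)"
      using \<theta> by (rule mult_left_mono)
    also have "\<dots> = (\<theta> * cost t h + ?\<eta>\<^sup>2 * (\<theta> * noise_bound)) + ?x" by (simp only: distrib_left mult_ac add_ac)
    finally have "exp (\<theta> * cost (Suc t) (h(Suc t := s))) \<le> e * exp ?x"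
      unfolding e_def exp_add[symmetric] by (simp only: exp_le_cancel_iff)
    also have "\<dots> \<le> e * (1 + ?x + v)"
      using \<open>exp ?x \<le> 1 + ?x + v\<close> by (intro mult_left_mono) (simp_all add: e_def)
    finally show "exp (\<theta> * cost (Suc t) (h(Suc t := s))) \<le> e * (1 + (\<theta> * ?\<eta>) * P s + v)" .
  qed
  also have "\<dots> = e * (n * (1 + v) + (\<theta> * ?\<eta>) * (\<Sum>s\<in>?W. P s))"
    by (simp only: sum_distrib_left[symmetric] sum.distrib sum_constant card) (simp add: distrib_left)
  also have "\<dots> \<le> e * (n * (1 + v))"
  proof -
    have "(\<Sum>s\<in>?W. P s) / n \<le> 0"
      by (rule order_trans[OF PV(4)]) (use \<kappa> cost_nonneg[of t h] in simp)
    then have "(\<Sum>s\<in>?W. P s) \<le> 0" using n by (simp add: divide_le_0_iff)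
    then have "(\<theta> * ?\<eta>) * (\<Sum>s\<in>?W. P s) \<le> 0"
      using \<theta> lrate_nonneg by (intro mult_nonneg_nonpos mult_nonneg_nonneg) auto
    then show ?thesis by (intro mult_left_mono) (simp_all add: e_def)
  qed
  also have "\<dots> \<le> e * (n * exp v)"
    using n by (intro mult_left_mono exp_ge_add_one_self) (simp_all add: e_def)
  finally have "(\<Sum>s\<in>?W. exp (\<theta> * cost (Suc t) (h(Suc t := s)))) / n \<le> e * exp v"
    using n by (simp add: divide_le_eq mult_ac)
  also have "\<dots> = exp (?\<eta>\<^sup>2 * (\<theta> * noise_bound + \<theta>\<^sup>2 * variance_bound)) * exp (\<theta> * cost t h)"
    unfolding e_def v_def exp_add[symmetric] power_mult_distrib
    by (intro arg_cong[where f = exp]) (simp only: distrib_left mult_ac add_ac)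
  finally show ?thesis unfolding n_def[symmetric] .
qed

text \<open>Survival is a constant factor in the average over the fresh sample. \<open>F\<close> and
  \<open>G\<close> stay general to serve the exponential and the linear estimate alike.\<close>

lemma expected_alive_step:
  assumes t: "i \<le> t" and G: "\<And>h. alive (Suc t) h \<Longrightarrow>
      (\<Sum>s\<in>{..<m} \<rightarrow>\<^sub>E X. F (cost (Suc t) (h(Suc t := s)))) / real (card X) ^ m \<le> G (cost t h)"
  shows "EE (\<lambda>s. F (cost (Suc t) s) * of_bool (alive (Suc t) s)) \<le> EE (\<lambda>s. G (cost t s) * of_bool (alive (Suc t) s))"
proof (rule one_step_expectation[OF t])
  show "determined i m (Suc t) (\<lambda>s. F (cost (Suc t) s) * of_bool (alive (Suc t) s))"
    by (rule determined_apply2[OF determined_cost determined_mono[OF determined_alive]]) simp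
  show "determined i m t (\<lambda>s. G (cost t s) * of_bool (alive (Suc t) s))"
    by (rule determined_apply2[OF determined_cost determined_alive])
  fix h
  have "alive (Suc t) (h(Suc t := s)) = alive (Suc t) h" for s
    by (rule determinedD[OF determined_alive]) simp
  then show "(\<Sum>s\<in>{..<m} \<rightarrow>\<^sub>E X. F (cost (Suc t) (h(Suc t := s))) * of_bool (alive (Suc t) (h(Suc t := s))))
      / real (card X) ^ m \<le> G (cost t h) * of_bool (alive (Suc t) h)"
    using G[of h] by (cases "alive (Suc t) h") simp_all
qed

lemma integrable_alive:
  "integrable M (\<lambda>\<omega>. F (cost t (sampled \<omega>)) * of_bool (alive t (sampled \<omega>)) :: real)"
  "integrable M (\<lambda>\<omega>. F (cost t (sampled \<omega>)) * of_bool (alive (Suc t) (sampled \<omega>)) :: real)"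
  using history_integral(1)[OF determined_apply2[OF determined_cost determined_alive']]
    history_integral(1)[OF determined_apply2[OF determined_cost determined_alive]] .

end

section \<open>Leaving the basin of attraction\<close>

locale skm_run_ignoring = skm_run +
  assumes ignored: "AE \<omega> in M. \<forall>t\<ge>i. alive t (sampled \<omega>) \<longrightarrow> nondegenerate (clusters t (sampled \<omega>)) \<subseteq> targets"
begin

definition alive_prob :: "nat \<Rightarrow> real" where
  "alive_prob t = EE (\<lambda>s. of_bool (alive t s))"

text \<open>While the distance is small and no label outside \<open>targets\<close> is used,
  \<open>Delta_on_no_empty_cluster\<close> gives every target a point; so the only way out is
  through a large distance.\<close>

lemma exit_cost: "AE \<omega> in M. \<forall>t\<ge>i. alive t (sampled \<omega>) \<longrightarrow> \<not> alive (Suc t) (sampled \<omega>) \<longrightarrow> b0 * \<phi>s < cost t (sampled \<omega>)"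
  using ignored
proof eventually_elim
  case (elim \<omega>)
  show ?case
  proof (intro allI impI, rule ccontr)
    fix t assume t: "i \<le> t" "alive t (sampled \<omega>)" "\<not> alive (Suc t) (sampled \<omega>)" "\<not> b0 * \<phi>s < cost t (sampled \<omega>)"
    have "pick t (centroids t (sampled \<omega>)) ` X = targets"
    proof (rule Delta_on_no_empty_cluster)
      show "pick t (centroids t (sampled \<omega>)) ` X \<subseteq> targets"
        using elim t by (simp add: clusters_def nondegenerate_clustering)
      show "Delta_on targets (centroids t (sampled \<omega>)) \<le> b0 * \<phi>s" using t(4) by (simp add: cost_def)
    qed (use ties targets_subset card_targets in auto)
    then show False using t alive_Suc[OF t(1), of "sampled \<omega>"] by (simp add: clusters_def nondegenerate_clustering)
  qed
qed

text \<open>One step of Markov's inequality: almost every run lost between the two events has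
  distance above \<open>b0 * \<phi>s\<close>, so it contributes at least \<open>c\<close> to the
  right-hand side.\<close>

lemma exit_expectation:
  assumes t: "i \<le> t" and F: "\<And>y. b0 * \<phi>s < y \<Longrightarrow> c \<le> F y"
  shows "EE (\<lambda>s. F (cost t s) * of_bool (alive (Suc t) s)) + c * (alive_prob t - alive_prob (Suc t))
    \<le> EE (\<lambda>s. F (cost t s) * of_bool (alive t s))"
proof -
  have int: "integrable M (\<lambda>\<omega>. c * of_bool (alive u (sampled \<omega>)))" for u
    using integrable_alive(1)[of "\<lambda>_. c" u] by simp
  have "EE (\<lambda>s. F (cost t s) * of_bool (alive (Suc t) s)) + c * (alive_prob t - alive_prob (Suc t))
      = EE (\<lambda>s. F (cost t s) * of_bool (alive (Suc t) s)) +
        (EE (\<lambda>s. c * of_bool (alive t s)) - EE (\<lambda>s. c * of_bool (alive (Suc t) s)))"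
    by (simp add: alive_prob_def right_diff_distrib)
  also have "\<dots> = EE (\<lambda>s. F (cost t s) * of_bool (alive (Suc t) s) +
      (c * of_bool (alive t s) - c * of_bool (alive (Suc t) s)))"
    using int integrable_alive(2)[of F t] by simp
  also have "\<dots> \<le> EE (\<lambda>s. F (cost t s) * of_bool (alive t s))"
  proof (rule integral_mono_AE)
    show "AE \<omega> in M. F (cost t (sampled \<omega>)) * of_bool (alive (Suc t) (sampled \<omega>)) +
        (c * of_bool (alive t (sampled \<omega>)) - c * of_bool (alive (Suc t) (sampled \<omega>)))
        \<le> F (cost t (sampled \<omega>)) * of_bool (alive t (sampled \<omega>))"
      using exit_cost
    proof eventually_elim
      case (elim \<omega>)
      then show ?case
        using t F[of "cost t (sampled \<omega>)"] alive_Suc[OF t, of "sampled \<omega>"]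
        by (cases "alive t (sampled \<omega>)"; cases "alive (Suc t) (sampled \<omega>)") auto
    qed
  qed (use int integrable_alive in auto)
  finally show ?thesis .
qed

end

section \<open>A recursion for real numbers\<close>

lemma one_minus_le_powr:
  fixes T \<beta> :: real
  assumes "T > 0" "\<beta> \<ge> 0"
  shows "1 - \<beta> / T \<le> (T / (T + 1)) powr \<beta>"
proof -
  have "ln (1 + 1 / T) \<le> 1 / T" using assms by (intro ln_add_one_self_le_self) simp
  moreover have "ln (T / (T + 1)) = - ln (1 + 1 / T)"
  proof -
    have "T / (T + 1) = inverse (1 + 1 / T)" using assms by (simp add: field_simps)
    then show ?thesis using assms by (simp add: ln_inverse add_pos_pos)
  qed
  ultimately have "- (1 / T) \<le> ln (T / (T + 1))" by linarith
  then have "\<beta> * (- (1 / T)) \<le> \<beta> * ln (T / (T + 1))" using assms(2) by (rule mult_left_mono)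
  then have "exp (- (\<beta> / T)) \<le> (T / (T + 1)) powr \<beta>" using assms by (simp add: powr_def)
  moreover have "1 - \<beta> / T \<le> exp (- (\<beta> / T))" using exp_ge_add_one_self[of "- (\<beta> / T)"] by linarith
  ultimately show ?thesis by linarith
qed

text \<open>The two terms are advanced separately. The power absorbs \<open>1 - \<beta> / T\<close>
  by \<open>one_minus_le_powr\<close>; for the other, \<open>G \<le> (\<beta> - 1) * K\<close>
  reduces the claim to \<open>(T - 1) / T\<^sup>2 \<le> 1 / (T + 1)\<close>. The assumption
  \<open>\<beta> \<le> T\<close> keeps the multiplier of \<open>u\<close> nonnegative.\<close>

lemma decay_recursion:
  fixes T T0 \<beta> D K G u :: real
  assumes T: "T > 0" "T0 > 0" "\<beta> \<le> T" and \<beta>: "\<beta> > 1" and pos: "D \<ge> 0" "G \<ge> 0"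
    and K: "G / (\<beta> - 1) \<le> K" and u: "u \<le> (T0 / T) powr \<beta> * D + K / T"
  shows "(1 - \<beta> / T) * u + G / T\<^sup>2 \<le> (T0 / (T + 1)) powr \<beta> * D + K / (T + 1)"
proof -
  have G: "G \<le> (\<beta> - 1) * K" using K \<beta> by (simp add: divide_le_eq mult.commute)
  have K0: "K \<ge> 0" using K \<beta> pos by (smt (verit) divide_nonneg_pos)
  have "(1 - \<beta> / T) * u \<le> (1 - \<beta> / T) * ((T0 / T) powr \<beta> * D + K / T)"
    using T u by (intro mult_left_mono) auto
  also have "\<dots> = (1 - \<beta> / T) * ((T0 / T) powr \<beta> * D) + (1 - \<beta> / T) * (K / T)"
    by (simp only: distrib_left)
  also have "(1 - \<beta> / T) * ((T0 / T) powr \<beta> * D) \<le> (T / (T + 1)) powr \<beta> * ((T0 / T) powr \<beta> * D)"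
    using T \<beta> pos by (intro mult_right_mono one_minus_le_powr) auto
  also have "\<dots> = (T0 / (T + 1)) powr \<beta> * D"
    using T by (simp add: powr_mult[symmetric])
  finally have "(1 - \<beta> / T) * u + G / T\<^sup>2 \<le> (T0 / (T + 1)) powr \<beta> * D + ((1 - \<beta> / T) * (K / T) + G / T\<^sup>2)"
    by linarith
  moreover have "(1 - \<beta> / T) * (K / T) + G / T\<^sup>2 \<le> K / (T + 1)"
  proof -
    have "(1 - \<beta> / T) * (K / T) + G / T\<^sup>2 = (K * (T - \<beta>) + G) / T\<^sup>2"
      using T by (simp add: field_simps power2_eq_square)
    also have "\<dots> \<le> (K * (T - 1)) / T\<^sup>2"
      using G by (intro divide_right_mono) (auto simp: algebra_simps)
    also have "\<dots> \<le> K / (T + 1)"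
    proof -
      have "K * (T - 1) * (T + 1) \<le> K * T\<^sup>2"
        using K0 by (simp add: algebra_simps power2_eq_square)
      then show ?thesis using T by (simp add: divide_le_eq le_divide_eq)
    qed
    finally show ?thesis .
  qed
  ultimately show ?thesis by linarith
qed

section \<open>Escape probability and mean over the surviving runs\<close>

context skm_run_ignoring
begin

lemma alive_prob_bounds: "0 \<le> alive_prob t" "alive_prob t \<le> 1"
proof -
  have int: "integrable M (\<lambda>\<omega>. of_bool (alive t (sampled \<omega>)) :: real)"
    using integrable_alive(1)[of "\<lambda>_. 1" t] by simp
  show "0 \<le> alive_prob t" unfolding alive_prob_def by (rule integral_nonneg_AE) simp
  have "alive_prob t \<le> expectation (\<lambda>_. 1)" unfolding alive_prob_def using int by (intro integral_mono) auto
  then show "alive_prob t \<le> 1" by (simp add: prob_space)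
qed

lemma alive_prob_init: "alive_prob i = 1"
  by (simp add: alive_prob_def alive_init prob_space)

lemma alive_prob_Suc_le:
  assumes "i \<le> t"
  shows "alive_prob (Suc t) \<le> alive_prob t"
  unfolding alive_prob_def
proof (rule integral_mono)
  show "of_bool (alive (Suc t) (sampled \<omega>)) \<le> (of_bool (alive t (sampled \<omega>)) :: real)" for \<omega>
    using alive_Suc[OF assms] by auto
qed (use integrable_alive(1)[of "\<lambda>_. 1"] in simp_all)

text \<open>A potential argument: lost runs are frozen at the threshold value they exceeded on
  leaving, and the factor \<open>exp (K / (t0 + real t))\<close>, decreasing in \<open>t\<close>,
  pays for the growth that noise and variance cause in each step.\<close>

lemma exponential_supermartingale:
  assumes \<kappa>: "drift_rate m \<ge> 0" and \<theta>: "\<theta> \<ge> 0"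
    and small: "\<And>t. (\<theta> * lrate (Suc t))\<^sup>2 * variance_bound \<le> 1"
    and K: "K = c'\<^sup>2 * (\<theta> * noise_bound + \<theta>\<^sup>2 * variance_bound)" and t: "i \<le> t"
  shows "exp (\<theta> * (b0 * \<phi>s)) * (1 - alive_prob t)
      + exp (K / (t0 + real t)) * EE (\<lambda>s. exp (\<theta> * cost t s) * of_bool (alive t s))
    \<le> exp (K / (t0 + real i)) * exp (\<theta> * Di)"
  using t
proof (induction t rule: dec_induct)
  case base
  show ?case by (simp add: alive_prob_init cost_init alive_init prob_space)
next
  case (step t)
  let ?c = "exp (\<theta> * (b0 * \<phi>s))" and ?F = "\<lambda>y. exp (\<theta> * y)"
  let ?x = "\<lambda>t. EE (\<lambda>s. ?F (cost t s) * of_bool (alive t s))"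
  let ?x' = "EE (\<lambda>s. ?F (cost t s) * of_bool (alive (Suc t) s))"
  define q where "q = (lrate (Suc t))\<^sup>2 * (\<theta> * noise_bound + \<theta>\<^sup>2 * variance_bound)"
  define T where "T = t0 + real t"
  have T: "T > 0" "t0 + real (Suc t) = T + 1" using t0_pos by (simp_all add: T_def)
  have K0: "K \<ge> 0"
    unfolding K using \<theta> b0_pos cost_pos by simp
  have q: "q = K / (T + 1)\<^sup>2"
    unfolding q_def K lrate_def T(2) by (simp add: power_divide)
  have "?x (Suc t) \<le> EE (\<lambda>s. (exp q * ?F (cost t s)) * of_bool (alive (Suc t) s))"
    unfolding q_def by (rule expected_alive_step[OF step(1), where F = ?F and G = "\<lambda>y. exp _ * ?F y"])
      (rule average_exp_step[OF step(1) _ \<kappa> \<theta> small])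
  also have "\<dots> = exp q * ?x'" by (simp add: mult.assoc)
  finally have x_Suc: "?x (Suc t) \<le> exp q * ?x'" .
  have x'_nonneg: "?x' \<ge> 0" by (rule integral_nonneg_AE) simp
  have exit: "?x' + ?c * (alive_prob t - alive_prob (Suc t)) \<le> ?x t"
    using \<theta> by (intro exit_expectation[OF step(1), where F = ?F]) (simp add: mult_left_mono)
  \<comment> \<open>Telescoping bound for the squared learning rates:
    \<open>1 / (T + 1)\<^sup>2 \<le> 1 / T - 1 / (T + 1)\<close>.\<close>
  have "1 / (T + 1)\<^sup>2 + 1 / (T + 1) \<le> 1 / T"
  proof -
    have "1 / (T + 1) = (T + 1) / (T + 1)\<^sup>2"
      using T(1) by (simp add: power2_eq_square)
    then have "1 / (T + 1)\<^sup>2 + 1 / (T + 1) = (T + 2) / (T + 1)\<^sup>2"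
      by (simp add: add_divide_distrib[symmetric])
    also have "\<dots> \<le> 1 / T"
    proof -
      have "(T + 2) * T \<le> (T + 1)\<^sup>2" by (simp add: power2_eq_square algebra_simps)
      then show ?thesis using T(1) by (simp add: pos_divide_le_eq pos_le_divide_eq)
    qed
    finally show ?thesis .
  qed
  then have "K * (1 / (T + 1)\<^sup>2 + 1 / (T + 1)) \<le> K * (1 / T)" using K0 by (rule mult_left_mono)
  then have exps: "exp (K / (T + 1)) * exp q \<le> exp (K / T)"
    unfolding q exp_add[symmetric] by (simp add: algebra_simps)
  have "exp (K / (T + 1)) * ?x (Suc t) \<le> exp (K / (T + 1)) * (exp q * ?x')"
    by (intro mult_left_mono x_Suc) simp
  also have "\<dots> \<le> exp (K / T) * ?x'"
    unfolding mult.assoc[symmetric] by (intro mult_right_mono exps x'_nonneg)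
  also have "\<dots> \<le> exp (K / T) * (?x t - ?c * (alive_prob t - alive_prob (Suc t)))"
    using exit by (intro mult_left_mono) auto
  \<comment> \<open>Lost mass enters the potential with weight 1 in place of
    \<open>exp (K / T)\<close>; it is nonnegative, so subtracting less of it keeps the
    inequality.\<close>
  also have "\<dots> \<le> exp (K / T) * ?x t - ?c * (alive_prob t - alive_prob (Suc t))"
  proof -
    have "1 * (?c * (alive_prob t - alive_prob (Suc t))) \<le> exp (K / T) * (?c * (alive_prob t - alive_prob (Suc t)))"
      using K0 T alive_prob_Suc_le[OF step(1)] by (intro mult_right_mono) auto
    then show ?thesis by (simp add: right_diff_distrib)
  qed
  finally have "?c * (1 - alive_prob (Suc t)) + exp (K / (T + 1)) * ?x (Suc t) \<le> ?c * (1 - alive_prob t) + exp (K / T) * ?x t"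
    by (simp add: algebra_simps)
  then show ?case using step.IH unfolding T(2) T_def[symmetric] by linarith
qed

lemma escape_probability:
  assumes \<delta>: "0 < \<delta>" "\<delta> \<le> 1 / exp 1" and \<kappa>: "drift_rate m \<ge> 0" and c': "c' \<ge> 1"
    and offset: "t0 \<ge> 768 * c'\<^sup>2 * (1 + 1 / b0)\<^sup>2 * (real (card X))\<^sup>2 * (ln (1 / \<delta>))\<^sup>2"
    and start: "Di \<le> 1/2 * b0 * \<phi>s" and t: "i \<le> t"
  shows "1 - \<delta> \<le> alive_prob t"
proof -
  define L n c where "L = ln (1 / \<delta>)" and "n = real (card X)" and "c = 1 + 1 / b0"
  have "exp 1 \<le> 1 / \<delta>" using \<delta> by (simp add: field_simps)
  then have L: "L \<ge> 1" unfolding L_def using \<delta> by (subst ln_ge_iff) auto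
  have n: "n \<ge> 1" using card_X_pos by (simp add: n_def)
  have c: "c \<ge> 1" using b0_pos by (simp add: c_def)
  have offset': "768 * (c'\<^sup>2 * (c\<^sup>2 * (n\<^sup>2 * L\<^sup>2))) \<le> t0"
    using offset by (simp add: c_def n_def L_def mult_ac)
  have prod: "c'\<^sup>2 * (c * (n * L\<^sup>2)) \<le> c'\<^sup>2 * (c\<^sup>2 * (n\<^sup>2 * L\<^sup>2))"
    using n c by (intro mult_left_mono mult_mono) (auto simp: power2_eq_square)
  have prod1: "1 \<le> c'\<^sup>2 * (c * (n * L\<^sup>2))"
  proof -
    have "1 * (1 * (1 * 1)) \<le> c'\<^sup>2 * (c * (n * L\<^sup>2))"
      using n c c' L by (intro mult_mono) auto
    then show ?thesis by simp
  qed
  have t0_ge: "768 * (c'\<^sup>2 * (c * (n * L\<^sup>2))) \<le> t0" using prod offset' by linarith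
  have t0_1: "t0 \<ge> 1" using t0_ge prod1 by linarith
  \<comment> \<open>With this \<theta>, leaving the basin means an exponent above
    \<open>4 * L\<close>, and the start has at most \<open>2 * L\<close>. The compensator adds at
    most \<open>1 \<le> L\<close>, and the remaining \<open>L\<close> becomes the factor
    \<delta>.\<close>
  define \<theta> where "\<theta> = 4 * L / (b0 * \<phi>s)"
  have \<theta>: "\<theta> > 0" "\<theta> * (b0 * \<phi>s) = 4 * L"
    using L b0_pos cost_pos by (simp_all add: \<theta>_def)
  have \<theta>_noise: "\<theta> * noise_bound = 4 * (c * (n * L))"
    using b0_pos cost_pos by (simp add: \<theta>_def c_def n_def field_simps)
  have \<theta>_var: "\<theta>\<^sup>2 * variance_bound = 64 * (c * (n * L\<^sup>2))"
    using b0_pos cost_pos by (simp add: \<theta>_def c_def n_def field_simps power2_eq_square)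
  define K where "K = c'\<^sup>2 * (\<theta> * noise_bound + \<theta>\<^sup>2 * variance_bound)"
  \<comment> \<open>As \<open>L \<ge> 1\<close>, both contributions are brought to the same power of
    \<open>L\<close>, with 4 + 64 = 68; the offset then gives \<open>K \<le> t0\<close>, so the
    compensator is at most 1.\<close>
  have "n * L \<le> n * L\<^sup>2" using L n by (simp add: power2_eq_square)
  then have "c * (n * L) \<le> c * (n * L\<^sup>2)" by (rule mult_left_mono) (use c in simp)
  then have "\<theta> * noise_bound + \<theta>\<^sup>2 * variance_bound \<le> 68 * (c * (n * L\<^sup>2))"
    unfolding \<theta>_noise \<theta>_var by linarith
  then have "K \<le> c'\<^sup>2 * (68 * (c * (n * L\<^sup>2)))"
    unfolding K_def by (intro mult_left_mono) auto
  then have K: "K \<le> t0" using t0_ge prod1 by simp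
  have K0: "K \<ge> 0" unfolding K_def using \<theta> b0_pos cost_pos by simp
  have small: "(\<theta> * lrate (Suc t))\<^sup>2 * variance_bound \<le> 1" for t
  proof -
    let ?T = "t0 + real (Suc t)"
    have T: "?T \<ge> t0" "?T \<ge> 1" using t0_1 by simp_all
    have "(\<theta> * lrate (Suc t))\<^sup>2 * variance_bound = c'\<^sup>2 * (\<theta>\<^sup>2 * variance_bound) / ?T\<^sup>2"
      by (simp add: lrate_def power_mult_distrib power_divide)
    also have "\<dots> \<le> t0 / ?T\<^sup>2"
      unfolding \<theta>_var using t0_ge prod1 by (intro divide_right_mono) auto
    also have "\<dots> \<le> 1"
    proof -
      have "t0 * 1 \<le> ?T * ?T" using T t0_1 by (intro mult_mono) auto
      then show ?thesis using T by (simp add: power2_eq_square divide_le_eq)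
    qed
    finally show ?thesis .
  qed
  have "0 \<le> exp (K / (t0 + real t)) * EE (\<lambda>s. exp (\<theta> * cost t s) * of_bool (alive t s))"
    by (intro mult_nonneg_nonneg integral_nonneg_AE) simp_all
  moreover have "exp (4 * L) * (1 - alive_prob t) + exp (K / (t0 + real t)) * EE (\<lambda>s. exp (\<theta> * cost t s) * of_bool (alive t s))
      \<le> exp (K / (t0 + real i) + \<theta> * Di)"
    using exponential_supermartingale[OF \<kappa> _ small K_def t] \<theta>(1) unfolding \<theta>(2) exp_add by simp
  ultimately have "exp (4 * L) * (1 - alive_prob t) \<le> exp (K / (t0 + real i) + \<theta> * Di)" by linarith
  also have "\<dots> \<le> exp (1 + 2 * L)"
  proof -
    have "K / (t0 + real i) \<le> 1" using K t0_1 by (simp add: divide_le_eq)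
    moreover have "\<theta> * Di \<le> \<theta> * (1/2 * b0 * \<phi>s)" using start \<theta>(1) by (intro mult_left_mono) auto
    moreover have "\<theta> * (1/2 * b0 * \<phi>s) = 2 * L" using \<theta>(2) by simp
    ultimately show ?thesis by simp
  qed
  also have "\<dots> \<le> exp (4 * L + - L)" using L by simp
  also have "\<dots> = exp (4 * L) * \<delta>"
    unfolding exp_add using \<delta> by (simp add: L_def ln_div exp_minus)
  finally show ?thesis by simp
qed

text \<open>The mean is renormalised by the survival probability at every step, so that each step
  has the form of \<open>decay_recursion\<close> with \<open>u\<close> the mean over the runs that
  survive into it.\<close>

lemma conditional_mean_bound:
  assumes p_pos: "\<And>t. i \<le> t \<Longrightarrow> alive_prob t > 0" and \<beta>: "\<beta> > 1" "\<beta> \<le> t0" "\<beta> \<le> 2 * c' * drift_rate m"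
    and K: "c'\<^sup>2 * noise_bound / (\<beta> - 1) \<le> K" and t: "i \<le> t"
  shows "EE (\<lambda>s. cost t s * of_bool (alive t s)) / alive_prob t
    \<le> ((t0 + real i + 1) / (t0 + real t + 1)) powr \<beta> * Di + K / (t0 + real t + 1)"
  using t
proof (induction t rule: dec_induct)
  case base
  have "0 \<le> c'\<^sup>2 * noise_bound / (\<beta> - 1)" using \<beta> b0_pos cost_pos by simp
  then have "K \<ge> 0" using K by linarith
  then show ?case using t0_pos by (simp add: alive_prob_init cost_init alive_init prob_space)
next
  case (step t)
  let ?e = "EE (\<lambda>s. cost t s * of_bool (alive t s))"
  let ?e' = "EE (\<lambda>s. cost t s * of_bool (alive (Suc t) s))"
  \<comment> \<open>\<open>T\<close> is the denominator of the learning rate in the step from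
    \<open>t\<close> to \<open>Suc t\<close>, hence the \<open>+ 1\<close> in the claimed
    bound.\<close>
  define T T0 where "T = t0 + real t + 1" and "T0 = t0 + real i + 1"
  have T: "T > 0" "\<beta> \<le> T" "t0 + real (Suc t) + 1 = T + 1" "t0 + real (Suc t) = T"
    using t0_pos \<beta> by (simp_all add: T_def)
  have p: "alive_prob t > 0" "alive_prob (Suc t) > 0" "alive_prob (Suc t) \<le> alive_prob t"
    using p_pos alive_prob_Suc_le step(1) by auto
  have "\<beta> / T \<le> 2 * c' * drift_rate m / T"
    using \<beta>(3) T(1) by (intro divide_right_mono) auto
  then have rate: "\<beta> / T \<le> 2 * lrate (Suc t) * drift_rate m"
    unfolding lrate_def T(4) by simp
  have noise: "(lrate (Suc t))\<^sup>2 * noise_bound = c'\<^sup>2 * noise_bound / T\<^sup>2"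
    unfolding lrate_def T(4) by (simp add: power_divide)
  have int: "integrable M (\<lambda>\<omega>. of_bool (alive (Suc t) (sampled \<omega>)) :: real)"
    "integrable M (\<lambda>\<omega>. cost t (sampled \<omega>) * of_bool (alive (Suc t) (sampled \<omega>)))"
    using integrable_alive(1)[of "\<lambda>_. 1" "Suc t"] integrable_alive(2)[of "\<lambda>y. y" t] by simp_all
  have e'_nonneg: "?e' \<ge> 0" by (rule integral_nonneg_AE) (simp add: cost_nonneg)
  have "EE (\<lambda>s. cost (Suc t) s * of_bool (alive (Suc t) s))
      \<le> EE (\<lambda>s. ((1 - 2 * lrate (Suc t) * drift_rate m) * cost t s + (lrate (Suc t))\<^sup>2 * noise_bound) * of_bool (alive (Suc t) s))"
    by (rule expected_alive_step[OF step(1), where F = "\<lambda>y. y" and G = "\<lambda>y. (1 - _) * y + _"])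
      (rule average_step[OF step(1)])
  also have "\<dots> = (1 - 2 * lrate (Suc t) * drift_rate m) * ?e' + (lrate (Suc t))\<^sup>2 * noise_bound * alive_prob (Suc t)"
    using int by (simp add: distrib_right mult.assoc alive_prob_def)
  also have "\<dots> \<le> (1 - \<beta> / T) * ?e' + c'\<^sup>2 * noise_bound / T\<^sup>2 * alive_prob (Suc t)"
    unfolding noise using rate e'_nonneg by (intro add_right_mono mult_right_mono) auto
  finally have "EE (\<lambda>s. cost (Suc t) s * of_bool (alive (Suc t) s)) / alive_prob (Suc t)
      \<le> ((1 - \<beta> / T) * ?e' + c'\<^sup>2 * noise_bound / T\<^sup>2 * alive_prob (Suc t)) / alive_prob (Suc t)"
    using p by (intro divide_right_mono) auto
  also have "\<dots> = (1 - \<beta> / T) * (?e' / alive_prob (Suc t)) + c'\<^sup>2 * noise_bound / T\<^sup>2"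
    using p by (simp add: add_divide_distrib)
  also have "\<dots> \<le> (T0 / (T + 1)) powr \<beta> * Di + K / (T + 1)"
  proof (rule decay_recursion[OF T(1) _ T(2) \<beta>(1) _ _ K])
    show "T0 > 0" using t0_pos by (simp add: T0_def)
    show "Di \<ge> 0" using cost_nonneg[of i] by (simp add: cost_init)
    show "0 \<le> c'\<^sup>2 * noise_bound" using b0_pos cost_pos by simp
    \<comment> \<open>Write \<open>p\<close>, \<open>p'\<close> for the survival probabilities at
      \<open>t\<close> and \<open>Suc t\<close>, and \<open>c\<close> for
      \<open>b0 * \<phi>s\<close>. From \<open>e' + c * (p - p') \<le> e\<close> and
      \<open>e' \<le> c * p'\<close> follows
      \<open>e' * p \<le> p' * (e' + c * (p - p')) \<le> e * p'\<close>, which compares the two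
      conditional means.\<close>
    have "?e' + b0 * \<phi>s * (alive_prob t - alive_prob (Suc t)) \<le> ?e"
      by (rule exit_expectation[OF step(1), where F = "\<lambda>y. y"]) simp
    moreover have "?e' \<le> b0 * \<phi>s * alive_prob (Suc t)"
    proof -
      have "?e' \<le> EE (\<lambda>s. b0 * \<phi>s * of_bool (alive (Suc t) s))"
        using int alive_Suc[OF step(1)] by (intro integral_mono) auto
      then show ?thesis by (simp add: alive_prob_def)
    qed
    then have "?e' * (alive_prob t - alive_prob (Suc t)) \<le> b0 * \<phi>s * alive_prob (Suc t) * (alive_prob t - alive_prob (Suc t))"
      using p by (intro mult_right_mono) auto
    moreover have "(?e' + b0 * \<phi>s * (alive_prob t - alive_prob (Suc t))) * alive_prob (Suc t) \<le> ?e * alive_prob (Suc t)"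
      using calculation(1) p by (intro mult_right_mono) auto
    ultimately have "?e' * alive_prob t \<le> ?e * alive_prob (Suc t)" by (simp add: algebra_simps)
    then have "?e' / alive_prob (Suc t) \<le> ?e / alive_prob t" using p by (simp add: field_simps)
    also have "\<dots> \<le> (T0 / T) powr \<beta> * Di + K / T" using step.IH by (simp add: T_def T0_def)
    finally show "?e' / alive_prob (Suc t) \<le> (T0 / T) powr \<beta> * Di + K / T" .
  qed
  finally show ?case unfolding T(3) T0_def .
qed

end

theorem theorem3:
  fixes X :: "(real^'d) set"
    and cs Ci :: "nat \<Rightarrow> real^'d"
    and As :: "nat \<Rightarrow> (real^'d) set"
    and n ks k m i :: nat
    and \<delta> b0 \<alpha> \<beta> c' t0 \<phi>s B :: real
    and pick :: "nat \<Rightarrow> (nat \<Rightarrow> real^'d) \<Rightarrow> real^'d \<Rightarrow> nat"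
    and M :: "'w measure"
    and S :: "nat \<Rightarrow> nat \<Rightarrow> 'w \<Rightarrow> real^'d"
    and C :: "nat \<Rightarrow> 'w \<Rightarrow> nat \<Rightarrow> real^'d"
    and A :: "nat \<Rightarrow> 'w \<Rightarrow> nat \<Rightarrow> (real^'d) set"
    and D :: "nat \<Rightarrow> 'w \<Rightarrow> real"
    and Ai :: "nat \<Rightarrow> (real^'d) set"
    and Di :: real
    and \<Omega> :: "nat \<Rightarrow> 'w set"
  assumes delta: "0 < \<delta>" "\<delta> \<le> 1 / exp 1"
    and X: "finite X" "card X = n"
    and phi_star: "\<phi>s = kmeans_cost X ks cs" "\<phi>s > 0"
    and stability: "b0 > 0" "0 \<le> \<alpha>" "\<alpha> < 1" "stable X ks cs As b0 \<alpha>"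
    and batch: "m \<ge> 1" "real m > ln (1 - sqrt \<alpha>) / ln (1 - 4/5 * p_min X ks As)"
    and rate: "\<beta> \<ge> 2" "c' > \<beta> / (2 * (1 - sqrt \<alpha> - (1 - 4/5 * p_min X ks As) ^ m))"
    and offset: "t0 \<ge> 768 * c'\<^sup>2 * (1 + 1 / b0)\<^sup>2 * (real n)\<^sup>2 * (ln (1 / \<delta>))\<^sup>2"
    and ties: "\<And>t c x. x \<in> X \<Longrightarrow> closest k c x (pick t c x)"
    and sampling: "prob_space M" "uniform_samples M X m i S"
    and C: "C = (\<lambda>t \<omega>. skm m (\<lambda>t r. c' / (t0 + real t)) pick i Ci (\<lambda>t l. S t l \<omega>) t)"
    and A: "A = (\<lambda>t \<omega>. clustering_of X (pick t (C t \<omega>)))"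
    and D: "D = (\<lambda>t \<omega>. Delta ks cs As k (C t \<omega>) (A t \<omega>))"
    and \<Omega>: "\<Omega> = (\<lambda>t. {\<omega> \<in> space M. \<forall>j. i \<le> j \<and> j < t \<longrightarrow> comparable ks (A j \<omega>) \<and> D j \<omega> \<le> b0 * \<phi>s})"
    and Ai: "Ai = clustering_of X (pick i Ci)"
    and Di: "Di = Delta ks cs As k Ci Ai"
    and start: "comparable ks Ai" "Di \<le> 1/2 * b0 * \<phi>s"
    \<comment> \<open>Centroids that are degenerate at iteration \<open>i\<close> stay out of play as long as the run is in \<open>\<Omega>\<close>;
      if \<open>k = ks\<close> there are none and this holds trivially.\<close>
    and ignored: "AE \<omega> in M. \<forall>t\<ge>i. \<omega> \<in> \<Omega> t \<longrightarrow> nondegenerate (A t \<omega>) \<subseteq> nondegenerate Ai"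
    and B: "B = 4 * (b0 + 1) * real n * \<phi>s"
  shows "\<forall>t>i. measure M (\<Omega> t) \<ge> 1 - \<delta> \<and>
           event_expectation M (D t) (\<Omega> t)
             \<le> ((t0 + real i + 1) / (t0 + real t + 1)) powr \<beta> * Di
               + c'\<^sup>2 * B / (\<beta> - 1) * ((t0 + real i + 2) / (t0 + real i + 1)) powr (\<beta> + 1)
                 * (1 / (t0 + real t + 1))"
proof -
  interpret prob_space M by (rule sampling(1))
  interpret stable_clustering X ks cs As b0 \<alpha>
    by unfold_locales (use X phi_star stability in simp_all)
  let ?q = "1 - 4/5 * p_min X ks As"
  have q: "0 < ?q" "?q < 1" using p_min_bounds by linarith+
  \<comment> \<open>As \<open>ln ?q < 0\<close>, clearing the denominator reverses the condition on
    \<open>m\<close>, which becomes \<open>?q ^ m < 1 - sqrt \<alpha>\<close>.\<close>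
  have \<kappa>: "drift_rate m > 0"
  proof -
    have "real m * ln ?q < ln (1 - sqrt \<alpha>)"
      using batch(2) q by (simp add: neg_divide_less_eq)
    moreover have "0 < 1 - sqrt \<alpha>" using \<alpha> by simp
    ultimately have "?q ^ m < 1 - sqrt \<alpha>"
      using q by (simp add: ln_realpow[symmetric])
    then show ?thesis by (simp add: drift_rate_def)
  qed
  have drift_le_1: "drift_rate m \<le> 1"
  proof -
    have "0 \<le> ?q ^ m" "0 \<le> sqrt \<alpha>" using q \<alpha>(1) by simp_all
    then show ?thesis unfolding drift_rate_def by linarith
  qed
  have c'_drift: "\<beta> < 2 * c' * drift_rate m"
    using rate(2) \<kappa> unfolding drift_rate_def[symmetric] by (simp add: pos_divide_less_eq mult_ac)
  have c': "c' \<ge> 1"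
  proof (rule ccontr)
    assume "\<not> c' \<ge> 1"
    have "c' > 0" using c'_drift rate(1) \<kappa> by (smt (verit) mult_nonpos_nonneg)
    then have "c' * drift_rate m \<le> 1 * 1"
      using \<open>\<not> c' \<ge> 1\<close> drift_le_1 \<kappa> by (intro mult_mono) auto
    then show False using c'_drift rate(1) by linarith
  qed
  \<comment> \<open>The factors of the offset other than \<open>768 * c'\<^sup>2\<close> are at
    least 1, and \<open>\<beta> \<le> 2 * c'\<close>. This keeps \<open>1 - \<beta> / T\<close>
    nonnegative throughout the recursion.\<close>
  have beta_t0: "\<beta> \<le> t0"
  proof -
    have "1 \<le> ln (1 / \<delta>)" using delta by (subst ln_ge_iff) (auto simp: field_simps)
    moreover have "1 \<le> real n" using X X_nonempty by (cases n) auto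
    moreover have "1 \<le> 1 + 1 / b0" using stability(1) by simp
    ultimately have "1 * 1 * 1 * c'\<^sup>2 \<le> (1 + 1 / b0)\<^sup>2 * (real n)\<^sup>2 * (ln (1 / \<delta>))\<^sup>2 * c'\<^sup>2"
      by (intro mult_mono mult_right_mono one_le_power) auto
    then have "768 * c'\<^sup>2 \<le> t0" using offset by (simp add: mult_ac)
    moreover have "c' * 1 \<le> c' * c'" using c' by (intro mult_left_mono) auto
    moreover have "\<beta> \<le> 2 * c' * 1"
    proof -
      have "2 * c' * drift_rate m \<le> 2 * c' * 1"
        using c' drift_le_1 by (intro mult_left_mono) auto
      then show ?thesis using c'_drift by linarith
    qed
    ultimately show ?thesis using c' unfolding power2_eq_square by linarith
  qed
  interpret uniform_sampling M X m i S
    by unfold_locales (use X X_nonempty sampling in simp_all)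
  have nd_Ai: "nondegenerate Ai = pick i Ci ` X" by (simp add: Ai nondegenerate_clustering)
  interpret run: skm_run X ks cs As b0 \<alpha> M m i S k pick Ci c' t0
    by unfold_locales (use ties start(1) c' beta_t0 rate(1) in \<open>simp_all add: comparable_def nd_Ai\<close>)
  have C_eq: "C t \<omega> = run.centroids t (sampled \<omega>)" for t \<omega>
    by (simp add: C run.centroids_def sampled_def)
  have A_eq: "A t \<omega> = run.clusters t (sampled \<omega>)" for t \<omega>
    by (simp add: A C_eq run.clusters_def)
  have N_eq: "nondegenerate Ai = run.targets" by (simp add: nd_Ai run.targets_def)
  have D_comparable: "D t \<omega> = run.cost t (sampled \<omega>)" if "nondegenerate (A t \<omega>) = run.targets" for t \<omega>
    using that by (simp add: D C_eq run.cost_def Delta_comparable comparable_def run.card_targets)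
  have Di_eq: "Di = run.Di"
    using start(1) by (simp add: Di run.Di_def Delta_comparable N_eq)
  define good where "good \<omega> \<longleftrightarrow> (\<forall>t\<ge>i. \<omega> \<in> \<Omega> t \<longrightarrow> nondegenerate (A t \<omega>) \<subseteq> run.targets)" for \<omega>
  have AE_good: "AE \<omega> in M. good \<omega>"
    using ignored by (simp add: good_def N_eq)
  have \<Omega>_alive: "\<omega> \<in> \<Omega> t \<longleftrightarrow> run.alive t (sampled \<omega>)" if \<omega>: "\<omega> \<in> space M" "good \<omega>" for t \<omega>
  proof
    assume mem: "\<omega> \<in> \<Omega> t"
    show "run.alive t (sampled \<omega>)"
      unfolding run.alive_def
    proof (intro allI impI)
      fix j assume j: "i \<le> j \<and> j < t"
      then have "\<omega> \<in> \<Omega> j" using mem by (auto simp: \<Omega>)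
      then have "nondegenerate (A j \<omega>) \<subseteq> run.targets" using \<omega>(2) j by (auto simp: good_def)
      moreover have "card (nondegenerate (A j \<omega>)) = ks" using mem j by (auto simp: \<Omega> comparable_def)
      ultimately have nd: "nondegenerate (A j \<omega>) = run.targets"
        using run.finite_targets run.card_targets by (intro card_seteq) auto
      have "D j \<omega> \<le> b0 * \<phi>s" using mem j by (auto simp: \<Omega>)
      then show "nondegenerate (run.clusters j (sampled \<omega>)) = run.targets \<and> run.cost j (sampled \<omega>) \<le> b0 * kmeans_cost X ks cs"
        using nd D_comparable[OF nd] by (simp add: A_eq phi_star)
    qed
  next
    assume alive: "run.alive t (sampled \<omega>)"
    have "comparable ks (A j \<omega>) \<and> D j \<omega> \<le> b0 * \<phi>s" if j: "i \<le> j \<and> j < t" for j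
    proof -
      have nd: "nondegenerate (A j \<omega>) = run.targets" "run.cost j (sampled \<omega>) \<le> b0 * \<phi>s"
        using alive j by (auto simp: run.alive_def A_eq phi_star)
      then show ?thesis using D_comparable[OF nd(1)] by (simp add: comparable_def run.card_targets)
    qed
    then show "\<omega> \<in> \<Omega> t" using \<omega>(1) by (auto simp: \<Omega>)
  qed
  \<comment> \<open>\<open>\<Omega> t\<close> constrains only iterations before \<open>t\<close>, so
    at \<open>t\<close> itself the clustering may fail to be comparable; the fallback of
    \<open>Delta\<close> then minimises over more matchings and is no larger.\<close>
  have D_le: "D t \<omega> \<le> run.cost t (sampled \<omega>)" if \<omega>: "good \<omega>" "\<omega> \<in> \<Omega> t" "i \<le> t" for t \<omega>
  proof (cases "comparable ks (A t \<omega>)")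
    case True
    have "nondegenerate (A t \<omega>) \<subseteq> run.targets" using \<omega> by (auto simp: good_def)
    then have "nondegenerate (A t \<omega>) = run.targets"
      using True run.finite_targets run.card_targets by (intro card_seteq) (auto simp: comparable_def)
    then show ?thesis by (simp add: D_comparable)
  next
    case False
    have "Delta_on {..<k} (C t \<omega>) \<le> Delta_on run.targets (C t \<omega>)"
      using run.targets_subset run.card_targets by (intro Delta_on_antimono) auto
    then show ?thesis using False by (simp add: D Delta_not_comparable run.cost_def C_eq)
  qed
  interpret run: skm_run_ignoring X ks cs As b0 \<alpha> M m i S k pick Ci c' t0
  proof unfold_locales
    show "AE \<omega> in M. \<forall>t\<ge>i. run.alive t (sampled \<omega>) \<longrightarrow> nondegenerate (run.clusters t (sampled \<omega>)) \<subseteq> run.targets"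
      using AE_good AE_space
    proof eventually_elim
      case (elim \<omega>)
      then show ?case using \<Omega>_alive[OF elim(2,1)] by (auto simp: good_def A_eq)
    qed
  qed
  \<comment> \<open>\<open>pick\<close> is an arbitrary function, so measurability of
    \<open>\<Omega> t\<close> and of \<open>D t\<close> is obtained by exhibiting both as functions
    of the finite history.\<close>
  define R where "R t s \<longleftrightarrow> (\<forall>j. i \<le> j \<and> j < t \<longrightarrow> comparable ks (run.clusters j s) \<and>
      Delta ks cs As k (run.centroids j s) (run.clusters j s) \<le> b0 * \<phi>s)" for t s
  have R: "\<Omega> t = {\<omega> \<in> space M. R t (sampled \<omega>)}" for t
    by (simp add: \<Omega> R_def A_eq D C_eq)
  have det_R: "determined i m t (R t)" for t
  proof (rule determinedI)
    fix s s' :: "nat \<Rightarrow> nat \<Rightarrow> real^'d"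
    assume eq: "\<And>j l. i < j \<Longrightarrow> j \<le> t \<Longrightarrow> l < m \<Longrightarrow> s j l = s' j l"
    have "run.centroids j s = run.centroids j s'" if "j < t" for j
      by (rule determinedD[OF run.determined_centroids]) (use eq that in simp)
    then show "R t s = R t s'" by (simp add: R_def run.clusters_def)
  qed
  define Dh where "Dh t s = Delta ks cs As k (run.centroids t s) (run.clusters t s)" for t s
  have det_D: "determined i m t (Dh t)" for t
    unfolding Dh_def run.clusters_def by (rule determined_apply[OF run.determined_centroids])
  have D_eq: "D t \<omega> = Dh t (sampled \<omega>)" for t \<omega>
    by (simp add: D Dh_def C_eq A_eq)
  have meas_R: "(\<lambda>\<omega>. of_bool (R t (sampled \<omega>)) :: real) \<in> borel_measurable M" for t
    by (rule borel_measurable_integrable[OF history_integral(1)[OF determined_apply[OF det_R]]])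
  have sets_\<Omega>: "\<Omega> t \<in> events" for t
  proof -
    have "\<Omega> t = (\<lambda>\<omega>. of_bool (R t (sampled \<omega>)) :: real) -` {1} \<inter> space M"
      by (auto simp: R)
    then show ?thesis using measurable_sets[OF meas_R, of "{1}"] by simp
  qed
  have prob_\<Omega>: "prob (\<Omega> t) = run.alive_prob t" for t
  proof -
    have "prob (\<Omega> t) = expectation (indicator (\<Omega> t))"
      using sets_\<Omega>[of t] sets.sets_into_space by (simp add: Int_absorb2)
    also have "\<dots> = run.alive_prob t"
      unfolding run.alive_prob_def
    proof (rule integral_cong_AE)
      show "AE \<omega> in M. indicator (\<Omega> t) \<omega> = (of_bool (run.alive t (sampled \<omega>)) :: real)"
        using AE_good AE_space
      proof eventually_elim
        case (elim \<omega>)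
        then show ?case using \<Omega>_alive[OF elim(2,1), of t] by (simp add: indicator_def)
      qed
      show "(\<lambda>\<omega>. of_bool (run.alive t (sampled \<omega>)) :: real) \<in> borel_measurable M"
        by (rule borel_measurable_integrable[OF history_integral(1)[OF determined_apply[OF run.determined_alive']]])
    qed (use sets_\<Omega> in simp)
    finally show ?thesis .
  qed
  have prob_bound: "1 - \<delta> \<le> run.alive_prob t" if "i \<le> t" for t
    using run.escape_probability[OF delta _ c' _ _ that] \<kappa> offset start(2)
    by (simp add: X(2) Di_eq phi_star)
  have \<delta>_less: "\<delta> < 1"
    using delta(2) exp_gt_one[of "1::real"] by (smt (verit) divide_less_eq_1_pos)
  show ?thesis
  proof (intro allI impI conjI)
    fix t assume t: "i < t"
    show "measure M (\<Omega> t) \<ge> 1 - \<delta>" using prob_bound[of t] t by (simp add: prob_\<Omega>)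
    let ?ratio = "((t0 + real i + 2) / (t0 + real i + 1)) powr (\<beta> + 1)"
    have "(LINT \<omega>:\<Omega> t|M. D t \<omega>) \<le> expectation (\<lambda>\<omega>. run.cost t (sampled \<omega>) * of_bool (run.alive t (sampled \<omega>)))"
      unfolding set_lebesgue_integral_def
    proof (rule integral_mono_AE)
      have "integrable M (\<lambda>\<omega>. of_bool (R t (sampled \<omega>)) * Dh t (sampled \<omega>))"
        by (rule history_integral(1)[OF determined_apply2[OF det_R det_D]])
      then show "integrable M (\<lambda>\<omega>. indicat_real (\<Omega> t) \<omega> *\<^sub>R D t \<omega>)"
        by (rule Bochner_Integration.integrable_cong[THEN iffD1, rotated 2]) (auto simp: R D_eq)
      show "integrable M (\<lambda>\<omega>. run.cost t (sampled \<omega>) * of_bool (run.alive t (sampled \<omega>)))"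
        using run.integrable_alive(1)[of "\<lambda>y. y"] by simp
      show "AE \<omega> in M. indicat_real (\<Omega> t) \<omega> *\<^sub>R D t \<omega> \<le> run.cost t (sampled \<omega>) * of_bool (run.alive t (sampled \<omega>))"
        using AE_good AE_space
      proof eventually_elim
        case (elim \<omega>)
        then show ?case
          using \<Omega>_alive[OF elim(2,1), of t] D_le[OF elim(1), of t] t by (cases "\<omega> \<in> \<Omega> t") simp_all
      qed
    qed
    then have "event_expectation M (D t) (\<Omega> t)
        \<le> expectation (\<lambda>\<omega>. run.cost t (sampled \<omega>) * of_bool (run.alive t (sampled \<omega>))) / run.alive_prob t"
      unfolding event_expectation_def prob_\<Omega> by (intro divide_right_mono run.alive_prob_bounds)
    also have "\<dots> \<le> ((t0 + real i + 1) / (t0 + real t + 1)) powr \<beta> * run.Di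
        + c'\<^sup>2 * B / (\<beta> - 1) * ?ratio / (t0 + real t + 1)"
    proof (rule run.conditional_mean_bound)
      show "0 < run.alive_prob j" if "i \<le> j" for j using prob_bound[OF that] \<delta>_less by linarith
      have B_nonneg: "0 \<le> B" using stability(1) phi_star by (simp add: B)
      \<comment> \<open>\<open>B\<close> is four times the noise bound and the ratio is at least 1,
        so the constant of the theorem is an admissible \<open>K\<close>.\<close>
      have "real (card X) * (1 + b0) * kmeans_cost X ks cs \<le> B"
        using stability(1) phi_star by (simp add: B X(2) algebra_simps)
      then have "c'\<^sup>2 * (real (card X) * (1 + b0) * kmeans_cost X ks cs) / (\<beta> - 1) \<le> c'\<^sup>2 * B / (\<beta> - 1) * 1"
        using rate(1) by (simp add: divide_right_mono mult_left_mono)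
      also have "\<dots> \<le> c'\<^sup>2 * B / (\<beta> - 1) * ?ratio"
        using rate(1) beta_t0 B_nonneg by (intro mult_left_mono ge_one_powr_ge_zero) auto
      finally show "c'\<^sup>2 * (real (card X) * (1 + b0) * kmeans_cost X ks cs) / (\<beta> - 1) \<le> c'\<^sup>2 * B / (\<beta> - 1) * ?ratio" .
    qed (use rate beta_t0 c'_drift t in auto)
    finally show "event_expectation M (D t) (\<Omega> t)
             \<le> ((t0 + real i + 1) / (t0 + real t + 1)) powr \<beta> * Di
               + c'\<^sup>2 * B / (\<beta> - 1) * ((t0 + real i + 2) / (t0 + real i + 1)) powr (\<beta> + 1)
                 * (1 / (t0 + real t + 1))"
      by (simp add: Di_eq)
  qed
qed

end
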